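(* For all $(n,m)\in\mathbb{Z}^2$ and all $\xi\in(0,\infty)$, $$P_{-\frac16+n}^{\frac14+m}(\cosh\xi)=2^{-2m-3n}\,\Gamma(\tfrac34-m)^{-1}\,(\sinh\xi)^{-1/4-m}\,A_+^{1/4+3m+3n}\,r^m_n(-A_-/A_+),$$ $$P_{-\frac16+n}^{-\frac14-m}(\cosh\xi)=(-1)^n\,2^{-2m-3n}\,3^{3/4+3m}\,\Gamma(\tfrac54+m)^{-1}\,(\sinh\xi)^{-1/4-m}\,A_-^{1/4+3m+3n}\,\hat r^m_n(-A_+/A_-),$$ where $P_\nu^\mu$ is the associated Legendre function of the first kind, $A_\pm=A_\pm(\xi)$ are the positive functions $$A_\pm(\xi)=\pm\cosh(\xi/3)+\sqrt{\frac{4\cosh^2(\xi/3)-1}{3}},$$ and $r^m_n$, $\hat r^m_n$ are the octahedral functions and their rescalings defined in the context.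
   Context: For $z>1$, $P_\nu^\mu(z)=\frac1{\Gamma(1-\mu)}\left(\frac{z+1}{z-1}\right)^{\mu/2}{}_2F_1\!\left(-\nu,\nu+1;1-\mu;\frac{1-z}2\right)$, with ${}_2F_1$ the (analytically continued) Gauss function. The rising factorial is extended to all integers $k$: $(d)_k=d(d+1)\cdots(d+k-1)$ for $k\ge0$ and $(d)_k=[(d-k')\cdots(d-1)]^{-1}$ for $k=-k'\le0$. Octahedral functions: let $p_{\rm v}(u)=u(1-u)^4$, $p_{\rm e}(u)=(1+u)(1-34u+u^2)$, $p_{\rm f}(u)=1+14u+u^2$, and $R(u)=-108\,p_{\rm v}(u)/p_{\rm e}(u)^2=1-p_{\rm f}(u)^3/p_{\rm e}(u)^2$. For $(n,m)\in\mathbb{Z}^2$, $r^m_n$ is the rational function of $u$ that on a neighborhood of $u=0$ satisfies $${}_2F_1\!\left(-\tfrac1{24}-\tfrac m2-\tfrac n2,\ \tfrac{11}{24}-\tfrac m2-\tfrac n2;\ \tfrac34-m;\ R(u)\right)=p_{\rm e}(u)^{-1/12-m-n}\,r^m_n(u)$$ (with powers of $p_{\rm e}(u)$ equal to $1$ at $u=0$). One has $r^m_n(0)=1$, and $r^m_n(u)\sim d^m_nu^{3n+2m}$ as $u\to\infty$, where $d^m_n=(-1)^{m+n}3^{3m}\frac{(5/12)_{m-n}(13/12)_{m+n}}{(1/4)_m(5/4)_m}$. The rescaled function is $\hat r^m_n:=r^m_n/d^m_n$. *)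

theory Defs
  imports "HOL-Complex_Analysis.Complex_Analysis"
begin

text \<open>
  The analytically continued Gauss function, principal branch. The library's formal series
  \<^const>\<open>fps_hypergeo\<close> is continued along the segment from \<open>0\<close> to \<open>z\<close>: \<open>S\<close> ranges over open
  sets that are star-shaped about \<open>0\<close>. Two such sets have a connected intersection, so by the
  identity theorem the value at \<open>z\<close> does not depend on \<open>S\<close>. For \<open>z\<close> outside the cut
  \<open>[1, \<infinity>)\<close> and \<open>c\<close> not a nonpositive integer such a continuation exists, since the slit
  plane is itself star-shaped about \<open>0\<close>.
\<close>

definition gauss_hypgeo :: "complex \<Rightarrow> complex \<Rightarrow> complex \<Rightarrow> complex \<Rightarrow> complex" where
  "gauss_hypgeo a b c z =
     (THE w. \<exists>S f. open S \<and> 0 \<in> S \<and> z \<in> S \<and> (\<forall>x\<in>S. closed_segment 0 x \<subseteq> S) \<and>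
        f holomorphic_on S \<and>
        (\<forall>\<^sub>F x in nhds 0. f x = eval_fps (fps_hypergeo [a, b] [c] 1) x) \<and> w = f z)"

text \<open>
  The associated Legendre function of the first kind for argument \<open>z > 1\<close>, with degree \<open>\<nu>\<close> and
  order \<open>\<mu>\<close>. The formula is meaningful as it stands when \<open>\<mu>\<close> is not a positive integer; the
  limiting values at positive integers \<open>\<mu>\<close> are not built in.
\<close>

definition legendre_P :: "complex \<Rightarrow> complex \<Rightarrow> real \<Rightarrow> complex" where
  "legendre_P \<nu> \<mu> z =
     1 / Gamma (1 - \<mu>) * complex_of_real ((z + 1) / (z - 1)) powr (\<mu> / 2) *
     gauss_hypgeo (- \<nu>) (\<nu> + 1) (1 - \<mu>) (complex_of_real ((1 - z) / 2))"

text \<open>For \<open>k = -k' \<le> 0\<close> the value is \<open>1 / ((d - k') \<cdots> (d - 1))\<close>.\<close>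

definition rising_fact :: "real \<Rightarrow> int \<Rightarrow> real" where
  "rising_fact d k =
     (if k \<ge> 0 then pochhammer d (nat k)
      else inverse (pochhammer (d + of_int k) (nat (- k))))"

definition oct_pv :: "complex \<Rightarrow> complex" where
  "oct_pv u = u * (1 - u) ^ 4"

definition oct_pe :: "complex \<Rightarrow> complex" where
  "oct_pe u = (1 + u) * (1 - 34 * u + u ^ 2)"

definition oct_pf :: "complex \<Rightarrow> complex" where
  "oct_pf u = 1 + 14 * u + u ^ 2"

definition oct_R :: "complex \<Rightarrow> complex" where
  "oct_R u = - 108 * oct_pv u / oct_pe u ^ 2"

lemma oct_R_altdef:
  assumes "oct_pe u \<noteq> 0"
  shows "oct_R u = 1 - oct_pf u ^ 3 / oct_pe u ^ 2"
proof -
  have "- 108 * oct_pv u = oct_pe u ^ 2 - oct_pf u ^ 3"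
    unfolding oct_pv_def oct_pe_def oct_pf_def by algebra
  thus ?thesis using assms by (simp add: oct_R_def diff_divide_distrib)
qed

text \<open>
  A rational function is represented by the function induced by its reduced fraction \<open>p / q\<close>
  (with value \<open>0\<close> at the poles, as \<open>x / 0 = 0\<close>), which makes it determined by its values near
  \<open>0\<close>. The principal power of \<^term>\<open>oct_pe u\<close> is the branch equal to \<open>1\<close> at \<open>u = 0\<close>.
\<close>

definition oct_r :: "int \<Rightarrow> int \<Rightarrow> complex \<Rightarrow> complex" where
  "oct_r n m =
     (THE r. (\<exists>p q :: complex poly. q \<noteq> 0 \<and> coprime p q \<and> r = (\<lambda>u. poly p u / poly q u)) \<and>
        (\<forall>\<^sub>F u in nhds 0.
           gauss_hypgeo (- 1 / 24 - of_int m / 2 - of_int n / 2)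
                        (11 / 24 - of_int m / 2 - of_int n / 2)
                        (3 / 4 - of_int m) (oct_R u) =
           oct_pe u powr (- 1 / 12 - of_int m - of_int n) * r u))"

definition oct_d :: "int \<Rightarrow> int \<Rightarrow> real" where
  "oct_d n m =
     (- 1) powi (m + n) * 3 powi (3 * m) *
     (rising_fact (5 / 12) (m - n) * rising_fact (13 / 12) (m + n)) /
     (rising_fact (1 / 4) m * rising_fact (5 / 4) m)"

definition oct_r_hat :: "int \<Rightarrow> int \<Rightarrow> complex \<Rightarrow> complex" where
  "oct_r_hat n m u = oct_r n m u / complex_of_real (oct_d n m)"

definition A_plus :: "real \<Rightarrow> real" where
  "A_plus \<xi> = cosh (\<xi> / 3) + sqrt ((4 * cosh (\<xi> / 3) ^ 2 - 1) / 3)"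

definition A_minus :: "real \<Rightarrow> real" where
  "A_minus \<xi> = - cosh (\<xi> / 3) + sqrt ((4 * cosh (\<xi> / 3) ^ 2 - 1) / 3)"

end

theory Submission
  imports Defs
begin

text \<open>
  Let \<open>z = cosh \<xi>\<close>. The octahedral parametrization of \<open>R = 1 - z\<^sup>-\<^sup>2\<close> by \<open>u\<close> turns the Legendre
  operator \<open>(z\<^sup>2 - 1) d/dz\<close> into \<open>2 u (1 - u) p\<^sub>f\<^sup>-\<^sup>1\<^sup>/\<^sup>2 d/du\<close>. Conjugating away the algebraic prefactor
  of \<open>P\<^sub>\<nu>\<^sup>\<mu>\<close>, one obtains the operator \<open>oct_op \<nu> \<mu>\<close> with polynomial coefficients, and Legendre's
  equation becomes \<open>oct_ode\<close>. The degree and order ladder operators of the Legendre functions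
  become operators on rational functions of \<open>u\<close>, so starting from the solutions \<open>1\<close> at
  \<open>(-1/6, 1/4)\<close> and \<open>1/(1 - u)\<close> at \<open>(-1/6, -1/4)\<close> one reaches a rational solution, regular and
  equal to \<open>1\<close> at \<open>u = 0\<close>, for every pair \<open>(-1/6 + n, \<plusminus>(1/4 + m))\<close>. The substitution
  \<open>u \<mapsto> 1/u\<close> exchanges the orders \<open>\<mu>\<close> and \<open>-\<mu>\<close>; following it along the ladders yields \<open>d\<^sup>m\<^sub>n\<close>.

  Near \<open>u = 0\<close> the solution with value \<open>1\<close> is unique, which identifies it with both
  hypergeometric functions: the one in \<open>R\<close> that defines \<open>r\<^sup>m\<^sub>n\<close>, and the one in \<open>x = (1 - z)/2\<close>
  that defines \<open>P\<^sub>\<nu>\<^sup>\<mu>\<close>. The latter identity then persists along the whole ray \<open>x \<le> 0\<close>, because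
  \<open>cosh (\<xi>/3)\<close>, and hence \<open>u = -A\<^sub>-/A\<^sub>+\<close>, is holomorphic in \<open>z\<close> near \<open>z \<ge> 1\<close>.
\<close>

section \<open>The Legendre equation in the octahedral parameter\<close>

text \<open>At degree -1/6 and order 1/4 the hypergeometric equation in R has exponent differences
  1/4, 1/3, 1/2 at 0, 1 and infinity, those of the octahedral triangle; this is the source of
  algebraic solutions. With u = t^4, \<open>oct_pv\<close> is the fourth power of the vertex form t
  (1 - t^4), while \<open>oct_pe\<close> and \<open>oct_pf\<close> are the edge and face forms, and
  \<open>oct_pf_cube\<close> is their syzygy. The prefactors of the Legendre functions are
  multivalued. Conjugating them away makes the ladders statements about rational functions; roots
  and complex powers return only near u = 0 and along the ray in x. At u = 0 the local exponents are
  0 and \<mu>, so the solution with value 1 is unique only if \<mu> is not a natural number; all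
  orders here lie in 1/4 + Z or -1/4 + Z. The number d relates u = 0 to u = infinity and cannot be
  read off a local expansion. For this reason solutions of order \<mu> and -\<mu> are carried up and
  down the ladders as a pair.\<close>

definition oct_dom :: "complex set" where
  "oct_dom = {u. u \<noteq> 1 \<and> oct_pf u \<noteq> 0}"

text \<open>
  With \<open>z\<^sup>2 - 1 = -108 p\<^sub>v/p\<^sub>f\<^sup>3\<close> and \<open>\<phi> = u\<^sup>-\<^sup>\<mu>\<^sup>/\<^sup>2 (1 - u)\<^sup>-\<^sup>2\<^sup>\<mu> p\<^sub>f\<^sup>-\<^sup>3\<^sup>\<nu>\<^sup>/\<^sup>2\<close>, this is
  \<open>p\<^sub>f\<^sup>3\<^sup>/\<^sup>2 \<phi>\<^sup>-\<^sup>1 (z\<^sup>2 - 1) d/dz \<phi>\<close>. The factor \<open>p\<^sub>f\<^sup>3\<^sup>/\<^sup>2\<close> keeps the coefficients polynomial; it is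
  absorbed by \<open>\<nu> \<mapsto> \<nu> + 1\<close>, which is why iterates are taken with shifted degree.
\<close>

definition oct_op :: "complex \<Rightarrow> complex \<Rightarrow> (complex \<Rightarrow> complex) \<Rightarrow> complex \<Rightarrow> complex" where
  "oct_op \<nu> \<mu> y u = 2 * u * (1 - u) * oct_pf u * deriv y u
     - (\<mu> * oct_pe u + 6 * (\<nu> + \<mu>) * u * (1 - u) * (7 + u)) * y u"

text \<open>With D = (z^2 - 1) d/dz, Legendre's equation reads D^2 w = (\<mu>^2 + \<nu> (\<nu> + 1)
  (z^2 - 1)) w. The two operators together contribute the factor \<open>oct_pf u ^ 3\<close>, which
  turns z^2 - 1 into \<open>- 108 * oct_pv u\<close>.\<close>

definition oct_ode :: "complex set \<Rightarrow> complex \<Rightarrow> complex \<Rightarrow> (complex \<Rightarrow> complex) \<Rightarrow> bool" where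
  "oct_ode A \<nu> \<mu> y \<longleftrightarrow> y holomorphic_on A \<and>
     (\<forall>u\<in>A. oct_op (\<nu> + 1) \<mu> (oct_op \<nu> \<mu> y) u =
        (\<mu> ^ 2 * oct_pf u ^ 3 - 108 * \<nu> * (\<nu> + 1) * oct_pv u) * y u)"

lemma oct_pf_cube: "oct_pf u ^ 3 = oct_pe u ^ 2 + 108 * oct_pv u"
  unfolding oct_pv_def oct_pe_def oct_pf_def by algebra

text \<open>The left side is \<open>2 * u * (1 - u) * oct_pf u\<close> times the logarithmic
  derivative of the square root of \<open>oct_pv\<close>. Raising \<mu> by one divides
  \<open>\<phi>\<close> by this root, hence the same bracket in
  \<open>oct_op_shift_mu\<close>.\<close>

lemma oct_pf_eq: "oct_pf u * (1 - 5 * u) = oct_pe u + 6 * u * (1 - u) * (7 + u)"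
  unfolding oct_pe_def oct_pf_def by algebra

lemma has_field_derivative_oct_pe [derivative_intros]:
  "(f has_field_derivative f') (at z within A) \<Longrightarrow>
   ((\<lambda>z. oct_pe (f z)) has_field_derivative (- 33 - 66 * f z + 3 * f z ^ 2) * f') (at z within A)"
  unfolding oct_pe_def by (auto intro!: derivative_eq_intros simp: algebra_simps power2_eq_square)

lemma has_field_derivative_oct_pf [derivative_intros]:
  "(f has_field_derivative f') (at z within A) \<Longrightarrow>
   ((\<lambda>z. oct_pf (f z)) has_field_derivative (14 + 2 * f z) * f') (at z within A)"
  unfolding oct_pf_def by (auto intro!: derivative_eq_intros simp: algebra_simps power2_eq_square)

lemma has_field_derivative_oct_pv [derivative_intros]:
  "(f has_field_derivative f') (at z within A) \<Longrightarrow>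
   ((\<lambda>z. oct_pv (f z)) has_field_derivative (1 - f z) ^ 3 * (1 - 5 * f z) * f') (at z within A)"
  unfolding oct_pv_def
  by (rule derivative_eq_intros refl | assumption)+ (simp add: algebra_simps power_numeral_reduce)

lemma holomorphic_on_oct_polys [holomorphic_intros]:
  assumes "f holomorphic_on A"
  shows "(\<lambda>z. oct_pe (f z)) holomorphic_on A" "(\<lambda>z. oct_pf (f z)) holomorphic_on A"
    "(\<lambda>z. oct_pv (f z)) holomorphic_on A"
  using assms unfolding oct_pe_def oct_pf_def oct_pv_def by (auto intro!: holomorphic_intros)

lemma open_oct_dom [simp]: "open oct_dom"
proof -
  have "open ({u. u \<noteq> (1::complex)} \<inter> {u. oct_pf u \<noteq> 0})"
    by (intro open_Int open_Collect_neq) (auto simp: oct_pf_def intro!: continuous_intros)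
  thus ?thesis by (simp add: oct_dom_def Collect_conj_eq)
qed

lemma zero_in_oct_dom [simp]: "0 \<in> oct_dom"
  by (simp add: oct_dom_def oct_pf_def)

lemma oct_op_holomorphic [holomorphic_intros]:
  assumes "y holomorphic_on A" "open A"
  shows "oct_op \<nu> \<mu> y holomorphic_on A"
proof -
  have "(\<lambda>u. oct_op \<nu> \<mu> y u) holomorphic_on A"
    unfolding oct_op_def by (intro holomorphic_intros assms)
  thus ?thesis by simp
qed

lemma oct_op_cong:
  assumes "open A" "\<And>u. u \<in> A \<Longrightarrow> y u = g u" "u \<in> A"
  shows "oct_op \<nu> \<mu> y u = oct_op \<nu> \<mu> g u"
proof -
  have "deriv y u = deriv g u"
    using assms by (intro deriv_cong_ev) (auto intro: eventually_nhds_in_open elim: eventually_mono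
       simp: eventually_nhds)
  thus ?thesis using assms by (simp add: oct_op_def)
qed

lemma oct_op_eq:
  assumes "(y has_field_derivative y') (at u)"
  shows "oct_op \<nu> \<mu> y u = 2 * u * (1 - u) * oct_pf u * y'
     - (\<mu> * oct_pe u + 6 * (\<nu> + \<mu>) * u * (1 - u) * (7 + u)) * y u"
  using DERIV_imp_deriv[OF assms] by (simp add: oct_op_def)

section \<open>Product rules for the conjugated operator\<close>

context
  fixes A :: "complex set" and y g :: "complex \<Rightarrow> complex" and u :: complex
  assumes A: "open A" "u \<in> A" and y: "y holomorphic_on A" and g: "g holomorphic_on A"
begin

lemma deriv_of_holomorphic_pair: "(y has_field_derivative deriv y u) (at u)" "(g has_field_derivative deriv g u) (at u)"
  using A y g by (auto intro: holomorphic_derivI)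

lemma oct_op_linear:
  "oct_op \<nu> \<mu> (\<lambda>u. a * y u + b * g u) u = a * oct_op \<nu> \<mu> y u + b * oct_op \<nu> \<mu> g u"
  by (subst oct_op_eq) (rule derivative_eq_intros deriv_of_holomorphic_pair refl | simp add: oct_op_def algebra_simps)+

text \<open>\<open>oct_pe\<close> stands for z: the factor p_f^(3/2) between them is absorbed by the
  shift of the degree. What remains is the Leibniz rule with D z = z^2 - 1.\<close>

lemma oct_op_pe:
  "oct_op (\<nu> + 1) \<mu> (\<lambda>u. oct_pe u * y u) u = oct_pe u * oct_op \<nu> \<mu> y u - 108 * oct_pv u * y u"
  by (subst oct_op_eq, (rule derivative_eq_intros deriv_of_holomorphic_pair refl)+)
     (simp add: oct_op_def oct_pe_def oct_pf_def oct_pv_def, algebra)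

text \<open>The cube of \<open>oct_pf\<close> turns \<open>\<phi>\<close> of degree
  \<open>\<nu> + 2\<close> into \<open>\<phi>\<close> of degree \<nu>, so the factor passes through
  the operator without a derivative term. \<open>oct_op_pv\<close> is the analogue for the
  order.\<close>

lemma oct_op_pf3:
  "oct_op (\<nu> + 2) \<mu> (\<lambda>u. oct_pf u ^ 3 * y u) u = oct_pf u ^ 3 * oct_op \<nu> \<mu> y u"
  by (subst oct_op_eq, (rule derivative_eq_intros deriv_of_holomorphic_pair refl)+)
     (simp add: oct_op_def oct_pe_def, algebra)

lemma oct_op_pv:
  "oct_op \<nu> (\<mu> + 2) (\<lambda>u. oct_pv u * y u) u = oct_pv u * oct_op \<nu> \<mu> y u"
  by (subst oct_op_eq, (rule derivative_eq_intros deriv_of_holomorphic_pair refl)+)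
     (simp add: oct_op_def oct_pv_def oct_pe_def oct_pf_def, algebra)

end

lemma oct_op_shift_nu: "oct_op (\<nu> + 1) \<mu> y u = oct_op \<nu> \<mu> y u - 6 * u * (1 - u) * (7 + u) * y u"
  by (simp add: oct_op_def algebra_simps)

lemma oct_op_shift_mu:
  "oct_op \<nu> (\<mu> + 1) y u = oct_op \<nu> \<mu> y u - (oct_pe u + 6 * u * (1 - u) * (7 + u)) * y u"
  by (simp add: oct_op_def algebra_simps)

section \<open>The degree ladder\<close>

context
  fixes A :: "complex set" and y g :: "complex \<Rightarrow> complex" and \<nu> \<mu> \<gamma> :: complex
  assumes A: "open A" and ode: "oct_ode A \<nu> \<mu> y" and \<gamma>: "\<gamma> * (\<gamma> - 1) = \<nu> * (\<nu> + 1)"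
    and g: "\<And>u. u \<in> A \<Longrightarrow> g u = oct_op \<nu> \<mu> y u + \<gamma> * oct_pe u * y u"
begin

lemma nu_step_holomorphic: "y holomorphic_on A" "g holomorphic_on A"
proof -
  show y: "y holomorphic_on A" using ode by (simp add: oct_ode_def)
  have "(\<lambda>u. oct_op \<nu> \<mu> y u + \<gamma> * oct_pe u * y u) holomorphic_on A"
    by (intro holomorphic_intros y A)
  thus "g holomorphic_on A" using g by (subst holomorphic_cong[OF refl]) auto
qed

text \<open>For w = \<open>\<phi>\<close> y, \<open>g\<close> represents D w + \<gamma> z w. The
  condition on \<gamma> has the roots \<nu> + 1 and -\<nu>, belonging to the raising and the
  lowering operator, so one computation serves both.\<close>

lemma nu_step_first_order:
  assumes u: "u \<in> A"
  shows "oct_op (\<nu> + 1) \<mu> g u = \<gamma> * oct_pe u * g u + (\<mu> ^ 2 - \<gamma> ^ 2) * oct_pf u ^ 3 * y u"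
proof -
  have "oct_op (\<nu> + 1) \<mu> g u =
      oct_op (\<nu> + 1) \<mu> (\<lambda>u. 1 * oct_op \<nu> \<mu> y u + \<gamma> * (oct_pe u * y u)) u"
    by (rule oct_op_cong[OF A _ u]) (simp add: g)
  also have "\<dots> = oct_op (\<nu> + 1) \<mu> (oct_op \<nu> \<mu> y) u + \<gamma> * oct_op (\<nu> + 1) \<mu> (\<lambda>u. oct_pe u * y u) u"
    by (subst oct_op_linear[OF A u]) (auto intro!: holomorphic_intros nu_step_holomorphic A)
  also have "\<dots> = (\<mu> ^ 2 * oct_pf u ^ 3 - 108 * \<nu> * (\<nu> + 1) * oct_pv u) * y u +
      \<gamma> * (oct_pe u * oct_op \<nu> \<mu> y u - 108 * oct_pv u * y u)"
    using ode u by (subst oct_op_pe[OF A u nu_step_holomorphic(1)]) (auto simp: oct_ode_def intro!: holomorphic_intros)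
  also have "oct_op \<nu> \<mu> y u = g u - \<gamma> * oct_pe u * y u"
    using g[OF u] by simp
  also have "(\<mu> ^ 2 * oct_pf u ^ 3 - 108 * \<nu> * (\<nu> + 1) * oct_pv u) * y u +
      \<gamma> * (oct_pe u * (g u - \<gamma> * oct_pe u * y u) - 108 * oct_pv u * y u) =
     \<gamma> * oct_pe u * g u + (\<mu> ^ 2 - \<gamma> ^ 2) * oct_pf u ^ 3 * y u"
    using \<gamma> oct_pf_cube[of u] by algebra
  finally show ?thesis .
qed

text \<open>The equation obtained has degree \<gamma>, but its operators carry \<nu> + 1 for either
  root. For \<gamma> = -\<nu>, where \<gamma> (\<gamma> + 1) = (\<nu> - 1) \<nu>, the prefactor is
  therefore off by \<open>oct_pf u ^ 3\<close>, which \<open>oct_sol_nu_down\<close> divides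
  out.\<close>

lemma nu_step_second_order:
  assumes u: "u \<in> A"
  shows "oct_op (\<nu> + 2) \<mu> (oct_op (\<nu> + 1) \<mu> g) u =
      (\<mu> ^ 2 * oct_pf u ^ 3 - 108 * \<gamma> * (\<gamma> + 1) * oct_pv u) * g u"
proof -
  have "oct_op (\<nu> + 2) \<mu> (oct_op (\<nu> + 1) \<mu> g) u =
      oct_op (\<nu> + 2) \<mu> (\<lambda>u. \<gamma> * (oct_pe u * g u) + (\<mu> ^ 2 - \<gamma> ^ 2) * (oct_pf u ^ 3 * y u)) u"
    by (rule oct_op_cong[OF A _ u]) (simp add: nu_step_first_order)
  also have "\<dots> = \<gamma> * oct_op (\<nu> + 1 + 1) \<mu> (\<lambda>u. oct_pe u * g u) u +
      (\<mu> ^ 2 - \<gamma> ^ 2) * oct_op (\<nu> + 2) \<mu> (\<lambda>u. oct_pf u ^ 3 * y u) u"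
    by (subst oct_op_linear[OF A u]) (auto intro!: holomorphic_intros nu_step_holomorphic simp: add.assoc)
  also have "\<dots> = \<gamma> * (oct_pe u * oct_op (\<nu> + 1) \<mu> g u - 108 * oct_pv u * g u) +
      (\<mu> ^ 2 - \<gamma> ^ 2) * (oct_pf u ^ 3 * oct_op \<nu> \<mu> y u)"
    by (subst oct_op_pe[OF A u nu_step_holomorphic(2)], rule nu_step_holomorphic, subst oct_op_pf3[OF A u nu_step_holomorphic(1)], rule nu_step_holomorphic) simp
  also have "oct_op \<nu> \<mu> y u = g u - \<gamma> * oct_pe u * y u"
    using g[OF u] by simp
  also note nu_step_first_order[OF u]
  also have "\<gamma> * (oct_pe u * (\<gamma> * oct_pe u * g u + (\<mu>\<^sup>2 - \<gamma>\<^sup>2) * oct_pf u ^ 3 * y u) - 108 * oct_pv u * g u) +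
      (\<mu>\<^sup>2 - \<gamma>\<^sup>2) * (oct_pf u ^ 3 * (g u - \<gamma> * oct_pe u * y u)) =
      (\<mu> ^ 2 * oct_pf u ^ 3 - 108 * \<gamma> * (\<gamma> + 1) * oct_pv u) * g u"
    using oct_pf_cube[of u] by algebra
  finally show ?thesis .
qed

end

section \<open>The order ladder\<close>

context
  fixes A :: "complex set" and y g :: "complex \<Rightarrow> complex" and \<nu> \<mu> \<beta> :: complex
  assumes A: "open A" and ode: "oct_ode A \<nu> \<mu> y" and \<beta>: "\<beta> ^ 2 = \<mu> ^ 2"
    and g: "\<And>u. u \<in> A \<Longrightarrow> g u = oct_op \<nu> \<mu> y u - \<beta> * oct_pe u * y u"
begin

lemma mu_step_holomorphic: "y holomorphic_on A" "g holomorphic_on A"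
proof -
  show y: "y holomorphic_on A" using ode by (simp add: oct_ode_def)
  have "(\<lambda>u. oct_op \<nu> \<mu> y u - \<beta> * oct_pe u * y u) holomorphic_on A"
    by (intro holomorphic_intros y A)
  thus "g holomorphic_on A" using g by (subst holomorphic_cong[OF refl]) auto
qed

text \<open>Dividing D w - \<beta> z w by the square root of z^2 - 1 shifts the order, up for
  \<beta> = \<mu> and down for \<beta> = -\<mu>. That division is not visible in \<open>g\<close>:
  it is the change from \<mu> to \<mu> + 1 in \<open>\<phi>\<close>.\<close>

lemma mu_step_first_order:
  assumes u: "u \<in> A"
  shows "oct_op \<nu> (\<mu> + 1) g u = - (\<beta> + 1) * oct_pe u * g u
      - 108 * (\<nu> - \<beta>) * (\<nu> + \<beta> + 1) * oct_pv u * y u"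
proof -
  have "oct_op (\<nu> + 1) \<mu> g u =
      oct_op (\<nu> + 1) \<mu> (\<lambda>u. 1 * oct_op \<nu> \<mu> y u + (- \<beta>) * (oct_pe u * y u)) u"
    by (rule oct_op_cong[OF A _ u]) (simp add: g)
  also have "\<dots> = oct_op (\<nu> + 1) \<mu> (oct_op \<nu> \<mu> y) u - \<beta> * oct_op (\<nu> + 1) \<mu> (\<lambda>u. oct_pe u * y u) u"
    by (subst oct_op_linear[OF A u]) (auto intro!: holomorphic_intros mu_step_holomorphic A)
  also have "\<dots> = (\<mu> ^ 2 * oct_pf u ^ 3 - 108 * \<nu> * (\<nu> + 1) * oct_pv u) * y u -
      \<beta> * (oct_pe u * oct_op \<nu> \<mu> y u - 108 * oct_pv u * y u)"
    using ode u by (subst oct_op_pe[OF A u mu_step_holomorphic(1)]) (auto simp: oct_ode_def intro!: holomorphic_intros)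
  also have "oct_op \<nu> \<mu> y u = g u + \<beta> * oct_pe u * y u"
    using g[OF u] by simp
  finally have "oct_op (\<nu> + 1) \<mu> g u = (\<mu>\<^sup>2 * oct_pf u ^ 3 - 108 * \<nu> * (\<nu> + 1) * oct_pv u) * y u -
    \<beta> * (oct_pe u * (g u + \<beta> * oct_pe u * y u) - 108 * oct_pv u * y u)" .
  hence "oct_op \<nu> (\<mu> + 1) g u = (\<mu>\<^sup>2 * oct_pf u ^ 3 - 108 * \<nu> * (\<nu> + 1) * oct_pv u) * y u -
    \<beta> * (oct_pe u * (g u + \<beta> * oct_pe u * y u) - 108 * oct_pv u * y u) - oct_pe u * g u"
    unfolding oct_op_shift_mu oct_op_shift_nu by (simp add: algebra_simps)
  thus ?thesis using oct_pf_cube[of u] \<beta> by algebra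
qed

text \<open>For \<beta> = -\<mu> the equation is that of order \<mu> - 1 while the operators carry
  \<mu> + 1; \<open>oct_sol_mu_down\<close> repairs this by dividing by
  \<open>oct_pv\<close>.\<close>

lemma mu_step_second_order:
  assumes u: "u \<in> A"
  shows "oct_op (\<nu> + 1) (\<mu> + 1) (oct_op \<nu> (\<mu> + 1) g) u =
      ((\<beta> + 1) ^ 2 * oct_pf u ^ 3 - 108 * \<nu> * (\<nu> + 1) * oct_pv u) * g u"
proof -
  have "oct_op (\<nu> + 1) (\<mu> + 1) (oct_op \<nu> (\<mu> + 1) g) u =
      oct_op (\<nu> + 1) (\<mu> + 1) (\<lambda>u. (- (\<beta> + 1)) * (oct_pe u * g u) +
         (- 108 * (\<nu> - \<beta>) * (\<nu> + \<beta> + 1)) * (oct_pv u * y u)) u"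
    by (rule oct_op_cong[OF A _ u], subst mu_step_first_order, assumption, algebra)
  also have "\<dots> = (- (\<beta> + 1)) * oct_op (\<nu> + 1) (\<mu> + 1) (\<lambda>u. oct_pe u * g u) u +
         (- 108 * (\<nu> - \<beta>) * (\<nu> + \<beta> + 1)) * oct_op (\<nu> + 1) (\<mu> + 1) (\<lambda>u. oct_pv u * y u) u"
    by (subst oct_op_linear[OF A u]) (auto intro!: holomorphic_intros mu_step_holomorphic simp: add.assoc)
  \<comment> \<open>Reading \<mu> + 1 as (\<mu> - 1) + 2 makes \<open>oct_op_pv\<close> applicable;
    the shift lemmas then lead back to the operator at \<nu>, \<mu>.\<close>
  also have "oct_op (\<nu> + 1) (\<mu> + 1) (\<lambda>u. oct_pv u * y u) u =
      oct_op (\<nu> + 1) (\<mu> - 1 + 2) (\<lambda>u. oct_pv u * y u) u" by (simp add: add.commute)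
  also have "\<dots> = oct_pv u * oct_op (\<nu> + 1) (\<mu> - 1) y u"
    by (subst oct_op_pv[OF A u mu_step_holomorphic(1)], rule mu_step_holomorphic) simp
  also have "oct_op (\<nu> + 1) (\<mu> - 1) y u = oct_op (\<nu> + 1) (\<mu> - 1 + 1) y u +
      (oct_pe u + 6 * u * (1 - u) * (7 + u)) * y u" by (simp only: oct_op_shift_mu) simp
  also have "oct_op (\<nu> + 1) (\<mu> - 1 + 1) y u = oct_op \<nu> \<mu> y u - 6 * u * (1 - u) * (7 + u) * y u"
    by (simp add: oct_op_shift_nu)
  also have "oct_op \<nu> \<mu> y u = g u + \<beta> * oct_pe u * y u"
    using g[OF u] by simp
  also have "oct_op (\<nu> + 1) (\<mu> + 1) (\<lambda>u. oct_pe u * g u) u =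
     oct_pe u * oct_op \<nu> (\<mu> + 1) g u - 108 * oct_pv u * g u"
    by (subst oct_op_pe[OF A u mu_step_holomorphic(2)], rule mu_step_holomorphic) simp
  also note mu_step_first_order[OF u]
  finally show ?thesis using oct_pf_cube[of u] by algebra
qed

end

section \<open>Ladders of rational solutions\<close>

text \<open>The explicit denominator confines the poles to the complement of \<open>oct_dom\<close>,
  so that a zero of the numerator at 0 can be divided out.\<close>

definition oct_rational :: "(complex \<Rightarrow> complex) \<Rightarrow> bool" where
  "oct_rational r \<longleftrightarrow>
     (\<exists>P i j. \<forall>u\<in>oct_dom. r u = poly P u / ((1 - u) ^ i * oct_pf u ^ j))"

definition oct_sol :: "complex \<Rightarrow> complex \<Rightarrow> (complex \<Rightarrow> complex) \<Rightarrow> bool" where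
  "oct_sol \<nu> \<mu> r \<longleftrightarrow> oct_rational r \<and> oct_ode oct_dom \<nu> \<mu> r \<and> r 0 = 1"

lemma oct_ode_cong:
  assumes "open A" "oct_ode A \<nu> \<mu> y" "\<And>u. u \<in> A \<Longrightarrow> g u = y u"
  shows "oct_ode A \<nu> \<mu> g"
proof -
  have "g holomorphic_on A"
    using assms holomorphic_cong[OF refl, of A g y] by (auto simp: oct_ode_def)
  moreover have "oct_op (\<nu> + 1) \<mu> (oct_op \<nu> \<mu> g) u = oct_op (\<nu> + 1) \<mu> (oct_op \<nu> \<mu> y) u" if "u \<in> A" for u
    by (rule oct_op_cong[OF assms(1) _ that], rule oct_op_cong[OF assms(1)]) (use assms(3) in auto)
  ultimately show ?thesis using assms by (simp add: oct_ode_def)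
qed

lemma oct_ode_cmult:
  assumes A: "open A" and ode: "oct_ode A \<nu> \<mu> y"
  shows "oct_ode A \<nu> \<mu> (\<lambda>u. c * y u)"
proof -
  have y: "y holomorphic_on A" using ode by (simp add: oct_ode_def)
  have *: "oct_op a b (\<lambda>u. c * f u) u = c * oct_op a b f u"
    if "f holomorphic_on A" "u \<in> A" for a b f u
    using oct_op_linear[OF A that(2) that(1) that(1), of a b c 0] by simp
  have "oct_op (\<nu> + 1) \<mu> (oct_op \<nu> \<mu> (\<lambda>u. c * y u)) u = c * oct_op (\<nu> + 1) \<mu> (oct_op \<nu> \<mu> y) u"
    if "u \<in> A" for u
  proof -
    have "oct_op (\<nu> + 1) \<mu> (oct_op \<nu> \<mu> (\<lambda>u. c * y u)) u =
        oct_op (\<nu> + 1) \<mu> (\<lambda>u. c * oct_op \<nu> \<mu> y u) u"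
      by (rule oct_op_cong[OF A _ that]) (simp add: *[OF y])
    thus ?thesis using * that A y by (simp add: oct_op_holomorphic)
  qed
  thus ?thesis using ode by (auto simp: oct_ode_def intro!: holomorphic_intros)
qed

lemma oct_rational_cmult:
  assumes "oct_rational r"
  shows "oct_rational (\<lambda>u. c * r u)"
proof -
  obtain P i j where "\<And>u. u \<in> oct_dom \<Longrightarrow> r u = poly P u / ((1 - u) ^ i * oct_pf u ^ j)"
    using assms unfolding oct_rational_def by blast
  hence "\<forall>u\<in>oct_dom. c * r u = poly (smult c P) u / ((1 - u) ^ i * oct_pf u ^ j)" by simp
  thus ?thesis unfolding oct_rational_def by blast
qed

text \<open>The logarithmic form keeps the full power as a factor and avoids the exponent n - 1 with
  its truncation at n = 0.\<close>

lemma DERIV_power_log: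
  fixes f :: "'a::real_normed_field \<Rightarrow> 'a"
  assumes "(f has_field_derivative f') (at z within A)" "f z \<noteq> 0"
  shows "((\<lambda>z. f z ^ n) has_field_derivative f z ^ n * (of_nat n * f' / f z)) (at z within A)"
proof (cases n)
  case (Suc m)
  have eq: "f z ^ n * (of_nat n * f' / f z) = of_nat n * (f' * f z ^ (n - Suc 0))"
    using assms(2) by (simp add: Suc)
  show ?thesis unfolding eq by (rule DERIV_power[OF assms(1)])
qed auto

text \<open>Differentiation adds one factor (1 - u) \<open>oct_pf\<close> to the denominator, and
  the leading coefficient of \<open>oct_op\<close> contains exactly this factor. The exponents i and
  j thus stay the same.\<close>

lemma oct_rational_op:
  assumes "oct_rational r"
  shows "oct_rational (\<lambda>u. oct_op \<nu> \<mu> r u + \<gamma> * oct_pe u * r u)"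
proof -
  obtain P i j where r: "\<And>u. u \<in> oct_dom \<Longrightarrow> r u = poly P u / ((1 - u) ^ i * oct_pf u ^ j)"
    using assms unfolding oct_rational_def by blast
  define pe pf :: "complex poly" where "pe = [:1, -33, -33, 1:]" and "pf = [:1, 14, 1:]"
  have pe: "poly pe u = oct_pe u" and pf: "poly pf u = oct_pf u" for u
    by (simp_all add: pe_def pf_def oct_pe_def oct_pf_def algebra_simps power2_eq_square)
  \<comment> \<open>The bracket with i and j comes from the logarithmic derivative of the
    denominator, cleared by (1 - u) \<open>oct_pf\<close>; note (14 + 2 u) (1 - u) = 14 - 12 u - 2
    u^2.\<close>
  define N where "N = [:0, 2, -2:] * pf * pderiv P
     - [:0, 2:] * P * (of_nat j * [:14, -12, -2:] - of_nat i * pf)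
     - (smult \<mu> pe + smult (6 * (\<nu> + \<mu>)) [:0, 7, -6, -1:]) * P + smult \<gamma> (pe * P)"
  have "oct_op \<nu> \<mu> r u + \<gamma> * oct_pe u * r u = poly N u / ((1 - u) ^ i * oct_pf u ^ j)"
    if u: "u \<in> oct_dom" for u
  proof -
    define Q where "Q = (\<lambda>u. (1 - u) ^ i * oct_pf u ^ j)"
    have nz: "1 - u \<noteq> 0" "oct_pf u \<noteq> 0" "Q u \<noteq> 0" using u by (auto simp: oct_dom_def Q_def)
    define q where "q = of_nat j * (14 + 2 * u) * (1 - u) - of_nat i * oct_pf u"
    have Q': "(Q has_field_derivative Q u * q / ((1 - u) * oct_pf u)) (at u)"
    proof -
      have "((\<lambda>u. 1 - u) has_field_derivative - 1) (at u)"
        by (auto intro!: derivative_eq_intros)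
      moreover have "(oct_pf has_field_derivative (14 + 2 * u)) (at u)"
        using has_field_derivative_oct_pf[OF DERIV_ident] by simp
      ultimately have "(Q has_field_derivative
          (1 - u) ^ i * (of_nat i * - 1 / (1 - u)) * oct_pf u ^ j +
          oct_pf u ^ j * (of_nat j * (14 + 2 * u) / oct_pf u) * (1 - u) ^ i) (at u)"
        unfolding Q_def using nz by (intro DERIV_mult DERIV_power_log) auto
      also have "(1 - u) ^ i * (of_nat i * - 1 / (1 - u)) * oct_pf u ^ j +
          oct_pf u ^ j * (of_nat j * (14 + 2 * u) / oct_pf u) * (1 - u) ^ i =
          Q u * q / ((1 - u) * oct_pf u)"
        unfolding Q_def q_def using nz(1,2) by (simp add: divide_simps) algebra
      finally show ?thesis .
    qed
    define r' where "r' = (poly (pderiv P) u - r u * Q u * q / ((1 - u) * oct_pf u)) / Q u"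
    have rQ: "r u * Q u = poly P u" using nz r[OF u] by (simp add: Q_def)
    have "((\<lambda>u. poly P u / Q u) has_field_derivative r') (at u)"
    proof -
      have "((\<lambda>u. poly P u / Q u) has_field_derivative
         (poly (pderiv P) u * Q u - poly P u * (Q u * q / ((1 - u) * oct_pf u))) / (Q u * Q u)) (at u)"
        using nz by (intro DERIV_divide poly_DERIV Q')
      also have "(poly (pderiv P) u * Q u - poly P u * (Q u * q / ((1 - u) * oct_pf u))) / (Q u * Q u) = r'"
        unfolding r'_def rQ using nz(3) by (simp add: diff_divide_distrib mult_ac)
      finally show ?thesis .
    qed
    hence "(r has_field_derivative r') (at u)"
      by (rule has_field_derivative_transform_within_open[OF _ open_oct_dom u]) (simp add: r Q_def)
    hence "oct_op \<nu> \<mu> r u = 2 * u * (1 - u) * oct_pf u * r'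
       - (\<mu> * oct_pe u + 6 * (\<nu> + \<mu>) * u * (1 - u) * (7 + u)) * r u"
      by (rule oct_op_eq)
    also have "2 * u * (1 - u) * oct_pf u * r' =
        (2 * u * (1 - u) * oct_pf u * poly (pderiv P) u - 2 * u * poly P u * q) / Q u"
      unfolding r'_def rQ using nz by (simp add: field_simps)
    also have "r u = poly P u / Q u" using r[OF u] by (simp add: Q_def)
    also have "(2 * u * (1 - u) * oct_pf u * poly (pderiv P) u - 2 * u * poly P u * q) / Q u -
      (\<mu> * oct_pe u + 6 * (\<nu> + \<mu>) * u * (1 - u) * (7 + u)) * (poly P u / Q u) =
      (2 * u * (1 - u) * oct_pf u * poly (pderiv P) u - 2 * u * poly P u * q -
      (\<mu> * oct_pe u + 6 * (\<nu> + \<mu>) * u * (1 - u) * (7 + u)) * poly P u) / Q u"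
      by (simp add: diff_divide_distrib)
    finally have "oct_op \<nu> \<mu> r u + \<gamma> * oct_pe u * r u =
      (2 * u * (1 - u) * oct_pf u * poly (pderiv P) u - 2 * u * poly P u * q -
      (\<mu> * oct_pe u + 6 * (\<nu> + \<mu>) * u * (1 - u) * (7 + u)) * poly P u + \<gamma> * oct_pe u * poly P u) / Q u"
      using r[OF u] by (simp add: Q_def add_divide_distrib)
    also have "2 * u * (1 - u) * oct_pf u * poly (pderiv P) u - 2 * u * poly P u * q -
      (\<mu> * oct_pe u + 6 * (\<nu> + \<mu>) * u * (1 - u) * (7 + u)) * poly P u + \<gamma> * oct_pe u * poly P u = poly N u"
      by (simp add: N_def pe pf q_def) algebra
    finally show ?thesis by (simp add: Q_def)
  qed
  thus ?thesis unfolding oct_rational_def by blast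
qed

text \<open>Identities found by cancelling \<open>oct_pv\<close> or a power of u hold only off 0;
  continuity supplies the missing point.\<close>

lemma holomorphic_eq_at:
  assumes "open A" "a \<in> A" "f holomorphic_on A" "g holomorphic_on A"
    and "\<And>u. u \<in> A \<Longrightarrow> u \<noteq> a \<Longrightarrow> f u = (g u :: complex)"
  shows "f a = g a"
proof -
  have *: "isCont f a" "isCont g a"
    using assms holomorphic_on_imp_continuous_on continuous_on_eq_continuous_at by blast+
  have "eventually (\<lambda>u. f u = g u) (at a)"
    using eventually_at_in_open'[OF assms(1,2)] assms(5)
    unfolding eventually_at_filter by (auto elim: eventually_mono)
  hence "(f \<longlongrightarrow> g a) (at a)"
    using *(2) by (subst tendsto_cong) (auto simp: isCont_def)
  with *(1) show ?thesis unfolding isCont_def using tendsto_unique trivial_limit_at by blast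
qed

text \<open>The derivative term vanishes at 0. The normalizing constants of both degree steps and of
  the raising order step can therefore be read off from the value at 0.\<close>

lemma oct_op_0: "oct_op \<nu> \<mu> y 0 = - \<mu> * y 0"
  by (simp add: oct_op_def oct_pe_def)

lemma oct_sol_nu_up:
  assumes r: "oct_sol \<nu> \<mu> r" and c: "\<nu> - \<mu> + 1 \<noteq> 0"
  shows "\<exists>s. oct_sol (\<nu> + 1) \<mu> s \<and>
    (\<forall>u\<in>oct_dom. oct_op \<nu> \<mu> r u + (\<nu> + 1) * oct_pe u * r u = (\<nu> - \<mu> + 1) * s u)"
proof (intro exI conjI ballI)
  define g where "g = (\<lambda>u. oct_op \<nu> \<mu> r u + (\<nu> + 1) * oct_pe u * r u)"
  define s where "s = (\<lambda>u. 1 / (\<nu> - \<mu> + 1) * g u)"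
  have ode: "oct_ode oct_dom \<nu> \<mu> r" using r by (simp add: oct_sol_def)
  have "g holomorphic_on oct_dom"
    by (rule nu_step_holomorphic[OF open_oct_dom ode, of "\<nu> + 1"]) (auto simp: g_def)
  moreover have "oct_op (\<nu> + 2) \<mu> (oct_op (\<nu> + 1) \<mu> g) u =
      (\<mu>\<^sup>2 * oct_pf u ^ 3 - 108 * (\<nu> + 1) * (\<nu> + 1 + 1) * oct_pv u) * g u" if "u \<in> oct_dom" for u
    by (rule nu_step_second_order[OF open_oct_dom ode _ _ that]) (auto simp: g_def)
  ultimately have "oct_ode oct_dom (\<nu> + 1) \<mu> g"
    by (simp add: oct_ode_def add.assoc)
  hence "oct_ode oct_dom (\<nu> + 1) \<mu> s"
    unfolding s_def by (intro oct_ode_cmult) auto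
  moreover have "oct_rational s"
    unfolding s_def g_def using r by (intro oct_rational_cmult oct_rational_op) (simp add: oct_sol_def)
  moreover have "s 0 = 1"
    using r c by (simp add: s_def g_def oct_op_0 oct_sol_def oct_pe_def)
  ultimately show "oct_sol (\<nu> + 1) \<mu> s" by (simp add: oct_sol_def)
  fix u
  show "oct_op \<nu> \<mu> r u + (\<nu> + 1) * oct_pe u * r u = (\<nu> - \<mu> + 1) * s u"
    using c by (simp add: s_def g_def)
qed

lemma oct_sol_nu_down:
  assumes r: "oct_sol \<nu> \<mu> r" and c: "\<nu> + \<mu> \<noteq> 0"
  shows "\<exists>s. oct_sol (\<nu> - 1) \<mu> s \<and>
    (\<forall>u\<in>oct_dom. oct_op \<nu> \<mu> r u - \<nu> * oct_pe u * r u = - (\<nu> + \<mu>) * oct_pf u ^ 3 * s u)"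
proof (intro exI conjI ballI)
  define g where "g = (\<lambda>u. oct_op \<nu> \<mu> r u + (- \<nu>) * oct_pe u * r u)"
  define h where "h = (\<lambda>u. - 1 / (\<nu> + \<mu>) * g u)"
  define s where "s = (\<lambda>u. h u / oct_pf u ^ 3)"
  have ode: "oct_ode oct_dom \<nu> \<mu> r" using r by (simp add: oct_sol_def)
  have g: "g holomorphic_on oct_dom"
    by (rule nu_step_holomorphic[OF open_oct_dom ode, of "- \<nu>"]) (auto simp: g_def algebra_simps)
  moreover have "oct_op (\<nu> + 2) \<mu> (oct_op (\<nu> + 1) \<mu> g) u =
      (\<mu>\<^sup>2 * oct_pf u ^ 3 - 108 * (- \<nu>) * (- \<nu> + 1) * oct_pv u) * g u" if "u \<in> oct_dom" for u
    by (rule nu_step_second_order[OF open_oct_dom ode _ _ that]) (auto simp: g_def algebra_simps)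
  ultimately have g2: "oct_op (\<nu> + 2) \<mu> (oct_op (\<nu> + 1) \<mu> g) u =
      (\<mu>\<^sup>2 * oct_pf u ^ 3 - 108 * \<nu> * (\<nu> - 1) * oct_pv u) * g u" if "u \<in> oct_dom" for u
    using that by (simp add: algebra_simps)
  have s: "s holomorphic_on oct_dom" unfolding s_def h_def using g
    by (auto intro!: holomorphic_intros simp: oct_dom_def)
  have gs: "g u = oct_pf u ^ 3 * (- (\<nu> + \<mu>) * s u)" if "u \<in> oct_dom" for u
    using that c by (simp add: s_def h_def oct_dom_def divide_simps) (simp add: algebra_simps)
  define s' where "s' = (\<lambda>u. - (\<nu> + \<mu>) * s u)"
  have s': "s' holomorphic_on oct_dom" unfolding s'_def by (intro holomorphic_intros s)
  have "oct_ode oct_dom (\<nu> - 1) \<mu> s'"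
    unfolding oct_ode_def
  proof (intro conjI ballI s')
    fix u assume u: "u \<in> oct_dom"
    have "oct_op (\<nu> + 2) \<mu> (oct_op (\<nu> + 1) \<mu> g) u =
       oct_op (\<nu> + 2) \<mu> (\<lambda>u. oct_pf u ^ 3 * oct_op (\<nu> - 1) \<mu> s' u) u"
    proof (rule oct_op_cong[OF open_oct_dom _ u])
      fix u assume u: "u \<in> oct_dom"
      have "oct_op (\<nu> + 1) \<mu> g u = oct_op (\<nu> - 1 + 2) \<mu> (\<lambda>u. oct_pf u ^ 3 * s' u) u"
        by (subst oct_op_cong[OF open_oct_dom gs u]) (simp_all add: s'_def add.commute)
      also have "\<dots> = oct_pf u ^ 3 * oct_op (\<nu> - 1) \<mu> s' u"
        by (rule oct_op_pf3[OF open_oct_dom u s' s'])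
      finally show "oct_op (\<nu> + 1) \<mu> g u = oct_pf u ^ 3 * oct_op (\<nu> - 1) \<mu> s' u" .
    qed
    also have "\<dots> = oct_pf u ^ 3 * oct_op \<nu> \<mu> (oct_op (\<nu> - 1) \<mu> s') u"
      by (rule oct_op_pf3[OF open_oct_dom u _ s']) (intro oct_op_holomorphic s' open_oct_dom)
    finally have "oct_pf u ^ 3 * oct_op \<nu> \<mu> (oct_op (\<nu> - 1) \<mu> s') u =
      (\<mu>\<^sup>2 * oct_pf u ^ 3 - 108 * \<nu> * (\<nu> - 1) * oct_pv u) * g u" using g2[OF u] by simp
    moreover have "g u = oct_pf u ^ 3 * s' u" using gs[OF u] by (simp add: s'_def)
    moreover have "oct_pf u \<noteq> 0" using u by (simp add: oct_dom_def)
    ultimately have "oct_op \<nu> \<mu> (oct_op (\<nu> - 1) \<mu> s') u =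
      (\<mu>\<^sup>2 * oct_pf u ^ 3 - 108 * (\<nu> - 1) * \<nu> * oct_pv u) * s' u"
      by algebra
    thus "oct_op (\<nu> - 1 + 1) \<mu> (oct_op (\<nu> - 1) \<mu> s') u =
      (\<mu>\<^sup>2 * oct_pf u ^ 3 - 108 * (\<nu> - 1) * (\<nu> - 1 + 1) * oct_pv u) * s' u"
      by simp
  qed
  hence "oct_ode oct_dom (\<nu> - 1) \<mu> (\<lambda>u. - 1 / (\<nu> + \<mu>) * s' u)"
    by (intro oct_ode_cmult) auto
  hence "oct_ode oct_dom (\<nu> - 1) \<mu> s"
    by (rule oct_ode_cong[rotated]) (use c in \<open>auto simp: s'_def field_simps\<close>)
  moreover have "oct_rational s"
  proof -
    have "oct_rational h"
      unfolding h_def g_def using r by (intro oct_rational_cmult oct_rational_op) (simp add: oct_sol_def)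
    then obtain P i j where "\<And>u. u \<in> oct_dom \<Longrightarrow> h u = poly P u / ((1 - u) ^ i * oct_pf u ^ j)"
      unfolding oct_rational_def by blast
    hence "\<forall>u\<in>oct_dom. s u = poly P u / ((1 - u) ^ i * oct_pf u ^ (j + 3))"
      by (simp add: s_def power_add)
    thus ?thesis unfolding oct_rational_def by blast
  qed
  moreover have "s 0 = 1"
    using r c by (simp add: s_def h_def g_def oct_op_0 oct_sol_def oct_pe_def oct_pf_def field_simps)
  ultimately show "oct_sol (\<nu> - 1) \<mu> s" by (simp add: oct_sol_def)
  fix u assume "u \<in> oct_dom"
  from gs[OF this]
  show "oct_op \<nu> \<mu> r u - \<nu> * oct_pe u * r u = - (\<nu> + \<mu>) * oct_pf u ^ 3 * s u"
    by (simp add: g_def)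
qed

lemma oct_sol_mu_up:
  assumes r: "oct_sol \<nu> \<mu> r" and c: "\<mu> \<noteq> 0"
  shows "\<exists>s. oct_sol \<nu> (\<mu> + 1) s \<and>
    (\<forall>u\<in>oct_dom. oct_op \<nu> \<mu> r u - \<mu> * oct_pe u * r u = - 2 * \<mu> * s u)"
proof (intro exI conjI ballI)
  define g where "g = (\<lambda>u. oct_op \<nu> \<mu> r u + (- \<mu>) * oct_pe u * r u)"
  define s where "s = (\<lambda>u. - 1 / (2 * \<mu>) * g u)"
  have ode: "oct_ode oct_dom \<nu> \<mu> r" using r by (simp add: oct_sol_def)
  have "g holomorphic_on oct_dom"
    by (rule mu_step_holomorphic[OF open_oct_dom ode, of \<mu>]) (auto simp: g_def)
  moreover have "oct_op (\<nu> + 1) (\<mu> + 1) (oct_op \<nu> (\<mu> + 1) g) u =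
      ((\<mu> + 1) ^ 2 * oct_pf u ^ 3 - 108 * \<nu> * (\<nu> + 1) * oct_pv u) * g u" if "u \<in> oct_dom" for u
    by (rule mu_step_second_order[OF open_oct_dom ode _ _ that]) (auto simp: g_def)
  ultimately have "oct_ode oct_dom \<nu> (\<mu> + 1) g"
    by (simp add: oct_ode_def)
  hence "oct_ode oct_dom \<nu> (\<mu> + 1) s"
    unfolding s_def by (intro oct_ode_cmult) auto
  moreover have "oct_rational s"
    unfolding s_def g_def using r by (intro oct_rational_cmult oct_rational_op) (simp add: oct_sol_def)
  moreover have "s 0 = 1"
    using r c by (simp add: s_def g_def oct_op_0 oct_sol_def oct_pe_def)
  ultimately show "oct_sol \<nu> (\<mu> + 1) s" by (simp add: oct_sol_def)
  fix u
  show "oct_op \<nu> \<mu> r u - \<mu> * oct_pe u * r u = - 2 * \<mu> * s u"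
    using c by (simp add: s_def g_def)
qed

text \<open>Here the ladder operator annihilates the value at 0, since -\<mu> + \<mu> = 0, so the
  result is divisible by \<open>oct_pv\<close> and the normalizing constant needs a separate
  argument.\<close>

lemma oct_sol_mu_down:
  assumes r: "oct_sol \<nu> \<mu> r" and c: "\<mu> \<noteq> 1" "\<nu> + \<mu> \<noteq> 0" "\<nu> - \<mu> + 1 \<noteq> 0"
  shows "\<exists>s. oct_sol \<nu> (\<mu> - 1) s \<and>
    (\<forall>u\<in>oct_dom. oct_op \<nu> \<mu> r u + \<mu> * oct_pe u * r u =
       54 * (\<nu> + \<mu>) * (\<nu> - \<mu> + 1) / (\<mu> - 1) * oct_pv u * s u)"
proof -
  define C where "C = 54 * (\<nu> + \<mu>) * (\<nu> - \<mu> + 1) / (\<mu> - 1)"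
  have C: "C \<noteq> 0" "C * (\<mu> - 1) = 54 * (\<nu> + \<mu>) * (\<nu> - \<mu> + 1)"
    unfolding C_def using c by (simp_all del: distrib_left_numeral)
  define g where "g = (\<lambda>u. oct_op \<nu> \<mu> r u + \<mu> * oct_pe u * r u)"
  have "oct_rational g" unfolding g_def using r by (intro oct_rational_op) (simp add: oct_sol_def)
  then obtain P i j where P: "\<And>u. u \<in> oct_dom \<Longrightarrow> g u = poly P u / ((1 - u) ^ i * oct_pf u ^ j)"
    unfolding oct_rational_def by blast
  have r0: "r 0 = 1" using r by (simp add: oct_sol_def)
  have "g 0 = 0" using r0 by (simp add: g_def oct_op_0 oct_pe_def)
  hence "poly P 0 = 0" using P[of 0] by (simp add: oct_pf_def)
  then obtain P' where P': "P = [:0, 1:] * P'"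
    using poly_eq_0_iff_dvd[of P 0] by (auto elim: dvdE)
  \<comment> \<open>In the division by u (1 - u)^4, the factor u is taken out of the numerator and
    (1 - u)^4 joins the denominator.\<close>
  define h where "h = (\<lambda>u. poly P' u / ((1 - u) ^ (i + 4) * oct_pf u ^ j))"
  define s where "s = (\<lambda>u. 1 / C * h u)"
  have gh: "g u = oct_pv u * h u" if "u \<in> oct_dom" for u
    using that P[OF that] by (simp add: h_def P' oct_pv_def oct_dom_def power_add)
  have h: "h holomorphic_on oct_dom" unfolding h_def
    by (auto intro!: holomorphic_intros simp: oct_dom_def)
  have ode: "oct_ode oct_dom \<nu> \<mu> r" using r by (simp add: oct_sol_def)
  have rhol: "r holomorphic_on oct_dom" using ode by (simp add: oct_ode_def)
  have gop: "oct_op \<nu> (\<mu> + 1) g u = oct_pv u * oct_op \<nu> (\<mu> - 1) h u" if u: "u \<in> oct_dom" for u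
  proof -
    have "oct_op \<nu> (\<mu> + 1) g u = oct_op \<nu> (\<mu> - 1 + 2) (\<lambda>u. oct_pv u * h u) u"
      by (subst oct_op_cong[OF open_oct_dom gh u]) (simp_all add: add.commute)
    also have "\<dots> = oct_pv u * oct_op \<nu> (\<mu> - 1) h u"
      by (rule oct_op_pv[OF open_oct_dom u h h])
    finally show ?thesis .
  qed
  have pv: "oct_pv u \<noteq> 0" if "u \<in> oct_dom" "u \<noteq> 0" for u
    using that by (simp add: oct_pv_def oct_dom_def)
  have g1: "oct_op \<nu> (\<mu> + 1) g u = - (- \<mu> + 1) * oct_pe u * g u
      - 108 * (\<nu> - - \<mu>) * (\<nu> + - \<mu> + 1) * oct_pv u * r u" if "u \<in> oct_dom" for u
    by (rule mu_step_first_order[OF open_oct_dom ode _ _ that]) (auto simp: g_def)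
  have g2: "oct_op (\<nu> + 1) (\<mu> + 1) (oct_op \<nu> (\<mu> + 1) g) u =
      ((- \<mu> + 1) ^ 2 * oct_pf u ^ 3 - 108 * \<nu> * (\<nu> + 1) * oct_pv u) * g u" if "u \<in> oct_dom" for u
    by (rule mu_step_second_order[OF open_oct_dom ode _ _ that]) (auto simp: g_def)
  \<comment> \<open>The first-order relation divided by \<open>oct_pv\<close>. At 0 the left side is
    -(\<mu> - 1) h(0), which gives 2 (\<mu> - 1) h(0) = 108 (\<nu> + \<mu>) (\<nu> - \<mu> + 1) and
    so h(0) = C.\<close>
  have "oct_op \<nu> (\<mu> - 1) h 0 = (\<mu> - 1) * oct_pe 0 * h 0 - 108 * (\<nu> + \<mu>) * (\<nu> - \<mu> + 1) * r 0"
  proof (rule holomorphic_eq_at[OF open_oct_dom zero_in_oct_dom])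
    show "(\<lambda>u. (\<mu> - 1) * oct_pe u * h u - 108 * (\<nu> + \<mu>) * (\<nu> - \<mu> + 1) * r u) holomorphic_on oct_dom"
      by (intro holomorphic_intros h rhol)
    fix u :: complex assume u: "u \<in> oct_dom" "u \<noteq> 0"
    show "oct_op \<nu> (\<mu> - 1) h u = (\<mu> - 1) * oct_pe u * h u - 108 * (\<nu> + \<mu>) * (\<nu> - \<mu> + 1) * r u"
      using g1[OF u(1)] gop[OF u(1)] gh[OF u(1)] pv[OF u]
      by (simp add: algebra_simps) algebra
  qed (intro oct_op_holomorphic h open_oct_dom)
  hence "h 0 = C" using C r0 c(1) unfolding oct_op_0 by (simp add: oct_pe_def) algebra
  hence "s 0 = 1" using C by (simp add: s_def)
  moreover have "oct_ode oct_dom \<nu> (\<mu> - 1) h"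
    unfolding oct_ode_def
  proof (intro conjI ballI h)
    fix u assume u: "u \<in> oct_dom"
    have *: "oct_op (\<nu> + 1) (\<mu> - 1) (oct_op \<nu> (\<mu> - 1) h) u =
      ((\<mu> - 1)\<^sup>2 * oct_pf u ^ 3 - 108 * \<nu> * (\<nu> + 1) * oct_pv u) * h u"
      if u: "u \<in> oct_dom" "u \<noteq> 0" for u
    proof -
      have "oct_op (\<nu> + 1) (\<mu> + 1) (oct_op \<nu> (\<mu> + 1) g) u =
         oct_op (\<nu> + 1) (\<mu> - 1 + 2) (\<lambda>u. oct_pv u * oct_op \<nu> (\<mu> - 1) h u) u"
        by (subst oct_op_cong[OF open_oct_dom gop u(1)]) (simp_all add: add.commute)
      also have "\<dots> = oct_pv u * oct_op (\<nu> + 1) (\<mu> - 1) (oct_op \<nu> (\<mu> - 1) h) u"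
        by (rule oct_op_pv[OF open_oct_dom u(1) _ h]) (intro oct_op_holomorphic h open_oct_dom)
      finally show ?thesis using g2[OF u(1)] gh[OF u(1)] pv[OF u] by algebra
    qed
    show "oct_op (\<nu> + 1) (\<mu> - 1) (oct_op \<nu> (\<mu> - 1) h) u =
      ((\<mu> - 1)\<^sup>2 * oct_pf u ^ 3 - 108 * \<nu> * (\<nu> + 1) * oct_pv u) * h u"
    proof (cases "u = 0")
      case True
      have "oct_op (\<nu> + 1) (\<mu> - 1) (oct_op \<nu> (\<mu> - 1) h) 0 =
        ((\<mu> - 1)\<^sup>2 * oct_pf 0 ^ 3 - 108 * \<nu> * (\<nu> + 1) * oct_pv 0) * h 0"
        by (rule holomorphic_eq_at[OF open_oct_dom zero_in_oct_dom _ _ *])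
           (intro oct_op_holomorphic h open_oct_dom holomorphic_intros | assumption)+
      thus ?thesis by (simp only: True)
    qed (use * u in auto)
  qed
  hence "oct_ode oct_dom \<nu> (\<mu> - 1) s"
    unfolding s_def by (intro oct_ode_cmult) auto
  moreover have "oct_rational h" unfolding oct_rational_def h_def by blast
  hence "oct_rational s" unfolding s_def by (rule oct_rational_cmult)
  ultimately have "oct_sol \<nu> (\<mu> - 1) s" by (simp add: oct_sol_def)
  moreover have "oct_op \<nu> \<mu> r u + \<mu> * oct_pe u * r u = 54 * (\<nu> + \<mu>) * (\<nu> - \<mu> + 1) / (\<mu> - 1) * oct_pv u * s u"
    if "u \<in> oct_dom" for u
    unfolding C_def[symmetric] using C gh[OF that] by (simp add: g_def s_def)
  ultimately show ?thesis by blast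
qed

section \<open>The inversion \<open>u \<mapsto> 1/u\<close>\<close>

lemma inverse_in_oct_dom:
  assumes "u \<in> oct_dom" "u \<noteq> 0"
  shows "1 / u \<in> oct_dom"
  using assms by (auto simp: oct_dom_def oct_pf_def field_simps power2_eq_square)

text \<open>The powers of u and 1 - 1/u are \<open>\<phi>\<close> of order -\<mu> at 1/u divided by
  \<open>\<phi>\<close> of order \<mu> at u, up to a constant: the product of \<open>oct_pv\<close>
  at u and 1/u is u^4 (1 - 1/u)^8, and \<open>oct_pf u\<close> is u^2 \<open>oct_pf (1 / u)\<close>.
  This yields k = 3 \<nu> + 2 \<mu> and l = 4 \<mu>, which are integers in the cases of interest. If
  s(0) = 1, then d is the leading coefficient of r at infinity.\<close>

definition oct_flip :: "complex \<Rightarrow> int \<Rightarrow> int \<Rightarrow> (complex \<Rightarrow> complex) \<Rightarrow> (complex \<Rightarrow> complex) \<Rightarrow> bool" where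
  "oct_flip d k l r s \<longleftrightarrow>
     (\<forall>u\<in>oct_dom - {0}. r u = d * u powi k * (1 - 1 / u) powi l * s (1 / u))"

lemma oct_flip_polys:
  assumes "u \<noteq> 0"
  shows "oct_pe u = u ^ 3 * oct_pe (1 / u)" "oct_pf u = u ^ 2 * oct_pf (1 / u)"
    "oct_pv u = u ^ 5 * (1 - 1 / u) ^ 4"
    "oct_pv u = u ^ 6 * oct_pv (1 / u)"
proof -
  have *: "u ^ 4 * (1 - 1 / u) ^ 4 = (u - 1) ^ 4"
    using assms by (simp add: power_mult_distrib[symmetric] right_diff_distrib)
  have "u ^ 5 * (1 - 1 / u) ^ 4 = u * (u ^ 4 * (1 - 1 / u) ^ 4)" by algebra
  also have "\<dots> = oct_pv u" unfolding * oct_pv_def by algebra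
  finally show 1: "oct_pv u = u ^ 5 * (1 - 1 / u) ^ 4" ..
  have "u ^ 6 * oct_pv (1 / u) = u ^ 5 * (1 - 1 / u) ^ 4"
    using assms by (simp add: oct_pv_def power_numeral_reduce)
  thus "oct_pv u = u ^ 6 * oct_pv (1 / u)" using 1 by simp
  show "oct_pe u = u ^ 3 * oct_pe (1 / u)" "oct_pf u = u ^ 2 * oct_pf (1 / u)"
    using assms by (simp_all add: oct_pe_def oct_pf_def field_simps power_numeral_reduce)
qed

text \<open>On the matching branch of the square root, D is invariant under u to 1/u; only the
  factor p_f^(3/2) built into \<open>oct_op\<close> changes, and it contributes u^3.\<close>

lemma oct_op_flip:
  assumes flip: "oct_flip d k l r s" and u: "u \<in> oct_dom" "u \<noteq> 0"
    and s: "s holomorphic_on oct_dom"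
    and kl: "of_int k = 3 * \<nu> + 2 * \<mu>" "of_int l = 4 * \<mu>"
  shows "oct_op \<nu> \<mu> r u = d * u powi (k + 3) * (1 - 1 / u) powi l * oct_op \<nu> (- \<mu>) s (1 / u)"
proof -
  define v where "v = 1 / u"
  have v: "v \<in> oct_dom" "v \<noteq> 0" "u * v = 1"
    using inverse_in_oct_dom[OF u] u by (auto simp: v_def)
  have v1: "1 - v \<noteq> 0" using v by (auto simp: oct_dom_def)
  define c where "c = d * u powi k * (1 - v) powi l"
  define s' where "s' = deriv s v"
  have s': "(s has_field_derivative s') (at v)"
    unfolding s'_def by (rule holomorphic_derivI[OF s open_oct_dom v(1)])
  have inv': "((\<lambda>u. 1 / u) has_field_derivative - (v ^ 2)) (at u)"
    using u by (auto intro!: derivative_eq_intros simp: v_def field_simps power2_eq_square)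
  have D1: "((\<lambda>u. u powi k) has_field_derivative of_int k * u powi k * v) (at u)"
    using u by (auto intro!: derivative_eq_intros simp: v_def power_int_diff)
  have "((\<lambda>u. 1 - 1 / u) has_field_derivative v ^ 2) (at u)"
    using DERIV_diff[OF DERIV_const inv', of 1] by simp
  hence "((\<lambda>u. (1 - 1 / u) powi l) has_field_derivative
      of_int l * (1 - 1 / u) powi (l - 1) * v ^ 2) (at u)"
    by (rule DERIV_power_int) (use v1 in \<open>simp add: v_def\<close>)
  also have "of_int l * (1 - 1 / u) powi (l - 1) * v ^ 2 = of_int l * (1 - v) powi l / (1 - v) * v ^ 2"
    using v1 by (simp add: v_def[symmetric] power_int_diff)
  finally have D2: "((\<lambda>u. (1 - 1 / u) powi l) has_field_derivative
     of_int l * (1 - v) powi l / (1 - v) * v ^ 2) (at u)" .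
  have D3: "((\<lambda>u. s (1 / u)) has_field_derivative s' * (- (v ^ 2))) (at u)"
    using DERIV_chain2[OF _ inv', of s s'] s' by (simp add: v_def)
  have "((\<lambda>u. d * u powi k * (1 - 1 / u) powi l * s (1 / u)) has_field_derivative
      d * (of_int k * u powi k * v) * (1 - v) powi l * s v +
      d * u powi k * (of_int l * (1 - v) powi l / (1 - v) * v ^ 2) * s v +
      d * u powi k * (1 - v) powi l * (s' * (- (v ^ 2)))) (at u)"
    using DERIV_mult[OF DERIV_mult[OF DERIV_cmult[OF D1, of d] D2] D3]
    by (simp add: v_def algebra_simps)
  also have "d * (of_int k * u powi k * v) * (1 - v) powi l * s v +
      d * u powi k * (of_int l * (1 - v) powi l / (1 - v) * v ^ 2) * s v +
      d * u powi k * (1 - v) powi l * (s' * (- (v ^ 2))) =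
      c * ((of_int k * v + of_int l / (1 - v) * v ^ 2) * s v - s' * v ^ 2)"
    by (simp add: c_def algebra_simps)
  finally have "(r has_field_derivative
      c * ((of_int k * v + of_int l / (1 - v) * v ^ 2) * s v - s' * v ^ 2)) (at u)"
  proof (rule has_field_derivative_transform_within_open[where S = "oct_dom - {0}"])
    show "d * u powi k * (1 - 1 / u) powi l * s (1 / u) = r u" if "u \<in> oct_dom - {0}" for u
      using flip that by (simp add: oct_flip_def)
  qed (use u in auto)
  from oct_op_eq[OF this, of \<nu> \<mu>]
  have "oct_op \<nu> \<mu> r u = 2 * u * (1 - u) * oct_pf u *
      (c * ((of_int k * v + of_int l / (1 - v) * v ^ 2) * s v - s' * v ^ 2)) -
      (\<mu> * oct_pe u + 6 * (\<nu> + \<mu>) * u * (1 - u) * (7 + u)) * r u" .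
  also have "r u = c * s v" using flip u by (simp add: oct_flip_def c_def v_def)
  also have "of_int l / (1 - v) * v ^ 2 = of_int l * (1 / (1 - v)) * v ^ 2" by simp
  also have "2 * u * (1 - u) * oct_pf u *
      (c * ((of_int k * v + of_int l * (1 / (1 - v)) * v ^ 2) * s v - s' * v ^ 2)) -
      (\<mu> * oct_pe u + 6 * (\<nu> + \<mu>) * u * (1 - u) * (7 + u)) * (c * s v) =
      c * u ^ 3 * (2 * v * (1 - v) * oct_pf v * s' -
        (- \<mu> * oct_pe v + 6 * (\<nu> - \<mu>) * v * (1 - v) * (7 + v)) * s v)"
  proof -
    \<comment> \<open>With w and v tied to 1 - v and u by polynomial relations, the remaining claim
      is a polynomial identity modulo these relations.\<close>
    define w where "w = 1 / (1 - v)"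
    have w: "w * (1 - v) = 1" using v1 by (simp add: w_def)
    show ?thesis unfolding kl w_def[symmetric] oct_pe_def oct_pf_def
      using v(3) w by algebra
  qed
  also have "\<dots> = c * u ^ 3 * oct_op \<nu> (- \<mu>) s v"
    by (subst oct_op_eq[OF s']) simp
  also have "c * u ^ 3 = d * u powi (k + 3) * (1 - v) powi l"
    using u by (simp add: c_def power_int_add)
  finally show ?thesis by (simp add: v_def)
qed

definition oct_pair :: "complex \<Rightarrow> complex \<Rightarrow> int \<Rightarrow> int \<Rightarrow> complex \<Rightarrow> bool" where
  "oct_pair \<nu> \<mu> k l d \<longleftrightarrow> (\<exists>r s. oct_sol \<nu> \<mu> r \<and> oct_sol \<nu> (- \<mu>) s \<and> oct_flip d k l r s)"

lemma oct_sol_holomorphic: "oct_sol \<nu> \<mu> r \<Longrightarrow> r holomorphic_on oct_dom"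
  by (simp add: oct_sol_def oct_ode_def)

lemma flip_combination:
  assumes flip: "oct_flip d k l r s" and u: "u \<in> oct_dom" "u \<noteq> 0"
    and s: "s holomorphic_on oct_dom"
    and kl: "of_int k = 3 * \<nu> + 2 * \<mu>" "of_int l = 4 * \<mu>"
  shows "oct_op \<nu> \<mu> r u + \<gamma> * oct_pe u * r u = d * u powi (k + 3) * (1 - 1 / u) powi l *
    (oct_op \<nu> (- \<mu>) s (1 / u) + \<gamma> * oct_pe (1 / u) * s (1 / u))"
proof -
  have r: "r u = d * u powi k * (1 - 1 / u) powi l * s (1 / u)"
    using flip u by (simp add: oct_flip_def)
  have pe: "oct_pe u = u ^ 3 * oct_pe (1 / u)" by (rule oct_flip_polys[OF u(2)])
  have "u powi (k + 3) = u powi k * u ^ 3" using u by (simp add: power_int_add)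
  thus ?thesis unfolding oct_op_flip[OF assms] r by (subst pe) (simp add: algebra_simps)
qed

text \<open>Both sides of the flip relation are raised by the same operator. The new d collects the
  quotient of the normalizing constants of s and r, and u^3 raises k by 3.\<close>

lemma oct_pair_nu_up:
  assumes "oct_pair \<nu> \<mu> k l d" "of_int k = 3 * \<nu> + 2 * \<mu>" "of_int l = 4 * \<mu>"
    and nz: "\<nu> - \<mu> + 1 \<noteq> 0" "\<nu> + \<mu> + 1 \<noteq> 0"
  shows "oct_pair (\<nu> + 1) \<mu> (k + 3) l (d * (\<nu> + \<mu> + 1) / (\<nu> - \<mu> + 1))"
proof -
  obtain r s where rs: "oct_sol \<nu> \<mu> r" "oct_sol \<nu> (- \<mu>) s" "oct_flip d k l r s"
    using assms(1) unfolding oct_pair_def by blast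
  obtain r' where r': "oct_sol (\<nu> + 1) \<mu> r'"
    "\<And>u. u \<in> oct_dom \<Longrightarrow> oct_op \<nu> \<mu> r u + (\<nu> + 1) * oct_pe u * r u = (\<nu> - \<mu> + 1) * r' u"
    using oct_sol_nu_up[OF rs(1) nz(1)] by blast
  obtain s' where s': "oct_sol (\<nu> + 1) (- \<mu>) s'"
    "\<And>u. u \<in> oct_dom \<Longrightarrow> oct_op \<nu> (- \<mu>) s u + (\<nu> + 1) * oct_pe u * s u = (\<nu> + \<mu> + 1) * s' u"
    using oct_sol_nu_up[OF rs(2)] nz(2) by auto
  have "oct_flip (d * (\<nu> + \<mu> + 1) / (\<nu> - \<mu> + 1)) (k + 3) l r' s'"
    unfolding oct_flip_def
  proof
    fix u assume u: "u \<in> oct_dom - {0}"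
    have "(\<nu> - \<mu> + 1) * r' u = d * u powi (k + 3) * (1 - 1 / u) powi l * ((\<nu> + \<mu> + 1) * s' (1 / u))"
      using flip_combination[OF rs(3) _ _ oct_sol_holomorphic[OF rs(2)] assms(2,3), of u "\<nu> + 1"]
        r'(2) s'(2) u inverse_in_oct_dom by auto
    hence "r' u = (d * u powi (k + 3) * (1 - 1 / u) powi l * ((\<nu> + \<mu> + 1) * s' (1 / u))) / (\<nu> - \<mu> + 1)"
      using nz by (subst eq_divide_eq) (simp add: mult.commute)
    thus "r' u = d * (\<nu> + \<mu> + 1) / (\<nu> - \<mu> + 1) * u powi (k + 3) * (1 - 1 / u) powi l * s' (1 / u)"
      by (simp add: mult_ac)
  qed
  thus ?thesis using r'(1) s'(1) unfolding oct_pair_def by blast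
qed

lemma oct_pair_nu_down:
  assumes "oct_pair \<nu> \<mu> k l d" "of_int k = 3 * \<nu> + 2 * \<mu>" "of_int l = 4 * \<mu>"
    and nz: "\<nu> - \<mu> \<noteq> 0" "\<nu> + \<mu> \<noteq> 0"
  shows "oct_pair (\<nu> - 1) \<mu> (k - 3) l (d * (\<nu> - \<mu>) / (\<nu> + \<mu>))"
proof -
  obtain r s where rs: "oct_sol \<nu> \<mu> r" "oct_sol \<nu> (- \<mu>) s" "oct_flip d k l r s"
    using assms(1) unfolding oct_pair_def by blast
  obtain r' where r': "oct_sol (\<nu> - 1) \<mu> r'"
    "\<And>u. u \<in> oct_dom \<Longrightarrow> oct_op \<nu> \<mu> r u - \<nu> * oct_pe u * r u = - (\<nu> + \<mu>) * oct_pf u ^ 3 * r' u"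
    using oct_sol_nu_down[OF rs(1) nz(2)] by blast
  obtain s' where s': "oct_sol (\<nu> - 1) (- \<mu>) s'"
    "\<And>u. u \<in> oct_dom \<Longrightarrow> oct_op \<nu> (- \<mu>) s u - \<nu> * oct_pe u * s u = - (\<nu> - \<mu>) * oct_pf u ^ 3 * s' u"
    using oct_sol_nu_down[OF rs(2)] nz(1) by auto
  have "oct_flip (d * (\<nu> - \<mu>) / (\<nu> + \<mu>)) (k - 3) l r' s'"
    unfolding oct_flip_def
  proof
    fix u assume u: "u \<in> oct_dom - {0}"
    hence u0: "u \<noteq> 0" by simp
    have pf: "oct_pf (1 / u) \<noteq> 0" using inverse_in_oct_dom[of u] u by (simp add: oct_dom_def)
    have "- (\<nu> + \<mu>) * oct_pf u ^ 3 * r' u = d * u powi (k + 3) * (1 - 1 / u) powi l *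
        (- (\<nu> - \<mu>) * oct_pf (1 / u) ^ 3 * s' (1 / u))"
      using flip_combination[OF rs(3) _ _ oct_sol_holomorphic[OF rs(2)] assms(2,3), of u "- \<nu>"]
        r'(2) s'(2) u inverse_in_oct_dom by auto
    moreover have "u powi (k + 3) = u powi (k - 3) * u ^ 6"
      using power_int_add[of u "k - 3" 6] u0 by (simp add: add.commute)
    ultimately have "(\<nu> + \<mu>) * r' u = d * u powi (k - 3) * (1 - 1 / u) powi l * ((\<nu> - \<mu>) * s' (1 / u))"
      using pf u0 oct_flip_polys(2)[OF u0] by algebra
    hence "r' u = (d * u powi (k - 3) * (1 - 1 / u) powi l * ((\<nu> - \<mu>) * s' (1 / u))) / (\<nu> + \<mu>)"
      using nz by (subst eq_divide_eq) (simp add: mult.commute)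
    thus "r' u = d * (\<nu> - \<mu>) / (\<nu> + \<mu>) * u powi (k - 3) * (1 - 1 / u) powi l * s' (1 / u)"
      by (simp add: mult_ac)
  qed
  thus ?thesis using r'(1) s'(1) unfolding oct_pair_def by blast
qed

text \<open>The operator that raises the order \<mu> of r lowers the order -\<mu> of s. The factor
  \<open>oct_pv (1 / u)\<close> produced by the lowering equals (1 - 1/u)^4 / u, which accounts for
  k + 2 instead of k + 3 and for l + 4.\<close>

lemma oct_pair_mu_up:
  assumes "oct_pair \<nu> \<mu> k l d" "of_int k = 3 * \<nu> + 2 * \<mu>" "of_int l = 4 * \<mu>"
    and nz: "\<mu> \<noteq> 0" "\<mu> + 1 \<noteq> 0" "\<nu> - \<mu> \<noteq> 0" "\<nu> + \<mu> + 1 \<noteq> 0"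
  shows "oct_pair \<nu> (\<mu> + 1) (k + 2) (l + 4)
    (d * 27 * (\<nu> - \<mu>) * (\<nu> + \<mu> + 1) / (\<mu> * (\<mu> + 1)))"
proof -
  obtain r s where rs: "oct_sol \<nu> \<mu> r" "oct_sol \<nu> (- \<mu>) s" "oct_flip d k l r s"
    using assms(1) unfolding oct_pair_def by blast
  obtain r' where r': "oct_sol \<nu> (\<mu> + 1) r'"
    "\<And>u. u \<in> oct_dom \<Longrightarrow> oct_op \<nu> \<mu> r u - \<mu> * oct_pe u * r u = - 2 * \<mu> * r' u"
    using oct_sol_mu_up[OF rs(1) nz(1)] by blast
  have "- \<mu> \<noteq> 1" using nz(2) by (metis add.commute add.right_inverse)
  then obtain s' where s': "oct_sol \<nu> (- \<mu> - 1) s'"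
    "\<And>u. u \<in> oct_dom \<Longrightarrow> oct_op \<nu> (- \<mu>) s u - \<mu> * oct_pe u * s u =
       54 * (\<nu> - \<mu>) * (\<nu> + \<mu> + 1) / (- \<mu> - 1) * oct_pv u * s' u"
    using oct_sol_mu_down[OF rs(2)] nz by auto
  have "oct_flip (d * 27 * (\<nu> - \<mu>) * (\<nu> + \<mu> + 1) / (\<mu> * (\<mu> + 1))) (k + 2) (l + 4) r' s'"
    unfolding oct_flip_def
  proof
    fix u assume u: "u \<in> oct_dom - {0}"
    hence u0: "u \<noteq> 0" "1 - 1 / u \<noteq> 0" by (auto simp: oct_dom_def)
    have "- 2 * \<mu> * r' u = d * u powi (k + 3) * (1 - 1 / u) powi l *
        (54 * (\<nu> - \<mu>) * (\<nu> + \<mu> + 1) / (- \<mu> - 1) * oct_pv (1 / u) * s' (1 / u))"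
      using flip_combination[OF rs(3) _ _ oct_sol_holomorphic[OF rs(2)] assms(2,3), of u "- \<mu>"]
        r'(2) s'(2) u inverse_in_oct_dom by auto
    moreover have "u powi (k + 3) = u powi (k + 2) * u"
      using power_int_add[of u "k + 2" 1] u0 by (simp add: add.commute)
    moreover have "(1 - 1 / u) powi (l + 4) = (1 - 1 / u) powi l * (1 - 1 / u) ^ 4"
      using u0 by (simp add: power_int_add)
    moreover have "oct_pv (1 / u) * u = (1 - 1 / u) ^ 4"
      using u0 by (simp add: oct_pv_def)
    moreover have "54 * (\<nu> - \<mu>) * (\<nu> + \<mu> + 1) / (- \<mu> - 1) = - 54 * (\<nu> - \<mu>) * (\<nu> + \<mu> + 1) * (1 / (\<mu> + 1))"
      using nz \<open>- \<mu> \<noteq> 1\<close> by (simp add: field_simps)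
    ultimately have "2 * \<mu> * r' u = d * 54 * (\<nu> - \<mu>) * (\<nu> + \<mu> + 1) * (1 / (\<mu> + 1)) *
       u powi (k + 2) * (1 - 1 / u) powi (l + 4) * s' (1 / u)"
      by algebra
    hence "r' u * \<mu> = d * 27 * (\<nu> - \<mu>) * (\<nu> + \<mu> + 1) * (1 / (\<mu> + 1)) *
       u powi (k + 2) * (1 - 1 / u) powi (l + 4) * s' (1 / u)"
      by algebra
    hence "r' u = (d * 27 * (\<nu> - \<mu>) * (\<nu> + \<mu> + 1) * (1 / (\<mu> + 1)) *
       u powi (k + 2) * (1 - 1 / u) powi (l + 4) * s' (1 / u)) / \<mu>"
      using nz(1) by (subst eq_divide_eq) simp
    thus "r' u = d * 27 * (\<nu> - \<mu>) * (\<nu> + \<mu> + 1) / (\<mu> * (\<mu> + 1)) *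
        u powi (k + 2) * (1 - 1 / u) powi (l + 4) * s' (1 / u)"
      by (simp add: mult_ac)
  qed
  moreover have "- (\<mu> + 1) = - \<mu> - 1" by simp
  ultimately show ?thesis using r'(1) s'(1) unfolding oct_pair_def by metis
qed

lemma oct_pair_mu_down:
  assumes "oct_pair \<nu> \<mu> k l d" "of_int k = 3 * \<nu> + 2 * \<mu>" "of_int l = 4 * \<mu>"
    and nz: "\<mu> \<noteq> 0" "\<mu> \<noteq> 1" "\<nu> + \<mu> \<noteq> 0" "\<nu> - \<mu> + 1 \<noteq> 0"
  shows "oct_pair \<nu> (\<mu> - 1) (k - 2) (l - 4)
    (d * (\<mu> * (\<mu> - 1)) / (27 * (\<nu> + \<mu>) * (\<nu> - \<mu> + 1)))"
proof -
  obtain r s where rs: "oct_sol \<nu> \<mu> r" "oct_sol \<nu> (- \<mu>) s" "oct_flip d k l r s"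
    using assms(1) unfolding oct_pair_def by blast
  obtain r' where r': "oct_sol \<nu> (\<mu> - 1) r'"
    "\<And>u. u \<in> oct_dom \<Longrightarrow> oct_op \<nu> \<mu> r u + \<mu> * oct_pe u * r u =
       54 * (\<nu> + \<mu>) * (\<nu> - \<mu> + 1) / (\<mu> - 1) * oct_pv u * r' u"
    using oct_sol_mu_down[OF rs(1) nz(2-4)] by blast
  obtain s' where s': "oct_sol \<nu> (- \<mu> + 1) s'"
    "\<And>u. u \<in> oct_dom \<Longrightarrow> oct_op \<nu> (- \<mu>) s u + \<mu> * oct_pe u * s u = 2 * \<mu> * s' u"
    using oct_sol_mu_up[OF rs(2)] nz(1) by auto
  have "oct_flip (d * (\<mu> * (\<mu> - 1)) / (27 * (\<nu> + \<mu>) * (\<nu> - \<mu> + 1))) (k - 2) (l - 4) r' s'"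
    unfolding oct_flip_def
  proof
    fix u assume u: "u \<in> oct_dom - {0}"
    hence u0: "u \<noteq> 0" "1 - 1 / u \<noteq> 0" by (auto simp: oct_dom_def)
    have "54 * (\<nu> + \<mu>) * (\<nu> - \<mu> + 1) / (\<mu> - 1) * oct_pv u * r' u =
        d * u powi (k + 3) * (1 - 1 / u) powi l * (2 * \<mu> * s' (1 / u))"
      using flip_combination[OF rs(3) _ _ oct_sol_holomorphic[OF rs(2)] assms(2,3), of u \<mu>]
        r'(2) s'(2) u inverse_in_oct_dom by auto
    moreover have "u powi (k + 3) = u powi (k - 2) * u ^ 5"
      using power_int_add[of u "k - 2" 5] u0 by (simp add: add.commute)
    moreover have "(1 - 1 / u) powi l = (1 - 1 / u) powi (l - 4) * (1 - 1 / u) ^ 4"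
      using power_int_add[OF disjI1[OF u0(2)], of "l - 4" 4] by simp
    moreover note oct_flip_polys(3)[OF u0(1)]
    moreover have "oct_pv u \<noteq> 0" using u by (auto simp: oct_pv_def oct_dom_def)
    moreover have "54 * (\<nu> + \<mu>) * (\<nu> - \<mu> + 1) / (\<mu> - 1) * (\<mu> - 1) = 54 * (\<nu> + \<mu>) * (\<nu> - \<mu> + 1)"
      using nz(2) by simp
    ultimately have "r' u * (27 * (\<nu> + \<mu>) * (\<nu> - \<mu> + 1)) = d * (\<mu> * (\<mu> - 1)) *
      u powi (k - 2) * (1 - 1 / u) powi (l - 4) * s' (1 / u)"
      by algebra
    hence "r' u = (d * (\<mu> * (\<mu> - 1)) * u powi (k - 2) * (1 - 1 / u) powi (l - 4) * s' (1 / u)) /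
       (27 * (\<nu> + \<mu>) * (\<nu> - \<mu> + 1))"
      using nz by (subst eq_divide_eq) (simp del: distrib_left_numeral)
    thus "r' u = d * (\<mu> * (\<mu> - 1)) / (27 * (\<nu> + \<mu>) * (\<nu> - \<mu> + 1)) *
        u powi (k - 2) * (1 - 1 / u) powi (l - 4) * s' (1 / u)"
      by simp
  qed
  moreover have "- (\<mu> - 1) = - \<mu> + 1" by simp
  ultimately show ?thesis using r'(1) s'(1) unfolding oct_pair_def by metis
qed

section \<open>Recurrences and nonvanishing of the coefficient d\<close>

lemma rising_fact_add1:
  assumes "d + of_int k \<noteq> 0"
  shows "rising_fact d (k + 1) = rising_fact d k * (d + of_int k)"
proof (cases "k \<ge> 0")
  case True
  hence "nat (k + 1) = Suc (nat k)" by simp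
  with True show ?thesis by (simp add: rising_fact_def pochhammer_Suc)
next
  case False
  hence *: "nat (- k) = Suc (nat (- (k + 1)))" by simp
  have "pochhammer (d + of_int k) (nat (- k)) =
      (d + of_int k) * pochhammer (d + of_int (k + 1)) (nat (- (k + 1)))"
    unfolding * pochhammer_rec by (simp add: add.assoc)
  \<comment> \<open>At k = -1 the index k + 1 = 0 falls into the nonnegative branch of
    \<open>rising_fact\<close>; the empty product makes both descriptions equal to 1.\<close>
  moreover have "rising_fact d (k + 1) = inverse (pochhammer (d + of_int (k + 1)) (nat (- (k + 1))))"
    using False by (cases "k = -1") (auto simp: rising_fact_def)
  ultimately show ?thesis using False assms by (simp add: rising_fact_def)
qed

lemma rising_fact_diff1:
  assumes "d + of_int k - 1 \<noteq> 0"
  shows "rising_fact d (k - 1) = rising_fact d k / (d + of_int k - 1)"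
proof -
  have "rising_fact d k = rising_fact d (k - 1) * (d + of_int k - 1)"
    using rising_fact_add1[of d "k - 1"] assms by (simp add: add_diff_eq)
  thus ?thesis using assms by simp
qed

lemma rat_nonzero:
  fixes i j :: int
  assumes "j * i + c \<noteq> 0" "j \<noteq> 0"
  shows "of_int i + of_int c / of_int j \<noteq> (0 :: 'a :: field_char_0)"
proof
  assume "of_int i + of_int c / of_int j = (0 :: 'a)"
  hence "of_int (j * i + c) = (0 :: 'a)" using assms(2) by (simp add: field_simps)
  thus False using assms(1) by (simp only: of_int_eq_0_iff)
qed

text \<open>Multiplied by 4 or 12, each quantity is an integer not divisible by that number. No
  ladder step degenerates, so all pairs (n, m) are reached. The type is generic because
  \<open>oct_d\<close> is real while the equation has complex parameters.\<close>

lemma oct_param_nonzero: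
  fixes n m :: int
  shows "1 / 4 + of_int m \<noteq> (0 :: 'a :: field_char_0)"
    "5 / 4 + of_int m \<noteq> (0 :: 'a)"
    "of_int m - 3 / 4 \<noteq> (0 :: 'a)"
    "1 / 12 + of_int n + of_int m \<noteq> (0 :: 'a)"
    "13 / 12 + of_int n + of_int m \<noteq> (0 :: 'a)"
    "of_int n - of_int m - 5 / 12 \<noteq> (0 :: 'a)"
    "7 / 12 + of_int n - of_int m \<noteq> (0 :: 'a)"
proof -
  have a: "4 * m + 1 \<noteq> 0" "4 * m + 5 \<noteq> 0" "4 * m + (-3) \<noteq> 0" "12 * (n + m) + 1 \<noteq> 0"
    "12 * (n + m) + 13 \<noteq> 0" "12 * (n - m) + (-5) \<noteq> 0" "12 * (n - m) + 7 \<noteq> 0"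
    by presburger+
  show "1 / 4 + of_int m \<noteq> (0 :: 'a :: field_char_0)"
    "5 / 4 + of_int m \<noteq> (0 :: 'a)"
    "of_int m - 3 / 4 \<noteq> (0 :: 'a)"
    "1 / 12 + of_int n + of_int m \<noteq> (0 :: 'a)"
    "13 / 12 + of_int n + of_int m \<noteq> (0 :: 'a)"
    "of_int n - of_int m - 5 / 12 \<noteq> (0 :: 'a)"
    using a[THEN rat_nonzero, where 'a = 'a] by (simp_all add: add_ac)
  show "7 / 12 + of_int n - of_int m \<noteq> (0 :: 'a)"
    using a(7)[THEN rat_nonzero, where 'a = 'a] by (simp add: algebra_simps)
qed

text \<open>The same factor as in \<open>oct_pair_nu_up\<close> at \<nu> = -1/6 + n, \<mu> = 1/4 +
  m. The sign from lowering the index m - n is compensated by the power of -1.\<close>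

lemma oct_d_step_n:
  "oct_d (n + 1) m = oct_d n m * (13 / 12 + of_int n + of_int m) / (7 / 12 + of_int n - of_int m)"
proof -
  define X :: real where "X = 7 / 12 + of_int n - of_int m"
  have "rising_fact (5 / 12) (m - (n + 1)) = - (rising_fact (5 / 12) (m - n) / X)"
  proof -
    have "5 / 12 + real_of_int (m - n) - 1 = - X" by (simp add: X_def)
    moreover have "X \<noteq> 0" using oct_param_nonzero(7)[of n m, where 'a = real] by (simp add: X_def)
    ultimately show ?thesis using rising_fact_diff1[of "5 / 12" "m - n"] by (simp add: diff_diff_eq)
  qed
  moreover have "rising_fact (13 / 12) (m + (n + 1)) = rising_fact (13 / 12) (m + n) * (13 / 12 + of_int n + of_int m)"
    using rising_fact_add1[of "13 / 12" "m + n"] oct_param_nonzero(5)[of n m, where 'a = real]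
    by (simp add: algebra_simps)
  moreover have "(- 1 :: real) powi (m + (n + 1)) = - ((- 1) powi (m + n))"
    by (simp add: power_int_add algebra_simps)
  ultimately show ?thesis unfolding oct_d_def X_def[symmetric] by (simp add: mult_ac)
qed

text \<open>The same factor as in \<open>oct_pair_mu_up\<close>, where 1/4 + m is \<mu> and 5/4 + m
  is \<mu> + 1.\<close>

lemma oct_d_step_m:
  "oct_d n (m + 1) = oct_d n m * 27 * (of_int n - of_int m - 5 / 12) * (13 / 12 + of_int n + of_int m) /
     ((1 / 4 + of_int m) * (5 / 4 + of_int m))"
proof -
  define X :: real where "X = of_int n - of_int m - 5 / 12"
  have "rising_fact (5 / 12) (m + 1 - n) = - (rising_fact (5 / 12) (m - n) * X)"
    using rising_fact_add1[of "5 / 12" "m - n"] oct_param_nonzero(6)[of n m, where 'a = real]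
    by (simp add: X_def algebra_simps)
  moreover have "rising_fact (13 / 12) (m + 1 + n) = rising_fact (13 / 12) (m + n) * (13 / 12 + of_int n + of_int m)"
    using rising_fact_add1[of "13 / 12" "m + n"] oct_param_nonzero(5)[of n m, where 'a = real]
    by (simp add: algebra_simps)
  moreover have "rising_fact (1 / 4) (m + 1) = rising_fact (1 / 4) m * (1 / 4 + of_int m)"
    using rising_fact_add1[of "1 / 4" m] oct_param_nonzero(1)[of m, where 'a = real] by simp
  moreover have "rising_fact (5 / 4) (m + 1) = rising_fact (5 / 4) m * (5 / 4 + of_int m)"
    using rising_fact_add1[of "5 / 4" m] oct_param_nonzero(2)[of m, where 'a = real] by simp
  moreover have "(- 1 :: real) powi (m + 1 + n) = - ((- 1) powi (m + n))"
    by (simp add: power_int_add algebra_simps)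
  moreover have "(3 :: real) powi (3 * (m + 1)) = 27 * 3 powi (3 * m)"
    by (simp add: power_int_add algebra_simps)
  ultimately show ?thesis unfolding oct_d_def X_def[symmetric] by (simp add: mult_ac)
qed

lemma rising_fact_nonzero:
  assumes "\<And>k :: int. d + of_int k \<noteq> 0"
  shows "rising_fact d k \<noteq> 0"
proof -
  have "pochhammer (d + of_int i) j \<noteq> 0" for i :: int and j
    unfolding pochhammer_eq_0_iff using assms[of "i + int l" for l]
    by (auto simp: add.assoc eq_neg_iff_add_eq_0)
  from this[of 0] this show ?thesis by (auto simp: rising_fact_def)
qed

lemma oct_d_nonzero: "oct_d n m \<noteq> 0"
proof -
  have "c / b + of_int k \<noteq> (0 :: real)" if "b \<noteq> 0" "\<not> b dvd c" for b c k :: int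
  proof -
    have "b * k + c \<noteq> 0" using that by (metis dvd_add_right_iff dvd_triv_left dvd_0_right)
    from rat_nonzero[OF this that(1), where 'a = real] show ?thesis by (simp add: add.commute)
  qed
  from this[of 12 5] this[of 12 13] this[of 4 1] this[of 4 5] show ?thesis
    unfolding oct_d_def by (simp add: rising_fact_nonzero)
qed

text \<open>The base case: 2F1(-1/24, 11/24; 3/4; R) is the power -1/12 of
  \<open>oct_pe\<close>.\<close>

lemma oct_sol_const: "oct_sol (- 1 / 6) (1 / 4) (\<lambda>_. 1)"
proof -
  have "\<forall>u\<in>oct_dom. (1::complex) = poly 1 u / ((1 - u) ^ 0 * oct_pf u ^ 0)" by simp
  hence "oct_rational (\<lambda>_. 1)" unfolding oct_rational_def by blast
  moreover have "oct_ode oct_dom (- 1 / 6) (1 / 4) (\<lambda>_. 1)"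
    unfolding oct_ode_def
  proof (intro conjI ballI)
    fix u :: complex
    define g where "g = (\<lambda>u. - (1 / 4 * oct_pe u + 1 / 2 * (u * (1 - u) * (7 + u))))"
    have op: "oct_op (- 1 / 6) (1 / 4) (\<lambda>_. 1) = g"
      by (rule ext, subst oct_op_eq[OF DERIV_const]) (simp add: g_def)
    have g': "(g has_field_derivative - (1 / 4 * (- 33 - 66 * u + 3 * u ^ 2) + 1 / 2 * (7 - 12 * u - 3 * u ^ 2))) (at u)"
      unfolding g_def by (rule derivative_eq_intros refl)+ (simp add: field_simps power2_eq_square)
    show "oct_op (- 1 / 6 + 1) (1 / 4) (oct_op (- 1 / 6) (1 / 4) (\<lambda>_. 1)) u =
       ((1 / 4)\<^sup>2 * oct_pf u ^ 3 - 108 * (- 1 / 6) * (- 1 / 6 + 1) * oct_pv u) * 1"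
      unfolding op oct_op_eq[OF g'] unfolding g_def oct_pe_def oct_pf_def oct_pv_def
      by (simp add: field_simps) algebra
  qed auto
  ultimately show ?thesis by (simp add: oct_sol_def)
qed

text \<open>This partner of the constant solution is dictated by \<open>oct_flip\<close> with d = 1,
  k = 0, l = 1, which demands s(1/u) = 1 / (1 - 1/u).\<close>

lemma oct_sol_inverse: "oct_sol (- 1 / 6) (- (1 / 4)) (\<lambda>u. 1 / (1 - u))"
proof -
  have "\<forall>u\<in>oct_dom. 1 / (1 - u) = poly 1 u / ((1 - u) ^ 1 * oct_pf u ^ 0)" by simp
  hence "oct_rational (\<lambda>u. 1 / (1 - u))" unfolding oct_rational_def by blast
  moreover have "oct_ode oct_dom (- 1 / 6) (- (1 / 4)) (\<lambda>u. 1 / (1 - u))"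
    unfolding oct_ode_def
  proof (intro conjI ballI)
    show "(\<lambda>u. 1 / (1 - u)) holomorphic_on oct_dom"
      by (intro holomorphic_intros) (auto simp: oct_dom_def)
    fix u :: complex assume u: "u \<in> oct_dom"
    have inv': "((\<lambda>u. 1 / (1 - u)) has_field_derivative (1 / (1 - u)) ^ 2) (at u)" if "u \<noteq> 1" for u :: complex
      using that by (auto intro!: derivative_eq_intros simp: power2_eq_square field_simps)
    define N where "N = (\<lambda>u. 2 * u * oct_pf u + 1 / 4 * oct_pe u + 5 / 2 * (u * (1 - u) * (7 + u)))"
    define g where "g = (\<lambda>u. N u * (1 / (1 - u)))"
    have op: "oct_op (- 1 / 6) (- (1 / 4)) (\<lambda>u. 1 / (1 - u)) u = g u" if "u \<in> oct_dom" for u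
    proof -
      have u: "u \<noteq> 1" using that by (simp add: oct_dom_def)
      define t where "t = 1 / (1 - u)"
      have t: "t * (1 - u) = 1" using u by (simp add: t_def)
      show ?thesis unfolding oct_op_eq[OF inv'[OF u]] g_def N_def t_def[symmetric]
        using t by (simp add: field_simps) algebra
    qed
    define N' where "N' = 2 * oct_pf u + 2 * u * (14 + 2 * u) + 1 / 4 * (- 33 - 66 * u + 3 * u ^ 2) + 5 / 2 * (7 - 12 * u - 3 * u ^ 2)"
    have N: "(N has_field_derivative N') (at u)"
      unfolding N_def N'_def by (rule derivative_eq_intros refl)+ (simp add: field_simps power2_eq_square)
    have u1: "u \<noteq> 1" using u by (simp add: oct_dom_def)
    define t where "t = 1 / (1 - u)"
    have t: "t * (1 - u) = 1" using u1 by (simp add: t_def)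
    have g': "(g has_field_derivative N' * t + N u * t ^ 2) (at u)"
      using DERIV_mult[OF N inv'[OF u1]] by (simp add: g_def t_def mult.commute)
    have "oct_op (- 1 / 6 + 1) (- (1 / 4)) (oct_op (- 1 / 6) (- (1 / 4)) (\<lambda>u. 1 / (1 - u))) u =
       oct_op (- 1 / 6 + 1) (- (1 / 4)) g u"
      by (rule oct_op_cong[OF open_oct_dom op u])
    also have "\<dots> = ((- (1 / 4))\<^sup>2 * oct_pf u ^ 3 - 108 * (- 1 / 6) * (- 1 / 6 + 1) * oct_pv u) * (1 / (1 - u))"
      unfolding oct_op_eq[OF g'] unfolding g_def N_def N'_def t_def[symmetric] oct_pe_def oct_pf_def oct_pv_def
      using t by (simp add: field_simps) algebra
    finally show "oct_op (- 1 / 6 + 1) (- (1 / 4)) (oct_op (- 1 / 6) (- (1 / 4)) (\<lambda>u. 1 / (1 - u))) u = 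
      ((- (1 / 4))\<^sup>2 * oct_pf u ^ 3 - 108 * (- 1 / 6) * (- 1 / 6 + 1) * oct_pv u) * (1 / (1 - u))" .
  qed
  ultimately show ?thesis by (simp add: oct_sol_def)
qed

lemma oct_pair_0: "oct_pair (- 1 / 6) (1 / 4) 0 1 1"
proof -
  have "oct_flip 1 0 1 (\<lambda>_. 1) (\<lambda>u. 1 / (1 - u))"
    unfolding oct_flip_def oct_dom_def by (auto simp: field_simps)
  thus ?thesis using oct_sol_const oct_sol_inverse unfolding oct_pair_def by blast
qed

lemma oct_d_0: "oct_d 0 0 = 1"
  by (simp add: oct_d_def rising_fact_def)

lemma oct_pair_cong:
  "oct_pair \<nu> \<mu> k l d \<Longrightarrow> \<nu> = \<nu>' \<Longrightarrow> \<mu> = \<mu>' \<Longrightarrow> k = k' \<Longrightarrow> l = l' \<Longrightarrow> d = d' \<Longrightarrow> oct_pair \<nu>' \<mu>' k' l' d'"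
  by simp

text \<open>Walking the ladders from the base pair, \<open>oct_d\<close> is recognized by its
  recurrences; a descending step uses the recurrence at the preceding index, inverted.\<close>

lemma oct_pair_int:
  "oct_pair (- 1 / 6 + of_int n) (1 / 4 + of_int m) (3 * n + 2 * m) (1 + 4 * m) (of_real (oct_d n m))"
proof (induction n rule: int_induct[where k = 0])
  case base
  show ?case
  proof (induction m rule: int_induct[where k = 0])
    case base
    show ?case using oct_pair_0 by (simp add: oct_d_0)
  next
    case (step1 m)
    let ?\<nu> = "- 1 / 6 + of_int 0 :: complex" and ?\<mu> = "1 / 4 + of_int m :: complex"
    have eqs: "?\<nu> - ?\<mu> = of_int 0 - of_int m - 5 / 12" "?\<nu> + ?\<mu> + 1 = 13 / 12 + of_int 0 + of_int m"
      "?\<mu> + 1 = 5 / 4 + of_int m"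
      by (simp_all add: algebra_simps)
    have "oct_pair ?\<nu> (?\<mu> + 1) (3 * 0 + 2 * m + 2) (1 + 4 * m + 4)
      (of_real (oct_d 0 m) * 27 * (?\<nu> - ?\<mu>) * (?\<nu> + ?\<mu> + 1) / (?\<mu> * (?\<mu> + 1)))"
      by (rule oct_pair_mu_up[OF step1(2)])
         (unfold eqs, use oct_param_nonzero(1-3)[of m, where 'a = complex]
           oct_param_nonzero(4-7)[of 0 m, where 'a = complex] in simp_all)
    thus ?case
    proof (rule oct_pair_cong)
      show "of_real (oct_d 0 m) * 27 * (?\<nu> - ?\<mu>) * (?\<nu> + ?\<mu> + 1) / (?\<mu> * (?\<mu> + 1)) = of_real (oct_d 0 (m + 1))"
        unfolding eqs oct_d_step_m by simp
    qed (simp_all add: algebra_simps)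
  next
    case (step2 m)
    let ?\<nu> = "- 1 / 6 + of_int 0 :: complex" and ?\<mu> = "1 / 4 + of_int m :: complex"
    have eqs: "?\<nu> + ?\<mu> = 1 / 12 + of_int 0 + of_int m" "?\<nu> - ?\<mu> + 1 = 7 / 12 + of_int 0 - of_int m"
      "?\<mu> - 1 = of_int m - 3 / 4"
      by (simp_all add: algebra_simps)
    have ne: "?\<mu> \<noteq> 1"
      using oct_param_nonzero(3)[of m, where 'a = complex] eqs(3) right_minus_eq by metis
    have "oct_pair ?\<nu> (?\<mu> - 1) (3 * 0 + 2 * m - 2) (1 + 4 * m - 4)
      (of_real (oct_d 0 m) * (?\<mu> * (?\<mu> - 1)) / (27 * (?\<nu> + ?\<mu>) * (?\<nu> - ?\<mu> + 1)))"
      by (rule oct_pair_mu_down[OF step2(2)])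
         (unfold eqs, use oct_param_nonzero(1-3)[of m, where 'a = complex]
           oct_param_nonzero(4-7)[of 0 m, where 'a = complex] ne in simp_all)
    thus ?case
    proof (rule oct_pair_cong)
      define X Y :: real where "X = 1 / 12 + of_int 0 + of_int m" and "Y = 7 / 12 + of_int 0 - of_int m"
      define M N :: real where "M = 1 / 4 + of_int m" and "N = of_int m - 3 / 4"
      have "X \<noteq> 0" "Y \<noteq> 0" "M \<noteq> 0" "N \<noteq> 0"
        using oct_param_nonzero(1-3)[of m, where 'a = real] oct_param_nonzero(4-7)[of 0 m, where 'a = real]
        by (simp_all add: X_def Y_def M_def N_def)
      moreover have "of_int 0 - of_int (m - 1) - 5 / 12 = Y" "13 / 12 + of_int 0 + of_int (m - 1) = X"
         "1 / 4 + of_int (m - 1) = N" "5 / 4 + of_int (m - 1) = M"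
        by (simp_all add: X_def Y_def M_def N_def)
      ultimately have *: "oct_d 0 (m - 1) = oct_d 0 m * (M * N) / (27 * X * Y)"
        using oct_d_step_m[of 0 "m - 1"] by simp
      show "of_real (oct_d 0 m) * (?\<mu> * (?\<mu> - 1)) / (27 * (?\<nu> + ?\<mu>) * (?\<nu> - ?\<mu> + 1)) = of_real (oct_d 0 (m - 1))"
        unfolding * eqs by (simp add: X_def Y_def M_def N_def)
    qed (simp_all add: algebra_simps)
  qed
next
  case (step1 n)
  let ?\<nu> = "- 1 / 6 + of_int n :: complex" and ?\<mu> = "1 / 4 + of_int m :: complex"
  have eqs: "?\<nu> - ?\<mu> + 1 = 7 / 12 + of_int n - of_int m" "?\<nu> + ?\<mu> + 1 = 13 / 12 + of_int n + of_int m"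
    by (simp_all add: algebra_simps)
  have "oct_pair (?\<nu> + 1) ?\<mu> (3 * n + 2 * m + 3) (1 + 4 * m)
      (of_real (oct_d n m) * (?\<nu> + ?\<mu> + 1) / (?\<nu> - ?\<mu> + 1))"
    by (rule oct_pair_nu_up[OF step1(2)])
       (unfold eqs, use oct_param_nonzero(4-7)[of n m, where 'a = complex] in simp_all)
  thus ?case
  proof (rule oct_pair_cong)
    show "of_real (oct_d n m) * (?\<nu> + ?\<mu> + 1) / (?\<nu> - ?\<mu> + 1) = of_real (oct_d (n + 1) m)"
      unfolding eqs oct_d_step_n by simp
  qed (simp_all add: algebra_simps)
next
  case (step2 n)
  let ?\<nu> = "- 1 / 6 + of_int n :: complex" and ?\<mu> = "1 / 4 + of_int m :: complex"
  have eqs: "?\<nu> - ?\<mu> = of_int n - of_int m - 5 / 12" "?\<nu> + ?\<mu> = 1 / 12 + of_int n + of_int m"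
    by (simp_all add: algebra_simps)
  have "oct_pair (?\<nu> - 1) ?\<mu> (3 * n + 2 * m - 3) (1 + 4 * m)
      (of_real (oct_d n m) * (?\<nu> - ?\<mu>) / (?\<nu> + ?\<mu>))"
    by (rule oct_pair_nu_down[OF step2(2)])
       (unfold eqs, use oct_param_nonzero(4-7)[of n m, where 'a = complex] in simp_all)
  thus ?case
  proof (rule oct_pair_cong)
    define X Y :: real where "X = of_int n - of_int m - 5 / 12" and "Y = 1 / 12 + of_int n + of_int m"
    have "X \<noteq> 0" "Y \<noteq> 0"
      using oct_param_nonzero(4-7)[of n m, where 'a = real] by (simp_all add: X_def Y_def)
    moreover have "7 / 12 + of_int (n - 1) - of_int m = X" "13 / 12 + of_int (n - 1) + of_int m = Y"
      by (simp_all add: X_def Y_def)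
    ultimately have *: "oct_d (n - 1) m = oct_d n m * X / Y"
      using oct_d_step_n[of "n - 1" m] by simp
    show "of_real (oct_d n m) * (?\<nu> - ?\<mu>) / (?\<nu> + ?\<mu>) = of_real (oct_d (n - 1) m)"
      unfolding * eqs by (simp add: X_def Y_def)
  qed (simp_all add: algebra_simps)
qed

section \<open>Uniqueness at the origin\<close>

text \<open>If W were not zero, it would vanish at 0 to some order n, and comparing leading
  coefficients would give n p(0) = q(0). The case n = 0 of the hypothesis supplies W(0) = 0.\<close>

lemma fuchsian_zero:
  assumes r: "r > 0" and W: "W holomorphic_on ball 0 r" and p: "p holomorphic_on ball 0 r"
    and q: "q holomorphic_on ball 0 r"
    and eq: "\<And>u. u \<in> ball 0 r \<Longrightarrow> u * p u * deriv W u = q u * W u"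
    and ind: "\<And>n :: nat. q 0 \<noteq> of_nat n * (p 0 :: complex)"
    and u: "u \<in> ball 0 r"
  shows "W u = 0"
proof -
  have W0: "W 0 = 0" using eq[of 0] ind[of 0] r by simp
  show ?thesis
  proof (cases "W constant_on ball 0 r")
    case True
    thus ?thesis using W0 u r unfolding constant_on_def by (metis centre_in_ball)
  next
    case False
    have r0: "0 \<in> ball (0::complex) r" using r by simp
    obtain g s n where g: "0 < n" "0 < s" "ball (0::complex) s \<subseteq> ball 0 r" "g holomorphic_on ball 0 s"
       "\<And>w. w \<in> ball 0 s \<Longrightarrow> W w = (w - 0) ^ n * g w" "\<And>w. w \<in> ball 0 s \<Longrightarrow> g w \<noteq> 0"
      by (rule holomorphic_factor_zero_nonconstant[OF W open_ball connected_ball r0 W0 False]) (rule that)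
    note hol = holomorphic_on_subset[OF _ g(3)]
    \<comment> \<open>The equation for W = w^n g after cancelling w^n, evaluated at w = 0; the
      vanishing summand keeps the shape of the identity at general w.\<close>
    have "p 0 * (of_nat n * g 0 + 0 * deriv g 0) = q 0 * g 0"
    proof (rule holomorphic_eq_at[of "ball 0 s" 0])
      fix w :: complex assume w: "w \<in> ball 0 s" "w \<noteq> 0"
      have "(g has_field_derivative deriv g w) (at w)"
        using g(4) w by (auto intro: holomorphic_derivI)
      hence "((\<lambda>w. w ^ n * g w) has_field_derivative of_nat n * w ^ (n - 1) * g w + w ^ n * deriv g w) (at w)"
        by (auto intro!: derivative_eq_intros)
      hence "(W has_field_derivative of_nat n * w ^ (n - 1) * g w + w ^ n * deriv g w) (at w)"
        by (rule has_field_derivative_transform_within_open[where S = "ball 0 s"]) (use g w in auto)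
      hence "deriv W w = of_nat n * w ^ (n - 1) * g w + w ^ n * deriv g w"
        by (rule DERIV_imp_deriv)
      with eq[of w] w g have "w * p w * (of_nat n * w ^ (n - 1) * g w + w ^ n * deriv g w) = q w * (w ^ n * g w)"
        by auto
      moreover have "w ^ n = w * w ^ (n - 1)" using g(1) by (cases n) auto
      ultimately have "w ^ n * (p w * (of_nat n * g w + w * deriv g w)) = w ^ n * (q w * g w)"
        by (simp add: algebra_simps)
      thus "p w * (of_nat n * g w + w * deriv g w) = q w * g w" using w by simp
    qed (use g in \<open>auto intro!: holomorphic_intros hol[OF p] hol[OF q]\<close>)
    thus ?thesis using ind[of n] g(2) g(6)[of 0] by (auto simp: mult.commute)
  qed
qed

text \<open>Near 0 the quotient of the two functions has derivative 0, and the initial values fix it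
  as 1.\<close>

lemma wronskian_zero_imp_eq:
  fixes y1 y2 :: "complex \<Rightarrow> complex"
  assumes r: "r > 0" and y: "y1 holomorphic_on ball 0 r" "y2 holomorphic_on ball 0 r"
    and init: "y1 0 = 1" "y2 0 = 1"
    and W: "\<And>u. u \<in> ball 0 r \<Longrightarrow> u \<noteq> 0 \<Longrightarrow> y1 u * deriv y2 u = y2 u * deriv y1 u"
  shows "eventually (\<lambda>u. y1 u = y2 u) (nhds 0)"
proof -
  have "y1 0 * deriv y2 0 = y2 0 * deriv y1 0"
    by (rule holomorphic_eq_at[of "ball 0 r"]) (use r in \<open>auto intro!: holomorphic_intros y W\<close>)
  hence W: "y1 u * deriv y2 u = y2 u * deriv y1 u" if "u \<in> ball 0 r" for u
    by (cases "u = 0") (use W that in simp_all)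
  have "open (ball 0 r \<inter> y2 -` (- {0}))"
    by (intro continuous_open_preimage holomorphic_on_imp_continuous_on y) auto
  moreover have "0 \<in> ball 0 r \<inter> y2 -` (- {0})" using r init by auto
  ultimately obtain s where s: "s > 0" "ball 0 s \<subseteq> ball 0 r \<inter> y2 -` (- {0})"
    by (meson open_contains_ball)
  have "\<exists>c. \<forall>u\<in>ball 0 s. y1 u / y2 u = c"
  proof (rule has_field_derivative_zero_constant)
    fix u :: complex assume u: "u \<in> ball 0 s"
    hence u': "u \<in> ball 0 r" "y2 u \<noteq> 0" using s by auto
    have "(y1 has_field_derivative deriv y1 u) (at u)" "(y2 has_field_derivative deriv y2 u) (at u)"
      using u' by (auto intro!: holomorphic_derivI y)
    note D = DERIV_divide[OF this u'(2)]
    have "deriv y1 u * y2 u - y1 u * deriv y2 u = 0"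
      unfolding W[OF u'(1)] by (simp add: mult.commute)
    hence "((\<lambda>u. y1 u / y2 u) has_field_derivative 0) (at u)" using D by simp
    thus "((\<lambda>u. y1 u / y2 u) has_field_derivative 0) (at u within ball 0 s)"
      by (rule has_field_derivative_at_within)
  qed auto
  then obtain c where c: "\<And>u. u \<in> ball 0 s \<Longrightarrow> y1 u / y2 u = c" by blast
  from c[of 0] s init have "c = 1" by auto
  hence "y1 u = y2 u" if "u \<in> ball 0 s" for u using c[OF that] that s by auto
  moreover have "eventually (\<lambda>u. u \<in> ball 0 s) (nhds 0)"
    using s by (intro eventually_nhds_in_open) auto
  ultimately show ?thesis by (auto elim: eventually_mono)
qed

text \<open>\<open>W\<close> is 2 u (1 - u) \<open>oct_pf\<close> times the Wronskian, because the
  zeroth-order terms cancel. It satisfies a first-order equation whose coefficient \<open>q\<close>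
  adds the zeroth-order coefficients of the two operators. At 0 the condition of
  \<open>fuchsian_zero\<close> becomes 2 \<mu> different from 2 n, that is, \<mu> not
  natural.\<close>

lemma oct_ode_unique:
  assumes A: "open A" "0 \<in> A" and y: "oct_ode A \<nu> \<mu> y1" "oct_ode A \<nu> \<mu> y2"
    and init: "y1 0 = 1" "y2 0 = 1" and \<mu>: "\<mu> \<notin> \<nat>"
  shows "eventually (\<lambda>u. y1 u = y2 u) (nhds 0)"
proof -
  have "open (A \<inter> oct_dom)" "0 \<in> A \<inter> oct_dom" using A by auto
  then obtain r where r: "r > 0" "ball 0 r \<subseteq> A \<inter> oct_dom" by (meson open_contains_ball)
  have y1: "y1 holomorphic_on A" and y2: "y2 holomorphic_on A" using y by (auto simp: oct_ode_def)
  define o1 o2 where "o1 = oct_op \<nu> \<mu> y1" and "o2 = oct_op \<nu> \<mu> y2"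
  have o: "o1 holomorphic_on A" "o2 holomorphic_on A"
    unfolding o1_def o2_def by (intro oct_op_holomorphic A y1 y2)+
  define W where "W = (\<lambda>u. y1 u * o2 u - y2 u * o1 u)"
  define q where "q = (\<lambda>u. 2 * \<mu> * oct_pe u + 6 * (2 * \<nu> + 1 + 2 * \<mu>) * u * (1 - u) * (7 + u))"
  have W0: "W u = 0" if "u \<in> ball 0 r" for u
  proof (rule fuchsian_zero[OF r(1), where W = W and p = "\<lambda>u. 2 * (1 - u) * oct_pf u" and q = q])
    have "W holomorphic_on A"
      unfolding W_def by (intro holomorphic_intros y1 y2 o)
    thus "W holomorphic_on ball 0 r"
      using r by (auto intro: holomorphic_on_subset)
    fix u :: complex assume "u \<in> ball 0 r"
    hence u: "u \<in> A" using r by auto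
    note D = holomorphic_derivI[OF _ A(1) u]
    have "(W has_field_derivative deriv y1 u * o2 u + deriv o2 u * y1 u -
        (deriv y2 u * o1 u + deriv o1 u * y2 u)) (at u)"
      unfolding W_def by (intro DERIV_diff DERIV_mult D y1 y2 o)
    hence "deriv W u = deriv y1 u * o2 u + deriv o2 u * y1 u - (deriv y2 u * o1 u + deriv o1 u * y2 u)"
      by (rule DERIV_imp_deriv)
    note dW = this
    define P K K' S where "P = 2 * u * (1 - u) * oct_pf u"
      and "K = \<mu> * oct_pe u + 6 * (\<nu> + \<mu>) * u * (1 - u) * (7 + u)"
      and "K' = \<mu> * oct_pe u + 6 * (\<nu> + 1 + \<mu>) * u * (1 - u) * (7 + u)"
      and "S = \<mu> ^ 2 * oct_pf u ^ 3 - 108 * \<nu> * (\<nu> + 1) * oct_pv u"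
    have "oct_op (\<nu> + 1) \<mu> o1 u = S * y1 u" "oct_op (\<nu> + 1) \<mu> o2 u = S * y2 u"
      using y u by (auto simp: oct_ode_def o1_def o2_def S_def)
    hence P2: "P * deriv o1 u = S * y1 u + K' * o1 u" "P * deriv o2 u = S * y2 u + K' * o2 u"
      unfolding oct_op_def P_def[symmetric] K'_def[symmetric] by (simp_all add: diff_eq_eq)
    have "o1 u = P * deriv y1 u - K * y1 u" "o2 u = P * deriv y2 u - K * y2 u"
      by (simp_all add: o1_def o2_def oct_op_def P_def K_def)
    hence P1: "P * deriv y1 u = o1 u + K * y1 u" "P * deriv y2 u = o2 u + K * y2 u" by simp_all
    have "P * deriv W u = (P * deriv y1 u) * o2 u + (P * deriv o2 u) * y1 u -
        ((P * deriv y2 u) * o1 u + (P * deriv o1 u) * y2 u)"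
      unfolding dW by (simp add: algebra_simps)
    also have "\<dots> = (K + K') * W u" unfolding P1 P2 W_def by (simp add: algebra_simps)
    also have "K + K' = q u" by (simp add: K_def K'_def q_def algebra_simps)
    finally show "u * (2 * (1 - u) * oct_pf u) * deriv W u = q u * W u"
      by (simp add: P_def mult_ac)
  next
    fix n :: nat
    have "\<mu> \<noteq> of_nat n" using \<mu> by auto
    thus "q 0 \<noteq> of_nat n * (2 * (1 - 0) * oct_pf 0)"
      by (simp add: q_def oct_pe_def oct_pf_def)
  next
    show "(\<lambda>u. 2 * (1 - u) * oct_pf u) holomorphic_on ball 0 r"
      by (intro holomorphic_intros)
    show "q holomorphic_on ball 0 r"
      unfolding q_def by (intro holomorphic_intros)
  qed (rule that)
  show ?thesis
  proof (rule wronskian_zero_imp_eq[OF r(1)])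
    show "y1 holomorphic_on ball 0 r" "y2 holomorphic_on ball 0 r"
      using r by (auto intro: holomorphic_on_subset[OF y1] holomorphic_on_subset[OF y2])
    fix u :: complex assume u: "u \<in> ball 0 r" "u \<noteq> 0"
    have "u \<in> oct_dom" using r u by blast
    hence "2 * u * (1 - u) * oct_pf u \<noteq> 0" using u by (simp add: oct_dom_def)
    moreover have "2 * u * (1 - u) * oct_pf u * (y1 u * deriv y2 u - y2 u * deriv y1 u) = W u"
      unfolding W_def o1_def o2_def oct_op_def by (simp add: algebra_simps)
    ultimately show "y1 u * deriv y2 u = y2 u * deriv y1 u" using W0[OF u(1)] by simp
  qed (use init in auto)
qed

section \<open>The hypergeometric equation\<close>

context
  fixes a b c :: complex
  assumes c: "\<And>n :: nat. c + of_nat n \<noteq> 0"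
begin

lemma fps_hypergeo_Suc:
  "fps_nth (fps_hypergeo [a, b] [c] 1) (Suc n) =
     (a + of_nat n) * (b + of_nat n) / ((1 + of_nat n) * (c + of_nat n)) * fps_nth (fps_hypergeo [a, b] [c] 1) n"
  by (simp only: fps_hypergeo_rec foldl.simps of_nat_Suc mult_1)

lemma fps_hypergeo_ode:
  defines "H \<equiv> fps_hypergeo [a, b] [c] (1 :: complex)"
  shows "fps_X * fps_deriv (fps_deriv H) - fps_X * (fps_X * fps_deriv (fps_deriv H)) +
     fps_const c * fps_deriv H - fps_const (a + b + 1) * (fps_X * fps_deriv H) = fps_const (a * b) * H"
proof (rule fps_ext)
  fix n :: nat
  have rec: "fps_nth H (Suc n) * ((1 + of_nat n) * (c + of_nat n)) = (a + of_nat n) * (b + of_nat n) * fps_nth H n" for n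
  proof -
    have "(1 + of_nat n :: complex) \<noteq> 0" by (metis of_nat_Suc of_nat_neq_0)
    thus ?thesis using fps_hypergeo_Suc[of n] c[of n] unfolding H_def
      by (simp del: fps_hypergeo_nth)
  qed
  show "fps_nth (fps_X * fps_deriv (fps_deriv H) - fps_X * (fps_X * fps_deriv (fps_deriv H)) +
     fps_const c * fps_deriv H - fps_const (a + b + 1) * (fps_X * fps_deriv H)) n = fps_nth (fps_const (a * b) * H) n"
  \<comment> \<open>The terms with one or two factors \<open>fps_X\<close> have exceptional
    coefficients at n = 0 and n = 1.\<close>
  proof (cases n)
    case 0
    show ?thesis using rec[of 0] by (simp add: 0 mult.commute)
  next
    case (Suc m)
    show ?thesis
    proof (cases m)
      case 0
      show ?thesis using rec[of 1] by (simp add: Suc 0) algebra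
    next
      case (Suc l)
      have n: "n = Suc (Suc l)" using \<open>n = Suc m\<close> Suc by simp
      show ?thesis using rec[of n] unfolding n by simp algebra
    qed
  qed
qed

lemma fps_conv_radius_hypergeo: "fps_conv_radius (fps_hypergeo [a, b] [c] 1) \<ge> 1"
proof -
  define h where "h = fps_nth (fps_hypergeo [a, b] [c] (1 :: complex))"
  have "summable (\<lambda>n. h n * of_real r ^ n)" if r: "0 < r" "r < 1" for r :: real
  proof -
    define t where "t = (\<lambda>n. (a + of_nat n) * (b + of_nat n) / ((1 + of_nat n) * (c + of_nat n)) * of_real r)"
    have *: "(\<lambda>n. (z + of_nat n) / (w + of_nat n)) \<longlonglongrightarrow> 1" for z w :: complex
    proof -
      have "(\<lambda>n. 1 + (z - w) * inverse (w + of_nat n)) \<longlonglongrightarrow> 1 + (z - w) * 0"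
        by (intro tendsto_intros tendsto_inverse_0[THEN filterlim_compose]
              tendsto_add_filterlim_at_infinity[OF tendsto_const] tendsto_of_nat)
      moreover have "eventually (\<lambda>n. w + of_nat n \<noteq> 0) sequentially"
        using filterlim_at_infinity_imp_eventually_ne[OF tendsto_add_filterlim_at_infinity[OF tendsto_const tendsto_of_nat]]
        by blast
      hence "eventually (\<lambda>n. 1 + (z - w) * inverse (w + of_nat n) = (z + of_nat n) / (w + of_nat n)) sequentially"
        by eventually_elim (simp add: field_simps)
      ultimately show ?thesis by (subst (asm) tendsto_cong) auto
    qed
    have "(\<lambda>n. (a + of_nat n) / (1 + of_nat n) * ((b + of_nat n) / (c + of_nat n)) * of_real r) \<longlonglongrightarrow> 1 * 1 * of_real r"
      by (intro tendsto_intros *)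
    hence "t \<longlonglongrightarrow> of_real r" by (simp add: t_def)
    hence "(\<lambda>n. norm (t n)) \<longlonglongrightarrow> norm (of_real r :: complex)" by (rule tendsto_norm)
    hence lim: "(\<lambda>n. norm (t n)) \<longlonglongrightarrow> r" using r by simp
    define C where "C = (1 + r) / 2"
    have C: "r < C" "C < 1" using r by (auto simp: C_def)
    have "eventually (\<lambda>n. norm (t n) < C) sequentially"
      using lim C by (auto intro: order_tendstoD)
    then obtain N where N: "\<And>n. n \<ge> N \<Longrightarrow> norm (t n) < C"
      by (auto simp: eventually_at_top_linorder)
    show ?thesis
    proof (rule summable_ratio_test[OF C(2)])
      fix n assume n: "n \<ge> N"
      have "h (Suc n) * of_real r ^ Suc n = t n * (h n * of_real r ^ n)"
        unfolding h_def by (subst fps_hypergeo_Suc) (simp add: t_def mult_ac)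
      hence "norm (h (Suc n) * of_real r ^ Suc n) = norm (t n) * norm (h n * of_real r ^ n)"
        by (simp only: norm_mult)
      also have "\<dots> \<le> C * norm (h n * of_real r ^ n)"
        using N[OF n] by (intro mult_right_mono) auto
      finally show "norm (h (Suc n) * of_real r ^ Suc n) \<le> C * norm (h n * of_real r ^ n)" .
    qed
  qed
  hence "conv_radius h \<ge> 1"
    by (intro conv_radius_geI_ex') auto
  thus ?thesis by (simp add: fps_conv_radius_def h_def)
qed

text \<open>The formal identity \<open>fps_hypergeo_ode\<close> is summed coefficientwise at x,
  where the series of F and of its two derivatives all converge.\<close>

lemma hypergeo_ode:
  defines "F \<equiv> eval_fps (fps_hypergeo [a, b] [c] 1)"
  assumes x: "norm x < 1"
  shows "(F has_field_derivative deriv F x) (at x)"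
    "(deriv F has_field_derivative deriv (deriv F) x) (at x)"
    "x * (1 - x) * deriv (deriv F) x + (c - (a + b + 1) * x) * deriv F x = a * b * F x"
proof -
  define H where "H = fps_hypergeo [a, b] [c] (1 :: complex)"
  have FH: "F = eval_fps H" by (simp add: F_def H_def)
  have R: "ereal (norm z) < fps_conv_radius H" if "norm z < 1" for z :: complex
  proof -
    have "ereal (norm z) < 1" using that by simp
    thus ?thesis using fps_conv_radius_hypergeo unfolding H_def by (rule less_le_trans)
  qed
  have R1: "ereal (norm z) < fps_conv_radius (fps_deriv H)" if "norm z < 1" for z :: complex
    using R[OF that] fps_conv_radius_deriv[of H] by simp
  have R2: "ereal (norm z) < fps_conv_radius (fps_deriv (fps_deriv H))" if "norm z < 1" for z :: complex
    using R1[OF that] fps_conv_radius_deriv[of "fps_deriv H"] by simp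
  have F: "F holomorphic_on ball 0 1"
    unfolding FH by (intro holomorphic_on_eval_fps) (use R in \<open>auto simp: in_eball_iff\<close>)
  show D1: "(F has_field_derivative deriv F x) (at x)"
    using x by (intro holomorphic_derivI[OF F]) auto
  show "(deriv F has_field_derivative deriv (deriv F) x) (at x)"
    using x by (intro holomorphic_derivI[OF holomorphic_deriv[OF F]]) auto
  have d1: "deriv F z = eval_fps (fps_deriv H) z" if "norm z < 1" for z
    unfolding FH by (intro DERIV_imp_deriv has_field_derivative_eval_fps R that)
  have "deriv (deriv F) x = deriv (eval_fps (fps_deriv H)) x"
    by (rule complex_derivative_transform_within_open[of _ "ball 0 1"])
       (use d1 x R1 F in \<open>auto intro!: holomorphic_deriv holomorphic_on_eval_fps simp: in_eball_iff\<close>)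
  also have "\<dots> = eval_fps (fps_deriv (fps_deriv H)) x"
    by (intro DERIV_imp_deriv has_field_derivative_eval_fps R1 x)
  finally have d2: "deriv (deriv F) x = eval_fps (fps_deriv (fps_deriv H)) x" .
  note ode = fps_hypergeo_ode[folded H_def]
  have sums: "(\<lambda>n. fps_nth H n * x ^ n) sums F x"
    "(\<lambda>n. fps_nth (fps_deriv H) n * x ^ n) sums deriv F x"
    "(\<lambda>n. fps_nth (fps_deriv (fps_deriv H)) n * x ^ n) sums deriv (deriv F) x"
    using sums_eval_fps[OF R[OF x]] sums_eval_fps[OF R1[OF x]] sums_eval_fps[OF R2[OF x]] x
    by (simp_all add: FH d1[unfolded FH] d2[unfolded FH])
  have mX: "(\<lambda>n. fps_nth (fps_X * G) n * x ^ n) sums (x * s)"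
    if "(\<lambda>n. fps_nth G n * x ^ n) sums s" for G :: "complex fps" and s
  proof -
    have "(\<lambda>n. fps_nth (fps_X * G) (Suc n) * x ^ Suc n) sums (x * s)"
      using sums_mult[OF that, of x] by (simp add: mult_ac)
    thus ?thesis by (subst (asm) sums_Suc_iff) simp
  qed
  have mC: "(\<lambda>n. fps_nth (fps_const k * G) n * x ^ n) sums (k * s)"
    if "(\<lambda>n. fps_nth G n * x ^ n) sums s" for G :: "complex fps" and s k
    using sums_mult[OF that, of k] by (simp add: mult_ac)
  have add: "(\<lambda>n. fps_nth (G + K) n * x ^ n) sums (s + t)" "(\<lambda>n. fps_nth (G - K) n * x ^ n) sums (s - t)"
    if "(\<lambda>n. fps_nth G n * x ^ n) sums s" "(\<lambda>n. fps_nth K n * x ^ n) sums t"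
    for G K :: "complex fps" and s t
    using sums_add[OF that] sums_diff[OF that] by (simp_all add: algebra_simps)
  have "x * deriv (deriv F) x - x * (x * deriv (deriv F) x) + c * deriv F x - (a + b + 1) * (x * deriv F x) =
     a * b * F x"
  proof (rule sums_unique2)
    show "(\<lambda>n. fps_nth (fps_const (a * b) * H) n * x ^ n) sums
       (x * deriv (deriv F) x - x * (x * deriv (deriv F) x) + c * deriv F x - (a + b + 1) * (x * deriv F x))"
      unfolding ode[symmetric] by (intro add mX mC sums)
    show "(\<lambda>n. fps_nth (fps_const (a * b) * H) n * x ^ n) sums (a * b * F x)"
      by (intro mC sums)
  qed
  thus "x * (1 - x) * deriv (deriv F) x + (c - (a + b + 1) * x) * deriv F x = a * b * F x"
    by (simp add: algebra_simps)
qed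

end

section \<open>Pulling back the hypergeometric equations\<close>

text \<open>The branch of the square root with value 1 at u = 0, so that z =
  \<open>oct_pe u / oct_q u ^ 3\<close> starts at 1 and x = (1 - z)/2 at 0.\<close>

definition oct_q :: "complex \<Rightarrow> complex" where
  "oct_q u = csqrt (oct_pf u)"

definition oct_x :: "complex \<Rightarrow> complex" where
  "oct_x u = (1 - oct_pe u / oct_q u ^ 3) / 2"

lemma oct_q_square: "oct_q u ^ 2 = oct_pf u"
  by (simp add: oct_q_def)

lemma oct_q_0: "oct_q 0 = 1" and oct_x_0: "oct_x 0 = 0"
  by (simp_all add: oct_q_def oct_x_def oct_pf_def oct_pe_def)

lemma DERIV_powr_log:
  fixes f :: "complex \<Rightarrow> complex"
  assumes "(f has_field_derivative f') (at u)" "f u \<notin> \<real>\<^sub>\<le>\<^sub>0"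
  shows "((\<lambda>u. f u powr s) has_field_derivative f u powr s * (s * f' / f u)) (at u)"
proof -
  have nz: "f u \<noteq> 0" using assms(2) by auto
  have "((\<lambda>u. f u powr s) has_field_derivative s * f u powr (s - 1) * f') (at u)"
    using DERIV_chain2[OF has_field_derivative_powr[OF assms(2)] assms(1)] .
  also have "s * f u powr (s - 1) * f' = f u powr s * (s * f' / f u)"
    using nz by (simp add: powr_diff)
  finally show ?thesis .
qed

lemma oct_q_deriv:
  assumes "oct_pf u \<notin> \<real>\<^sub>\<le>\<^sub>0"
  shows "(oct_q has_field_derivative (7 + u) / oct_q u) (at u)"
proof -
  have "((\<lambda>u. csqrt (oct_pf u)) has_field_derivative ((14 + 2 * u) * 1 / (2 * csqrt (oct_pf u)))) (at u)"
    by (rule derivative_intros assms)+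
  also have "(14 + 2 * u) * 1 / (2 * csqrt (oct_pf u)) = (7 + u) / oct_q u"
  proof -
    have *: "14 + 2 * u = 2 * (7 + u)" by simp
    show ?thesis unfolding oct_q_def mult_1_right * by (rule mult_divide_mult_cancel_left) simp
  qed
  finally show ?thesis by (simp add: oct_q_def[abs_def])
qed

lemma oct_q_nz: "oct_pf u \<notin> \<real>\<^sub>\<le>\<^sub>0 \<Longrightarrow> oct_q u \<noteq> 0"
  by (auto simp: oct_q_def)

lemma oct_q_nonpos: "oct_pf u \<notin> \<real>\<^sub>\<le>\<^sub>0 \<Longrightarrow> oct_q u \<notin> \<real>\<^sub>\<le>\<^sub>0"
  using csqrt_principal[of "oct_pf u"] oct_q_nz[of u]
  by (auto simp: oct_q_def complex_nonpos_Reals_iff complex_eq_iff)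

text \<open>In the variable x, D is 2 x (1 - x) d/dx; this is the chain rule matching it with the
  derivation in u.\<close>

lemma oct_x_deriv:
  assumes "oct_pf u \<notin> \<real>\<^sub>\<le>\<^sub>0"
  shows "\<exists>x'. (oct_x has_field_derivative x') (at u) \<and>
     2 * u * (1 - u) * oct_pf u * x' = 2 * oct_q u ^ 3 * oct_x u * (1 - oct_x u)"
proof (intro exI conjI)
  note q' = oct_q_deriv[OF assms]
  have nz: "oct_q u \<noteq> 0" by (rule oct_q_nz[OF assms])
  define q where "q = oct_q u"
  define N where "N = (- 33 - 66 * u + 3 * u ^ 2) * q ^ 2 - 3 * oct_pe u * (7 + u)"
  have pe': "(oct_pe has_field_derivative (- 33 - 66 * u + 3 * u ^ 2)) (at u)"
    using has_field_derivative_oct_pe[OF DERIV_ident] by simp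
  have "((\<lambda>u. (1 - oct_pe u / oct_q u ^ 3) / 2) has_field_derivative
     (0 - ((- 33 - 66 * u + 3 * u ^ 2) * oct_q u ^ 3 - oct_pe u * (of_nat 3 * ((7 + u) / oct_q u * oct_q u ^ (3 - Suc 0))))
        / (oct_q u ^ 3 * oct_q u ^ 3)) / 2) (at u)"
    using nz by (intro DERIV_cdivide DERIV_diff DERIV_const DERIV_divide DERIV_power pe' q') auto
  also have "(0 - ((- 33 - 66 * u + 3 * u ^ 2) * oct_q u ^ 3 - oct_pe u * (of_nat 3 * ((7 + u) / oct_q u * oct_q u ^ (3 - Suc 0))))
        / (oct_q u ^ 3 * oct_q u ^ 3)) / 2 = - (N / (2 * q ^ 5))"
    using nz unfolding N_def q_def[symmetric] by (simp add: field_simps power_numeral_reduce)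
  finally show "(oct_x has_field_derivative - (N / (2 * q ^ 5))) (at u)"
    by (simp add: oct_x_def[abs_def])
  have pf: "oct_pf u = q ^ 2" by (simp add: q_def oct_q_square)
  have N: "2 * u * (1 - u) * N = - 108 * oct_pv u"
    unfolding N_def pf[symmetric] oct_pf_def oct_pe_def oct_pv_def by algebra
  have "2 * u * (1 - u) * oct_pf u * - (N / (2 * q ^ 5)) = - (2 * u * (1 - u) * N) / (2 * q ^ 3)"
    using nz unfolding pf q_def[symmetric] by (simp add: field_simps power_numeral_reduce)
  also have "\<dots> = 54 * oct_pv u / q ^ 3"
    unfolding N by simp
  also have "\<dots> = (108 * oct_pv u) / (2 * q ^ 3)" by simp
  also have "108 * oct_pv u = q ^ 6 - oct_pe u ^ 2"
    using oct_pf_cube[of u] unfolding pf by (simp add: power_mult[symmetric])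
  also have "(q ^ 6 - oct_pe u ^ 2) / (2 * q ^ 3) = 2 * oct_q u ^ 3 * oct_x u * (1 - oct_x u)"
  proof -
    define Q z where "Q = q ^ 3" and "z = oct_pe u / q ^ 3"
    have Q: "Q \<noteq> 0" using nz by (simp add: Q_def q_def)
    have pe: "oct_pe u = z * Q" and q6: "q ^ 6 = Q ^ 2"
      using Q by (simp_all add: z_def Q_def power_mult[symmetric])
    have x: "oct_x u = (1 - z) / 2" by (simp add: oct_x_def z_def q_def)
    have "Q ^ 2 - (z * Q) ^ 2 = 2 * Q * ((1 - z) / 2) * (1 - (1 - z) / 2) * (2 * Q)"
      by (simp add: field_simps power2_eq_square)
    hence "(Q ^ 2 - (z * Q) ^ 2) / (2 * Q) = 2 * Q * ((1 - z) / 2) * (1 - (1 - z) / 2)"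
      using Q by (subst nonzero_divide_eq_eq) simp_all
    thus ?thesis
      unfolding pe q6 x q_def[symmetric] Q_def[symmetric] .
  qed
  finally show "2 * u * (1 - u) * oct_pf u * - (N / (2 * q ^ 5)) = 2 * oct_q u ^ 3 * oct_x u * (1 - oct_x u)" .
qed

text \<open>Since x (1 - x) = 27 p_v / p_f^3, combining \<open>\<phi>\<close> with the factor ((z +
  1)/(z - 1))^(\<mu>/2) of the Legendre function leaves precisely this prefactor, up to a constant.
  On G the operator then acts as 2 x (1 - x) d/dx - \<mu>.\<close>

lemma oct_op_x:
  fixes \<nu> \<mu> :: complex
  assumes pf: "oct_pf u \<notin> \<real>\<^sub>\<le>\<^sub>0" and x: "1 - oct_x u \<notin> \<real>\<^sub>\<le>\<^sub>0"
    and G: "(G has_field_derivative G') (at (oct_x u))"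
  defines "y \<equiv> (\<lambda>u. (1 - oct_x u) powr \<mu> * oct_q u powr (3 * (\<nu> + \<mu>)) * G (oct_x u))"
  shows "\<exists>y'. (y has_field_derivative y') (at u)"
    "oct_op \<nu> \<mu> y u = (1 - oct_x u) powr \<mu> * oct_q u powr (3 * (\<nu> + 1 + \<mu>)) *
       (2 * oct_x u * (1 - oct_x u) * G' - \<mu> * G (oct_x u))"
proof -
  obtain x' where x': "(oct_x has_field_derivative x') (at u)"
    "2 * u * (1 - u) * oct_pf u * x' = 2 * oct_q u ^ 3 * oct_x u * (1 - oct_x u)"
    using oct_x_deriv[OF pf] by blast
  have nz: "oct_q u \<noteq> 0" "1 - oct_x u \<noteq> 0" using oct_q_nz[OF pf] x by auto
  define M1 M2 X q where "M1 = (1 - oct_x u) powr \<mu>" and "M2 = oct_q u powr (3 * (\<nu> + \<mu>))"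
    and "X = oct_x u" and "q = oct_q u"
  define t where "t = 1 / (1 - X)"
  have t: "t * (1 - X) = 1" using nz by (simp add: t_def X_def)
  define s where "s = 1 / q"
  have s: "s * q = 1" using nz by (simp add: s_def q_def)
  have D1: "((\<lambda>u. (1 - oct_x u) powr \<mu>) has_field_derivative M1 * (\<mu> * (0 - x') / (1 - oct_x u))) (at u)"
    unfolding M1_def by (intro DERIV_powr_log DERIV_diff DERIV_const x' x)
  have D2: "((\<lambda>u. oct_q u powr (3 * (\<nu> + \<mu>))) has_field_derivative
      M2 * (3 * (\<nu> + \<mu>) * ((7 + u) / oct_q u) / oct_q u)) (at u)"
    unfolding M2_def by (intro DERIV_powr_log oct_q_deriv oct_q_nonpos pf)
  have D3: "((\<lambda>u. G (oct_x u)) has_field_derivative G' * x') (at u)"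
    by (rule DERIV_chain2[OF G x'(1)])
  define y' where "y' = M1 * M2 * ((- \<mu> * x' * t + 3 * (\<nu> + \<mu>) * (7 + u) * s ^ 2) * G X + G' * x')"
  have "(y has_field_derivative (M1 * (\<mu> * (0 - x') / (1 - oct_x u)) * oct_q u powr (3 * (\<nu> + \<mu>)) +
     M2 * (3 * (\<nu> + \<mu>) * ((7 + u) / oct_q u) / oct_q u) * (1 - oct_x u) powr \<mu>) * G (oct_x u) +
      G' * x' * ((1 - oct_x u) powr \<mu> * oct_q u powr (3 * (\<nu> + \<mu>)))) (at u)"
    unfolding y_def by (intro DERIV_mult D1 D2 D3)
  also have "(M1 * (\<mu> * (0 - x') / (1 - oct_x u)) * oct_q u powr (3 * (\<nu> + \<mu>)) +
     M2 * (3 * (\<nu> + \<mu>) * ((7 + u) / oct_q u) / oct_q u) * (1 - oct_x u) powr \<mu>) * G (oct_x u) +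
      G' * x' * ((1 - oct_x u) powr \<mu> * oct_q u powr (3 * (\<nu> + \<mu>))) = y'"
    unfolding M1_def[symmetric] M2_def[symmetric]
    unfolding X_def[symmetric] q_def[symmetric] y'_def t_def s_def
    by (simp add: divide_inverse algebra_simps power2_eq_square)
  finally have y': "(y has_field_derivative y') (at u)" .
  thus "\<exists>y'. (y has_field_derivative y') (at u)" ..
  define P where "P = 2 * u * (1 - u) * oct_pf u"
  have Px: "P * x' = 2 * q ^ 3 * X * (1 - X)" using x'(2) by (simp add: P_def X_def q_def)
  have Ps: "P * s ^ 2 = 2 * u * (1 - u)"
  proof -
    have "oct_pf u = q ^ 2" by (simp add: q_def oct_q_square)
    moreover have "q ^ 2 * s ^ 2 = 1" using s by (simp add: power_mult_distrib[symmetric] mult.commute)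
    ultimately show ?thesis by (simp add: P_def mult.assoc)
  qed
  have pe: "oct_pe u = q ^ 3 * (1 - 2 * X)"
  proof -
    have "2 * X = 1 - oct_pe u / q ^ 3"
      unfolding X_def oct_x_def q_def by (subst times_divide_eq_right, rule nonzero_mult_div_cancel_left) simp
    thus ?thesis using nz(1) by (simp add: q_def)
  qed
  have "oct_op \<nu> \<mu> y u = P * y' - (\<mu> * oct_pe u + 6 * (\<nu> + \<mu>) * u * (1 - u) * (7 + u)) * y u"
    unfolding oct_op_eq[OF y'] P_def ..
  also have "y u = M1 * M2 * G X" by (simp add: y_def M1_def M2_def X_def)
  also have "P * y' = M1 * M2 * ((- \<mu> * (P * x') * t + 3 * (\<nu> + \<mu>) * (7 + u) * (P * s ^ 2)) * G X + G' * (P * x'))"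
    unfolding y'_def by (simp add: algebra_simps)
  also have "\<dots> = M1 * M2 * ((- \<mu> * (2 * q ^ 3 * X) + 6 * (\<nu> + \<mu>) * (7 + u) * (u * (1 - u))) * G X
      + G' * (2 * q ^ 3 * X * (1 - X)))"
    unfolding Px Ps using t by algebra
  also have "\<dots> - (\<mu> * oct_pe u + 6 * (\<nu> + \<mu>) * u * (1 - u) * (7 + u)) * (M1 * M2 * G X) =
     M1 * (M2 * q ^ 3) * (2 * X * (1 - X) * G' - \<mu> * G X)"
    unfolding pe by algebra
  also have "M2 * q ^ 3 = q powr (3 * (\<nu> + 1 + \<mu>))"
  proof -
    have "3 * (\<nu> + 1 + \<mu>) = 3 * (\<nu> + \<mu>) + of_nat 3" by (simp add: algebra_simps)
    thus ?thesis using nz by (simp only: powr_add[of _ "3 * (\<nu> + \<mu>)"]) (simp add: M2_def q_def powr_nat')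
  qed
  finally show "oct_op \<nu> \<mu> y u = (1 - oct_x u) powr \<mu> * oct_q u powr (3 * (\<nu> + 1 + \<mu>)) *
       (2 * oct_x u * (1 - oct_x u) * G' - \<mu> * G (oct_x u))"
    by (simp add: M1_def X_def q_def)
qed

text \<open>The counterpart in the variable R. Its prefactor, a power of \<open>oct_pe\<close>, is
  the inverse of the one in the definition of \<open>oct_r\<close>.\<close>

lemma oct_op_R:
  fixes \<nu> \<mu> :: complex
  assumes pe: "oct_pe u \<notin> \<real>\<^sub>\<le>\<^sub>0"
    and G: "(G has_field_derivative G') (at (oct_R u))"
  defines "y \<equiv> (\<lambda>u. oct_pe u powr (\<nu> + \<mu>) * G (oct_R u))"
  shows "\<exists>y'. (y has_field_derivative y') (at u)"
    "oct_op \<nu> \<mu> y u = oct_pe u powr (\<nu> + 1 + \<mu>) *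
       (2 * oct_R u * (1 - oct_R u) * G' + ((\<nu> + \<mu>) * oct_R u - \<mu>) * G (oct_R u))"
proof -
  have nz: "oct_pe u \<noteq> 0" using pe by auto
  define e where "e = oct_pe u"
  define e' where "e' = - 33 - 66 * u + 3 * u ^ 2"
  define M where "M = oct_pe u powr (\<nu> + \<mu>)"
  define X where "X = oct_R u"
  define s where "s = 1 / e"
  have s: "s * e = 1" using nz by (simp add: s_def e_def)
  have pe': "(oct_pe has_field_derivative e') (at u)"
    using has_field_derivative_oct_pe[OF DERIV_ident] by (simp add: e'_def)
  have pv': "(oct_pv has_field_derivative (1 - u) ^ 3 * (1 - 5 * u)) (at u)"
    using has_field_derivative_oct_pv[OF DERIV_ident] by simp
  define x' where "x' = (- 108 * ((1 - u) ^ 3 * (1 - 5 * u)) * e ^ 2 - (- 108 * oct_pv u) * (of_nat 2 * (e' * e ^ (2 - Suc 0)))) / (e ^ 2 * e ^ 2)"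
  have x': "(oct_R has_field_derivative x') (at u)"
    unfolding oct_R_def[abs_def] x'_def e_def using nz
    by (intro DERIV_divide DERIV_power pe' DERIV_cmult pv') auto
  have X: "X = - 108 * oct_pv u * s ^ 2" by (simp add: X_def oct_R_def s_def e_def power_divide)
  define P where "P = 2 * u * (1 - u) * oct_pf u"
  have Px: "P * x' = 2 * X * (1 - X) * e"
  proof -
    have "x' = - 108 * ((1 - u) ^ 3 * (1 - 5 * u)) * s ^ 2 + 216 * oct_pv u * e' * s ^ 3"
      using nz unfolding x'_def s_def by (simp add: e_def[symmetric] field_simps power_numeral_reduce)
    hence "P * x' = - 108 * (2 * u * (1 - u) ^ 4 * (1 - 5 * u) * oct_pf u) * s ^ 2 + 216 * oct_pv u * (P * e') * s ^ 3"
      unfolding P_def by algebra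
    also have "2 * u * (1 - u) ^ 4 * (1 - 5 * u) * oct_pf u = 2 * oct_pv u * (e + 6 * u * (1 - u) * (7 + u))"
      unfolding oct_pf_eq[symmetric] e_def by (simp add: oct_pv_def)
    also have "P * e' = 6 * u * (1 - u) * (7 + u) * e - 108 * oct_pv u"
      unfolding P_def e'_def e_def oct_pe_def oct_pf_def oct_pv_def by algebra
    also have "- 108 * (2 * oct_pv u * (e + 6 * u * (1 - u) * (7 + u))) * s ^ 2 +
        216 * oct_pv u * (6 * u * (1 - u) * (7 + u) * e - 108 * oct_pv u) * s ^ 3 = 2 * X * (1 - X) * e"
      unfolding X using s by algebra
    finally show ?thesis .
  qed
  have D1: "((\<lambda>u. oct_pe u powr (\<nu> + \<mu>)) has_field_derivative M * ((\<nu> + \<mu>) * e' / oct_pe u)) (at u)"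
    unfolding M_def by (intro DERIV_powr_log pe' pe)
  have D2: "((\<lambda>u. G (oct_R u)) has_field_derivative G' * x') (at u)"
    by (rule DERIV_chain2[OF G x'])
  define y' where "y' = M * ((\<nu> + \<mu>) * e' * s * G X + G' * x')"
  have "(y has_field_derivative M * ((\<nu> + \<mu>) * e' / oct_pe u) * G (oct_R u) + G' * x' * oct_pe u powr (\<nu> + \<mu>)) (at u)"
    unfolding y_def by (intro DERIV_mult D1 D2)
  also have "M * ((\<nu> + \<mu>) * e' / oct_pe u) * G (oct_R u) + G' * x' * oct_pe u powr (\<nu> + \<mu>) = y'"
    by (simp add: y'_def M_def s_def e_def X_def divide_inverse algebra_simps)
  finally have y': "(y has_field_derivative y') (at u)" .
  thus "\<exists>y'. (y has_field_derivative y') (at u)" ..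
  have "oct_op \<nu> \<mu> y u = P * y' - (\<mu> * e + 6 * (\<nu> + \<mu>) * u * (1 - u) * (7 + u)) * (M * G X)"
    unfolding oct_op_eq[OF y'] by (simp add: P_def e_def y_def M_def X_def)
  also have "P * y' = M * ((\<nu> + \<mu>) * (P * e') * s * G X + G' * (P * x'))"
    unfolding y'_def by (simp add: algebra_simps)
  also have "P * e' = 6 * u * (1 - u) * (7 + u) * e - 108 * oct_pv u"
    unfolding P_def e'_def e_def oct_pe_def oct_pf_def oct_pv_def by algebra
  also have "(\<nu> + \<mu>) * (6 * u * (1 - u) * (7 + u) * e - 108 * oct_pv u) * s =
      (\<nu> + \<mu>) * (6 * u * (1 - u) * (7 + u) + X * e)"
    unfolding X using s by algebra
  also have "M * ((\<nu> + \<mu>) * (6 * u * (1 - u) * (7 + u) + X * e) * G X + G' * (P * x')) -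
      (\<mu> * e + 6 * (\<nu> + \<mu>) * u * (1 - u) * (7 + u)) * (M * G X) =
      (M * e) * (2 * X * (1 - X) * G' + ((\<nu> + \<mu>) * X - \<mu>) * G X)"
    unfolding Px by algebra
  also have "M * e = oct_pe u powr (\<nu> + 1 + \<mu>)"
  proof -
    have "\<nu> + 1 + \<mu> = (\<nu> + \<mu>) + 1" by simp
    thus ?thesis using nz by (simp only: powr_add[of _ "\<nu> + \<mu>" 1]) (simp add: M_def e_def)
  qed
  finally show "oct_op \<nu> \<mu> y u = oct_pe u powr (\<nu> + 1 + \<mu>) *
       (2 * oct_R u * (1 - oct_R u) * G' + ((\<nu> + \<mu>) * oct_R u - \<mu>) * G (oct_R u))"
    by (simp add: X_def)
qed

lemma isCont_eventually_in_open:
  assumes "isCont f a" "open T" "f a \<in> T"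
  shows "eventually (\<lambda>x. f x \<in> T) (nhds a)"
  using topological_tendstoD[OF assms(1)[unfolded isCont_def] assms(2,3)] assms(3)
  by (simp add: eventually_nhds_conv_at)

lemma isCont_oct_0: "isCont oct_pf 0" "isCont oct_pe 0" "isCont oct_x 0" "isCont oct_q 0" "isCont oct_R 0"
proof -
  have pf0: "oct_pf 0 \<notin> \<real>\<^sub>\<le>\<^sub>0" by (simp add: oct_pf_def)
  show "isCont oct_pf 0" "isCont oct_pe 0"
    using has_field_derivative_oct_pf[OF DERIV_ident] has_field_derivative_oct_pe[OF DERIV_ident]
    by (blast intro: DERIV_isCont)+
  show "isCont oct_x 0" "isCont oct_q 0"
    using oct_x_deriv[OF pf0] oct_q_deriv[OF pf0] by (blast intro: DERIV_isCont)+
  show "isCont oct_R 0"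
    unfolding oct_R_def oct_pv_def oct_pe_def by (intro continuous_intros) auto
qed

lemma one_minus_non_Nat_add:
  assumes "\<mu> \<notin> \<nat>"
  shows "1 - \<mu> + of_nat n \<noteq> (0 :: complex)"
proof
  assume "1 - \<mu> + of_nat n = 0"
  hence "\<mu> = of_nat (Suc n)" by (simp add: algebra_simps)
  thus False using assms by (metis of_nat_in_Nats)
qed

text \<open>By \<open>oct_ode_unique\<close> only the equation for the left side near 0 is needed.
  Applying \<open>oct_op_x\<close> twice reduces it to the hypergeometric equation.\<close>

lemma oct_sol_hypergeo_x:
  fixes \<nu> \<mu> :: complex
  assumes r: "oct_sol \<nu> \<mu> r" and \<mu>: "\<mu> \<notin> \<nat>"
  shows "eventually (\<lambda>u. (1 - oct_x u) powr \<mu> * oct_q u powr (3 * (\<nu> + \<mu>)) *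
     eval_fps (fps_hypergeo [- \<nu>, \<nu> + 1] [1 - \<mu>] 1) (oct_x u) = r u) (nhds 0)"
proof -
  define F where "F = eval_fps (fps_hypergeo [- \<nu>, \<nu> + 1] [1 - \<mu>] (1 :: complex))"
  note F = hypergeo_ode[of "1 - \<mu>" _ "- \<nu>" "\<nu> + 1", folded F_def, OF one_minus_non_Nat_add[OF \<mu>]]
  have "eventually (\<lambda>u. u \<in> oct_dom \<and> oct_pf u \<in> - \<real>\<^sub>\<le>\<^sub>0 \<and> oct_x u \<in> (\<lambda>x. 1 - x) -` (- \<real>\<^sub>\<le>\<^sub>0) \<and> oct_x u \<in> ball 0 1) (nhds 0)"
    by (intro eventually_conj eventually_nhds_in_open isCont_eventually_in_open isCont_oct_0
         open_oct_dom zero_in_oct_dom open_ball continuous_open_vimage continuous_intros)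
       (auto simp: oct_pf_def oct_x_0)
  then obtain A where A: "open A" "0 \<in> A"
    "\<And>u. u \<in> A \<Longrightarrow> u \<in> oct_dom" "\<And>u. u \<in> A \<Longrightarrow> oct_pf u \<notin> \<real>\<^sub>\<le>\<^sub>0"
    "\<And>u. u \<in> A \<Longrightarrow> 1 - oct_x u \<notin> \<real>\<^sub>\<le>\<^sub>0" "\<And>u. u \<in> A \<Longrightarrow> norm (oct_x u) < 1"
    unfolding eventually_nhds by auto
  define M where "M = (\<lambda>\<nu> G u. (1 - oct_x u) powr \<mu> * oct_q u powr (3 * (\<nu> + \<mu>)) * G (oct_x u))"
  define G where "G = (\<lambda>x. 2 * x * (1 - x) * deriv F x - \<mu> * F x)"
  define G' where "G' = (\<lambda>x. (2 - 4 * x) * deriv F x + 2 * x * (1 - x) * deriv (deriv F) x - \<mu> * deriv F x)"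
  have G': "(G has_field_derivative G' x) (at x)" if "norm x < 1" for x
    unfolding G_def G'_def using F(1,2)[OF that]
    by (auto intro!: derivative_eq_intros simp: algebra_simps)
  have op1: "oct_op \<nu> \<mu> (M \<nu> F) u = M (\<nu> + 1) G u" if "u \<in> A" for u
    unfolding M_def G_def by (subst oct_op_x(2)[OF A(4,5)[OF that] F(1)[OF A(6)[OF that]]]) simp
  have "oct_ode A \<nu> \<mu> (M \<nu> F)"
    unfolding oct_ode_def
  proof (intro conjI ballI)
    show "M \<nu> F holomorphic_on A"
      unfolding holomorphic_on_open[OF A(1)] M_def
      using oct_op_x(1)[OF A(4,5) F(1)[OF A(6)]] by blast
    fix u assume u: "u \<in> A"
    define X where "X = oct_x u"
    have "oct_op (\<nu> + 1) \<mu> (oct_op \<nu> \<mu> (M \<nu> F)) u = oct_op (\<nu> + 1) \<mu> (M (\<nu> + 1) G) u"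
      by (rule oct_op_cong[OF A(1) op1 u])
    \<comment> \<open>Two degree shifts raise the exponent 3 (\<nu> + \<mu>) by 6, and the sixth
      power of \<open>oct_q\<close> is the cube of \<open>oct_pf\<close>.\<close>
    also have "\<dots> = (1 - X) powr \<mu> * oct_q u powr (3 * (\<nu> + \<mu>) + of_nat 6) * (2 * X * (1 - X) * G' X - \<mu> * G X)"
      unfolding M_def X_def
      by (subst oct_op_x(2)[OF A(4,5)[OF u] G'[OF A(6)[OF u]]]) (simp add: algebra_simps)
    also have "oct_q u powr (3 * (\<nu> + \<mu>) + of_nat 6) = oct_q u powr (3 * (\<nu> + \<mu>)) * oct_pf u ^ 3"
      using oct_q_nz[OF A(4)[OF u]] unfolding powr_add[of _ "3 * (\<nu> + \<mu>)"] oct_q_square[symmetric]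
      by (subst powr_nat') (auto simp: power_mult[symmetric])
    also have "2 * X * (1 - X) * G' X - \<mu> * G X = (\<mu> ^ 2 - 4 * \<nu> * (\<nu> + 1) * (X * (1 - X))) * F X"
    proof -
      have "X * (1 - X) * deriv (deriv F) X + (1 - \<mu> - (- \<nu> + (\<nu> + 1) + 1) * X) * deriv F X = - \<nu> * (\<nu> + 1) * F X"
        using F(3)[OF A(6)[OF u]] by (simp add: X_def)
      thus ?thesis unfolding G_def G'_def by algebra
    qed
    also have "(1 - X) powr \<mu> * (oct_q u powr (3 * (\<nu> + \<mu>)) * oct_pf u ^ 3) *
        ((\<mu> ^ 2 - 4 * \<nu> * (\<nu> + 1) * (X * (1 - X))) * F X) =
        (\<mu> ^ 2 * oct_pf u ^ 3 - 4 * \<nu> * (\<nu> + 1) * (oct_pf u ^ 3 * (X * (1 - X)))) * M \<nu> F u"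
      by (simp add: M_def X_def algebra_simps)
    also have "oct_pf u ^ 3 * (X * (1 - X)) = 27 * oct_pv u"
    proof -
      have nz: "oct_q u \<noteq> 0" by (rule oct_q_nz[OF A(4)[OF u]])
      define z where "z = oct_pe u / oct_q u ^ 3"
      have z: "z * oct_q u ^ 3 = oct_pe u" using nz by (simp add: z_def)
      have "4 * (X * (1 - X)) = 1 - z ^ 2"
        unfolding X_def oct_x_def z_def[symmetric] by (simp add: field_simps power2_eq_square)
      moreover have "oct_pf u ^ 3 = (oct_q u ^ 3) ^ 2"
        unfolding oct_q_square[symmetric] by (simp add: power_mult[symmetric])
      ultimately show ?thesis using z oct_pf_cube[of u] by algebra
    qed
    finally show "oct_op (\<nu> + 1) \<mu> (oct_op \<nu> \<mu> (M \<nu> F)) u =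
       (\<mu>\<^sup>2 * oct_pf u ^ 3 - 108 * \<nu> * (\<nu> + 1) * oct_pv u) * M \<nu> F u"
      by (simp add: algebra_simps)
  qed
  moreover have "oct_ode A \<nu> \<mu> r"
    using r A(3) unfolding oct_sol_def oct_ode_def by (auto intro: holomorphic_on_subset)
  moreover have "F 0 = 1" by (simp add: F_def eval_fps_at_0)
  hence "M \<nu> F 0 = 1" by (simp add: M_def oct_x_0 oct_q_0)
  ultimately have "eventually (\<lambda>u. M \<nu> F u = r u) (nhds 0)"
    using oct_ode_unique[OF A(1,2) _ _ _ _ \<mu>] r unfolding oct_sol_def by blast
  thus ?thesis unfolding M_def F_def .
qed

text \<open>R = 1 - 1/(1 - 2 x)^2, so this and \<open>oct_sol_hypergeo_x\<close> amount to a
  quadratic transformation, here a consequence of uniqueness.\<close>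

lemma oct_sol_hypergeo_R:
  fixes \<nu> \<mu> :: complex
  assumes r: "oct_sol \<nu> \<mu> r" and \<mu>: "\<mu> \<notin> \<nat>"
  shows "eventually (\<lambda>u. oct_pe u powr (\<nu> + \<mu>) *
     eval_fps (fps_hypergeo [- (\<nu> + \<mu>) / 2, (1 - \<nu> - \<mu>) / 2] [1 - \<mu>] 1) (oct_R u) = r u) (nhds 0)"
proof -
  define F where "F = eval_fps (fps_hypergeo [- (\<nu> + \<mu>) / 2, (1 - \<nu> - \<mu>) / 2] [1 - \<mu>] (1 :: complex))"
  note F = hypergeo_ode[of "1 - \<mu>" _ "- (\<nu> + \<mu>) / 2" "(1 - \<nu> - \<mu>) / 2", folded F_def, OF one_minus_non_Nat_add[OF \<mu>]]
  have R0: "oct_R 0 = 0" by (simp add: oct_R_def oct_pv_def)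
  have "eventually (\<lambda>u. u \<in> oct_dom \<and> oct_pe u \<in> - \<real>\<^sub>\<le>\<^sub>0 \<and> oct_R u \<in> ball 0 1) (nhds 0)"
    by (intro eventually_conj eventually_nhds_in_open isCont_eventually_in_open isCont_oct_0
         open_oct_dom zero_in_oct_dom open_ball) (auto simp: oct_pe_def R0)
  then obtain A where A: "open A" "0 \<in> A"
    "\<And>u. u \<in> A \<Longrightarrow> u \<in> oct_dom" "\<And>u. u \<in> A \<Longrightarrow> oct_pe u \<notin> \<real>\<^sub>\<le>\<^sub>0"
    "\<And>u. u \<in> A \<Longrightarrow> norm (oct_R u) < 1"
    unfolding eventually_nhds by auto
  define M where "M = (\<lambda>\<nu> G u. oct_pe u powr (\<nu> + \<mu>) * G (oct_R u))"
  define G where "G = (\<lambda>x. 2 * x * (1 - x) * deriv F x + ((\<nu> + \<mu>) * x - \<mu>) * F x)"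
  define G' where "G' = (\<lambda>x. (2 - 4 * x) * deriv F x + 2 * x * (1 - x) * deriv (deriv F) x +
     (\<nu> + \<mu>) * F x + ((\<nu> + \<mu>) * x - \<mu>) * deriv F x)"
  have G': "(G has_field_derivative G' x) (at x)" if "norm x < 1" for x
    unfolding G_def G'_def using F(1,2)[OF that]
    by (auto intro!: derivative_eq_intros simp: algebra_simps)
  have op1: "oct_op \<nu> \<mu> (M \<nu> F) u = M (\<nu> + 1) G u" if "u \<in> A" for u
    unfolding M_def G_def by (subst oct_op_R(2)[OF A(4)[OF that] F(1)[OF A(5)[OF that]]]) simp
  have "oct_ode A \<nu> \<mu> (M \<nu> F)"
    unfolding oct_ode_def
  proof (intro conjI ballI)
    show "M \<nu> F holomorphic_on A"
      unfolding holomorphic_on_open[OF A(1)] M_def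
      using oct_op_R(1)[OF A(4) F(1)[OF A(5)]] by blast
    fix u assume u: "u \<in> A"
    have nz: "oct_pe u \<noteq> 0" using A(4)[OF u] by auto
    define X where "X = oct_R u"
    have "oct_op (\<nu> + 1) \<mu> (oct_op \<nu> \<mu> (M \<nu> F)) u = oct_op (\<nu> + 1) \<mu> (M (\<nu> + 1) G) u"
      by (rule oct_op_cong[OF A(1) op1 u])
    also have "\<dots> = oct_pe u powr (\<nu> + \<mu> + of_nat 2) * (2 * X * (1 - X) * G' X + ((\<nu> + 1 + \<mu>) * X - \<mu>) * G X)"
      unfolding M_def X_def
      by (subst oct_op_R(2)[OF A(4)[OF u] G'[OF A(5)[OF u]]]) (simp add: algebra_simps)
    also have "oct_pe u powr (\<nu> + \<mu> + of_nat 2) = oct_pe u powr (\<nu> + \<mu>) * oct_pe u ^ 2"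
      using nz unfolding powr_add[of _ "\<nu> + \<mu>" "of_nat 2"] by (subst powr_nat') auto
    also have "2 * X * (1 - X) * G' X + ((\<nu> + 1 + \<mu>) * X - \<mu>) * G X =
       (\<nu> * (\<nu> + 1) * X + \<mu> ^ 2 * (1 - X)) * F X"
    proof -
      define a b where "a = - (\<nu> + \<mu>) / 2" and "b = (1 - \<nu> - \<mu>) / 2"
      have ab: "2 * a = - (\<nu> + \<mu>)" "2 * b = 1 - \<nu> - \<mu>"
        unfolding a_def b_def by (simp_all only: times_divide_eq_right nonzero_mult_div_cancel_left zero_neq_numeral[symmetric] not_False_eq_True)
      have "X * (1 - X) * deriv (deriv F) X + (1 - \<mu> - (a + b + 1) * X) * deriv F X = a * b * F X"
        using F(3)[OF A(5)[OF u]] unfolding X_def a_def b_def .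
      thus ?thesis unfolding G_def G'_def using ab by algebra
    qed
    also have "oct_pe u powr (\<nu> + \<mu>) * oct_pe u ^ 2 * ((\<nu> * (\<nu> + 1) * X + \<mu> ^ 2 * (1 - X)) * F X) =
        (\<nu> * (\<nu> + 1) * (oct_pe u ^ 2 * X) + \<mu> ^ 2 * (oct_pe u ^ 2 - oct_pe u ^ 2 * X)) * M \<nu> F u"
      by (simp add: M_def X_def algebra_simps)
    also have "oct_pe u ^ 2 * X = - 108 * oct_pv u" using nz by (simp add: X_def oct_R_def)
    finally show "oct_op (\<nu> + 1) \<mu> (oct_op \<nu> \<mu> (M \<nu> F)) u =
       (\<mu>\<^sup>2 * oct_pf u ^ 3 - 108 * \<nu> * (\<nu> + 1) * oct_pv u) * M \<nu> F u"
      unfolding oct_pf_cube by (simp add: algebra_simps)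
  qed
  moreover have "oct_ode A \<nu> \<mu> r"
    using r A(3) unfolding oct_sol_def oct_ode_def by (auto intro: holomorphic_on_subset)
  moreover have "F 0 = 1" by (simp add: F_def eval_fps_at_0)
  hence "M \<nu> F 0 = 1" by (simp add: M_def R0 oct_pe_def)
  ultimately have "eventually (\<lambda>u. M \<nu> F u = r u) (nhds 0)"
    using oct_ode_unique[OF A(1,2) _ _ _ _ \<mu>] r unfolding oct_sol_def by blast
  thus ?thesis unfolding M_def F_def .
qed

section \<open>Analytic continuation and reduced fractions\<close>

text \<open>Any open set around the segment suffices: it contains a convex neighbourhood of the
  segment, which is star-shaped about 0 as the definition demands.\<close>

lemma gauss_hypgeo_eqI:
  assumes U: "open U" "closed_segment 0 z \<subseteq> U" and g: "g holomorphic_on U"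
    and germ: "eventually (\<lambda>x. g x = eval_fps (fps_hypergeo [a, b] [c] 1) x) (nhds 0)"
  shows "gauss_hypgeo a b c z = g z"
proof -
  obtain e where e: "e > 0" "(\<Union>x\<in>closed_segment 0 z. ball x e) \<subseteq> U"
    by (rule compact_subset_open_imp_ball_epsilon_subset[OF compact_segment U])
  define S where "S = (\<Union>x\<in>closed_segment 0 z. ball x e)"
  have "x \<in> S" if "x \<in> closed_segment 0 z" for x
    unfolding S_def using that e(1) by (intro UN_I[of x]) auto
  moreover have "open S" "S \<subseteq> U" using e by (auto simp: S_def)
  ultimately have S: "open S" "0 \<in> S" "z \<in> S" "S \<subseteq> U" by auto
  \<comment> \<open>Written as a Minkowski sum of a segment and a ball, S is convex.\<close>
  have "S = (\<Union>x\<in>closed_segment 0 z. \<Union>y\<in>ball 0 e. {x + y})"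
  proof -
    have eq: "ball x e = (\<Union>y\<in>ball 0 e. {x + y})" for x :: complex
    proof safe
      fix w assume "w \<in> ball x e"
      hence "w - x \<in> ball 0 e" by (simp add: dist_norm norm_minus_commute)
      thus "w \<in> (\<Union>y\<in>ball 0 e. {x + y})" by (intro UN_I[of "w - x"]) simp_all
    qed (simp add: dist_norm)
    show ?thesis unfolding S_def by (intro SUP_cong refl eq)
  qed
  moreover have "convex (\<Union>x\<in>closed_segment 0 z. \<Union>y\<in>ball 0 e. {x + y})"
    by (rule convex_sums) auto
  ultimately have "convex S" by (simp only:)
  hence star: "\<forall>x\<in>S. closed_segment 0 x \<subseteq> S"
    using S(2) closed_segment_subset by blast
  show ?thesis
    unfolding gauss_hypgeo_def
  proof (rule the_equality)
    show "\<exists>S f. open S \<and> 0 \<in> S \<and> z \<in> S \<and> (\<forall>x\<in>S. closed_segment 0 x \<subseteq> S) \<and> f holomorphic_on S \<and>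
        (\<forall>\<^sub>F x in nhds 0. f x = eval_fps (fps_hypergeo [a, b] [c] 1) x) \<and> g z = f z"
      by (rule exI[of _ S], rule exI[of _ g])
         (intro conjI S(1-3) star germ holomorphic_on_subset[OF g S(4)] refl)
    fix w assume "\<exists>S f. open S \<and> 0 \<in> S \<and> z \<in> S \<and> (\<forall>x\<in>S. closed_segment 0 x \<subseteq> S) \<and> f holomorphic_on S \<and>
        (\<forall>\<^sub>F x in nhds 0. f x = eval_fps (fps_hypergeo [a, b] [c] 1) x) \<and> w = f z"
    then obtain S' f where S': "open S'" "0 \<in> S'" "z \<in> S'" "\<forall>x\<in>S'. closed_segment 0 x \<subseteq> S'"
      and f: "f holomorphic_on S'" "\<forall>\<^sub>F x in nhds 0. f x = eval_fps (fps_hypergeo [a, b] [c] 1) x" "w = f z"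
      by (elim exE conjE) (rule that)
    have "\<forall>\<^sub>F x in nhds 0. f x = g x" using f(2) germ by eventually_elim simp
    then obtain V where V: "open V" "0 \<in> V" "\<And>x. x \<in> V \<Longrightarrow> f x = g x"
      unfolding eventually_nhds by auto
    \<comment> \<open>Star-shapedness about the common centre 0 passes to the intersection, which is
      therefore connected; the identity theorem applies there.\<close>
    have "\<forall>x\<in>S \<inter> S'. closed_segment 0 x \<subseteq> S \<inter> S'" using S'(4) star by simp
    hence "starlike (S \<inter> S')" unfolding starlike_def using S(2) S'(2) by (intro bexI[of _ 0]) simp_all
    hence conn: "connected (S \<inter> S')" by (rule starlike_imp_connected)
    have ne: "V \<inter> (S \<inter> S') \<noteq> {}" using V(2) S(2) S'(2) by blast
    have opn: "open (V \<inter> (S \<inter> S'))" "open (S \<inter> S')" by (intro open_Int V(1) S(1) S'(1))+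
    have fg: "f holomorphic_on S \<inter> S'" "g holomorphic_on S \<inter> S'"
      by (rule holomorphic_on_subset[OF f(1)], blast) (rule holomorphic_on_subset[OF g], use S(4) in blast)
    have "f z = g z"
      by (rule analytic_continuation_open[OF opn ne conn Int_lower2 fg]) (use V(3) S(3) S'(3) in simp_all)
    thus "w = g z" using f(3) by simp
  qed
qed

lemma gauss_hypgeo_series:
  assumes "\<And>n :: nat. c + of_nat n \<noteq> 0" "norm z < 1"
  shows "gauss_hypgeo a b c z = eval_fps (fps_hypergeo [a, b] [c] 1) z"
proof (rule gauss_hypgeo_eqI[of "ball 0 1"])
  show "closed_segment 0 z \<subseteq> ball 0 1"
    using assms(2) by (intro closed_segment_subset) auto
  have "ereal (norm x) < fps_conv_radius (fps_hypergeo [a, b] [c] 1)" if "norm x < 1" for x :: complex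
  proof -
    have "ereal (norm x) < 1" using that by simp
    thus ?thesis using fps_conv_radius_hypergeo[OF assms(1)] by (rule less_le_trans)
  qed
  thus "eval_fps (fps_hypergeo [a, b] [c] 1) holomorphic_on ball 0 1"
    by (intro holomorphic_on_eval_fps) (auto simp: in_eball_iff)
qed auto

section \<open>Reduced fractions\<close>

lemma coprime_poly_root:
  fixes p q :: "complex poly"
  assumes "coprime p q" "poly q u = 0"
  shows "poly p u \<noteq> 0"
proof
  assume "poly p u = 0"
  hence "[:- u, 1:] dvd 1"
    using assms by (intro coprime_common_divisor[OF assms(1)]) (simp_all add: poly_eq_0_iff_dvd)
  then obtain k where "1 = [:- u, 1:] * k" by (elim dvdE)
  from arg_cong[OF this, of "\<lambda>p. poly p u"] show False by simp
qed

text \<open>Equality extends to every point, poles included: coprime representations of one rational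
  function have the same poles, where both quotients are 0 by convention.\<close>

lemma reduced_fraction_unique:
  fixes p q p' q' :: "complex poly"
  assumes q: "q \<noteq> 0" "q' \<noteq> 0" and coprime: "coprime p q" "coprime p' q'"
    and eq: "eventually (\<lambda>u. poly p u / poly q u = poly p' u / poly q' u) (at a)"
  shows "poly p u / poly q u = poly p' u / poly q' u"
proof -
  have nz: "eventually (\<lambda>u. poly Q u \<noteq> 0) (at a)" if "Q \<noteq> 0" for Q :: "complex poly"
  proof -
    have "open (- ({u. poly Q u = 0} - {a}))"
      using poly_roots_finite[OF that] by (intro open_Compl finite_imp_closed) simp
    hence "eventually (\<lambda>u. u \<in> - ({u. poly Q u = 0} - {a}) - {a}) (at a)"
      by (rule eventually_at_in_open) simp
    thus ?thesis by (rule eventually_mono) auto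
  qed
  have ev: "eventually (\<lambda>u. poly (p * q' - p' * q) u = 0) (at a)"
    using eq nz[OF q(1)] nz[OF q(2)] by eventually_elim (simp add: field_simps)
  have "p * q' - p' * q = 0"
  proof (rule ccontr)
    assume "p * q' - p' * q \<noteq> 0"
    from nz[OF this] ev have "eventually (\<lambda>u. False) (at a)" by eventually_elim simp
    thus False by simp
  qed
  hence "poly (p * q') u = poly (p' * q) u" by simp
  hence pq: "poly p u * poly q' u = poly p' u * poly q u" by simp
  show ?thesis
  proof (cases "poly q u = 0 \<or> poly q' u = 0")
    case True
    hence "poly q u = 0 \<and> poly q' u = 0"
      using pq coprime_poly_root[OF coprime(1)] coprime_poly_root[OF coprime(2)] by auto
    thus ?thesis by simp
  qed (use pq in \<open>simp add: field_simps\<close>)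
qed

lemma oct_rational_reduced:
  assumes "oct_rational r"
  obtains p q :: "complex poly" where "q \<noteq> 0" "coprime p q"
    "\<And>u. u \<in> oct_dom \<Longrightarrow> r u = poly p u / poly q u"
proof -
  obtain P i j where P: "\<And>u. u \<in> oct_dom \<Longrightarrow> r u = poly P u / ((1 - u) ^ i * oct_pf u ^ j)"
    using assms unfolding oct_rational_def by blast
  define Q :: "complex poly" where "Q = [:1, -1:] ^ i * [:1, 14, 1:] ^ j"
  have Q: "poly Q u = (1 - u) ^ i * oct_pf u ^ j" for u
    by (simp add: Q_def oct_pf_def algebra_simps power2_eq_square)
  have "Q \<noteq> 0" by (simp add: Q_def)
  \<comment> \<open>Among all representations of the function, one of least denominator degree is
    coprime.\<close>
  define repr where "repr = (\<lambda>(p, q). q \<noteq> 0 \<and> p * Q = P * q)"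
  have "repr (P, Q)" using \<open>Q \<noteq> 0\<close> by (simp add: repr_def)
  then obtain pq where pq: "repr pq" "\<And>pq'. repr pq' \<Longrightarrow> degree (snd pq) \<le> degree (snd pq')"
    using ex_has_least_nat[of repr _ "\<lambda>pq. degree (snd pq)"] by blast
  obtain p q where [simp]: "pq = (p, q)" by (cases pq)
  have q: "q \<noteq> 0" "p * Q = P * q" using pq(1) by (simp_all add: repr_def)
  have coprime: "coprime p q"
  proof (rule coprimeI)
    fix d assume "d dvd p" "d dvd q"
    then obtain p1 q1 where d: "p = d * p1" "q = d * q1" by (elim dvdE)
    have "d \<noteq> 0" "q1 \<noteq> 0" using q(1) d by auto
    moreover have "d * (p1 * Q) = d * (P * q1)" using q(2) d by (simp add: mult_ac)
    ultimately have "repr (p1, q1)" by (simp add: repr_def)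
    from pq(2)[OF this] have "degree q \<le> degree q1" by simp
    moreover have "degree q = degree d + degree q1"
      using d(2) \<open>d \<noteq> 0\<close> \<open>q1 \<noteq> 0\<close> by (simp add: degree_mult_eq)
    ultimately show "is_unit d" using \<open>d \<noteq> 0\<close> by (simp add: is_unit_iff_degree)
  qed
  show ?thesis
  proof (rule that[OF q(1) coprime])
    fix u assume u: "u \<in> oct_dom"
    hence Qu: "poly Q u \<noteq> 0" unfolding Q by (simp add: oct_dom_def)
    have eq: "poly p u * poly Q u = poly P u * poly q u"
      using arg_cong[OF q(2), of "\<lambda>p. poly p u"] by simp
    \<comment> \<open>A zero of q would force a zero of p, as Q does not vanish on
      \<open>oct_dom\<close>. Hence no value of r there is affected by the convention at
      poles.\<close>
    have "poly q u \<noteq> 0" using eq Qu coprime_poly_root[OF coprime] by auto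
    hence "poly p u / poly q u = poly P u / poly Q u" using eq Qu by (simp add: frac_eq_eq)
    thus "r u = poly p u / poly q u" using P[OF u] by (simp add: Q)
  qed
qed

section \<open>The cubic relating cosh \<xi> and cosh (\<xi>/3)\<close>

lemma cosh_triple: "cosh (3 * y) = 4 * cosh y ^ 3 - 3 * cosh (y :: real)"
proof -
  have "cosh (3 * y) = cosh (y + (y + y))" by simp
  also have "\<dots> = cosh y * (cosh y ^ 2 + sinh y ^ 2) + sinh y * (2 * sinh y * cosh y)"
    by (simp only: cosh_add sinh_add) (simp add: algebra_simps power2_eq_square)
  also have "\<dots> = 4 * cosh y ^ 3 - 3 * cosh y"
    using cosh_square_eq[of y] by algebra
  finally show ?thesis .
qed

text \<open>Continuation along the ray needs cosh (\<xi>/3) as a holomorphic function of z on an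
  open set around z >= 1, including z = 1. The cubic 4 s^3 - 3 s has derivative 9 at s = 1, so its
  inverse, unlike arcosh, is regular there.\<close>

lemma cubic_inverse:
  obtains \<sigma> :: "complex \<Rightarrow> complex" and V where
    "open V" "\<sigma> holomorphic_on V" "\<And>t. t \<ge> 1 \<Longrightarrow> of_real t \<in> V"
    "\<And>z. z \<in> V \<Longrightarrow> 4 * \<sigma> z ^ 3 - 3 * \<sigma> z = z \<and> Re (\<sigma> z) > 0 \<and> Re (4 * \<sigma> z ^ 2 - 1) > 0"
    "\<And>y. \<sigma> (of_real (cosh y)) = of_real (cosh (y / 3))"
proof -
  \<comment> \<open>In this truncated cone a product of two elements has real part above (81/100)
    (15/16) > 3/4. Then 4 (s^2 + s t + t^2) - 3 has real part above 6, which gives injectivity, and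
    4 s^2 - 1 has real part above 2, which makes its square root holomorphic.\<close>
  define S where "S = {s :: complex. 9 / 10 < Re s \<and> \<bar>Im s\<bar> < Re s / 4}"
  define T where "T = (\<lambda>s :: complex. 4 * s ^ 3 - 3 * s)"
  have S: "open S"
  proof -
    have "S = {s. 9 / 10 < Re s} \<inter> {s. \<bar>Im s\<bar> < Re s / 4}" by (auto simp: S_def)
    thus ?thesis by (auto intro!: open_Int open_Collect_less continuous_intros)
  qed
  have Re_mult: "Re (s * t) > 3 / 4" if "s \<in> S" "t \<in> S" for s t
  proof -
    have st: "9 / 10 < Re s" "9 / 10 < Re t" "\<bar>Im s\<bar> < Re s / 4" "\<bar>Im t\<bar> < Re t / 4"
      using that by (auto simp: S_def)
    have "\<bar>Im s\<bar> * \<bar>Im t\<bar> \<le> (Re s / 4) * (Re t / 4)" using st by (intro mult_mono) auto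
    hence "Im s * Im t \<le> Re s * Re t / 16" by (simp add: abs_mult[symmetric])
    moreover have "9 / 10 * (9 / 10) \<le> Re s * Re t" using st by (intro mult_mono) auto
    ultimately show ?thesis by simp
  qed
  have inj: "inj_on T S"
  proof (rule inj_onI)
    fix s t assume st: "s \<in> S" "t \<in> S" "T s = T t"
    have "(s - t) * (4 * (s * s + s * t + t * t) - 3) = 0"
      using st(3) unfolding T_def by algebra
    moreover have pos: "Re (4 * (s * s + s * t + t * t) - 3) > 0"
      using Re_mult[OF st(1,1)] Re_mult[OF st(1,2)] Re_mult[OF st(2,2)] by simp
    have "4 * (s * s + s * t + t * t) - 3 \<noteq> 0"
    proof
      assume "4 * (s * s + s * t + t * t) - 3 = 0"
      with pos show False by (simp only: zero_complex.simps)
    qed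
    ultimately show "s = t" by simp
  qed
  have hol: "T holomorphic_on S" unfolding T_def by (intro holomorphic_intros)
  obtain \<sigma> where \<sigma>: "\<sigma> holomorphic_on (T ` S)" "\<And>s. s \<in> S \<Longrightarrow> \<sigma> (T s) = s"
    using holomorphic_has_inverse[OF hol S inj] by metis
  have T_cosh: "T (of_real (cosh (y / 3))) = of_real (cosh y)" for y
    using cosh_triple[of "y / 3"] by (simp add: T_def)
  have in_S: "complex_of_real (cosh y) \<in> S" for y
    using cosh_real_ge_1[of y] by (simp add: S_def)
  show ?thesis
  proof (rule that[of "T ` S" \<sigma>])
    show "open (T ` S)" by (rule open_mapping_thm3[OF hol S inj])
    show "\<sigma> (of_real (cosh y)) = of_real (cosh (y / 3))" for y
      using \<sigma>(2)[OF in_S, of "y / 3"] by (simp add: T_cosh)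
    fix t :: real assume "t \<ge> 1"
    hence "complex_of_real t = T (of_real (cosh (arcosh t / 3)))" by (simp add: T_cosh)
    thus "of_real t \<in> T ` S" using in_S by blast
  next
    fix z assume "z \<in> T ` S"
    then obtain s where s: "s \<in> S" "z = T s" "\<sigma> z = s" using \<sigma>(2) by auto
    have "Re s > 0" using s(1) by (simp add: S_def)
    moreover have "Re (4 * s ^ 2 - 1) > 0"
      using Re_mult[OF s(1,1)] by (simp add: power2_eq_square)
    ultimately show "4 * \<sigma> z ^ 3 - 3 * \<sigma> z = z \<and> Re (\<sigma> z) > 0 \<and> Re (4 * \<sigma> z ^ 2 - 1) > 0"
      using s by (simp add: T_def)
  qed (rule \<sigma>(1))
qed

section \<open>Identifying the rational solution with \<open>oct_r\<close> and with the Gauss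
  function\<close>

lemma oct_order_not_Nats:
  fixes m :: int
  shows "1 / 4 + of_int m \<notin> (\<nat> :: complex set)" "- (1 / 4 + of_int m) \<notin> (\<nat> :: complex set)"
proof -
  show "1 / 4 + of_int m \<notin> (\<nat> :: complex set)"
  proof
    assume "1 / 4 + of_int m \<in> (\<nat> :: complex set)"
    then obtain k where "1 / 4 + of_int m = (of_nat k :: complex)" by (elim Nats_cases)
    hence "1 / 4 + of_int (m - int k) = (0 :: complex)" by (simp add: add_diff_eq)
    thus False using oct_param_nonzero(1) by blast
  qed
  show "- (1 / 4 + of_int m) \<notin> (\<nat> :: complex set)"
  proof
    assume "- (1 / 4 + of_int m) \<in> (\<nat> :: complex set)"
    then obtain k where k: "- (1 / 4 + of_int m) = (of_nat k :: complex)" by (elim Nats_cases)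
    have "1 / 4 + of_int (m + int k) = (1 / 4 + of_int m) + (of_nat k :: complex)" by simp
    also have "\<dots> = 0" unfolding k[symmetric] by simp
    finally have "1 / 4 + of_int (m + int k) = (0 :: complex)" .
    thus False using oct_param_nonzero(1) by blast
  qed
qed

text \<open>The power of \<open>oct_pe\<close> moves to the other side of
  \<open>oct_sol_hypergeo_R\<close>, and the reduced fraction of r is the only one with that germ at
  0.\<close>

lemma oct_r_eq:
  assumes sol: "oct_sol (- 1 / 6 + of_int n) (1 / 4 + of_int m) r" and u: "u \<in> oct_dom"
  shows "oct_r n m u = r u"
proof -
  define e :: complex where "e = - 1 / 12 - of_int m - of_int n"
  define a b c :: complex where "a = - 1 / 24 - of_int m / 2 - of_int n / 2"
    and "b = 11 / 24 - of_int m / 2 - of_int n / 2" and "c = 3 / 4 - of_int m"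
  define \<nu> \<mu> :: complex where "\<nu> = - 1 / 6 + of_int n" and "\<mu> = 1 / 4 + of_int m"
  have \<mu>: "\<mu> \<notin> \<nat>" unfolding \<mu>_def by (rule oct_order_not_Nats)
  have pars: "- (\<nu> + \<mu>) / 2 = a" "(1 - \<nu> - \<mu>) / 2 = b" "1 - \<mu> = c" "\<nu> + \<mu> = - e"
    by (simp_all add: \<nu>_def \<mu>_def a_def b_def c_def e_def field_simps)
  have ev: "eventually (\<lambda>u. gauss_hypgeo a b c (oct_R u) = oct_pe u powr e * r u \<and> oct_pe u \<noteq> 0 \<and> u \<in> oct_dom) (nhds 0)"
  proof -
    have R0: "oct_R 0 = 0" by (simp add: oct_R_def oct_pv_def)
    have "eventually (\<lambda>u. oct_pe u powr (\<nu> + \<mu>) * eval_fps (fps_hypergeo [a, b] [c] 1) (oct_R u) = r u) (nhds 0)"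
      using oct_sol_hypergeo_R[OF sol[folded \<nu>_def \<mu>_def] \<mu>] unfolding pars(1-3) .
    moreover have "eventually (\<lambda>u. oct_R u \<in> ball 0 1) (nhds 0)"
      "eventually (\<lambda>u. oct_pe u \<in> - {0}) (nhds 0)" "eventually (\<lambda>u. u \<in> oct_dom) (nhds 0)"
      by (intro isCont_eventually_in_open isCont_oct_0 eventually_nhds_in_open;
          simp add: R0 oct_pe_def open_Compl)+
    ultimately show ?thesis
    proof eventually_elim
      case (elim u)
      have "gauss_hypgeo a b c (oct_R u) = eval_fps (fps_hypergeo [a, b] [c] 1) (oct_R u)"
        using elim by (intro gauss_hypgeo_series) (auto simp: pars(3)[symmetric] one_minus_non_Nat_add[OF \<mu>])
      moreover have "oct_pe u powr e * oct_pe u powr (\<nu> + \<mu>) = 1"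
        using elim by (simp add: powr_add[symmetric] pars)
      moreover have "oct_pe u powr e * r u =
          (oct_pe u powr e * oct_pe u powr (\<nu> + \<mu>)) * eval_fps (fps_hypergeo [a, b] [c] 1) (oct_R u)"
        unfolding elim(1)[symmetric] by (simp only: mult.assoc)
      ultimately show ?case using elim by simp
    qed
  qed
  obtain p q where pq: "q \<noteq> 0" "coprime p q" "\<And>u. u \<in> oct_dom \<Longrightarrow> r u = poly p u / poly q u"
    using sol unfolding oct_sol_def by (auto elim: oct_rational_reduced)
  have "oct_r n m = (\<lambda>u. poly p u / poly q u)"
    unfolding oct_r_def a_def[symmetric] b_def[symmetric] c_def[symmetric] e_def[symmetric]
  proof (rule the_equality, intro conjI)
    show "\<exists>p' q'. q' \<noteq> 0 \<and> coprime p' q' \<and> (\<lambda>u. poly p u / poly q u) = (\<lambda>u. poly p' u / poly q' u)"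
      using pq by blast
    show "\<forall>\<^sub>F u in nhds 0. gauss_hypgeo a b c (oct_R u) = oct_pe u powr e * (poly p u / poly q u)"
      using ev by eventually_elim (simp add: pq(3))
    fix s assume s: "(\<exists>p' q'. q' \<noteq> 0 \<and> coprime p' q' \<and> s = (\<lambda>u. poly p' u / poly q' u)) \<and>
       (\<forall>\<^sub>F u in nhds 0. gauss_hypgeo a b c (oct_R u) = oct_pe u powr e * s u)"
    then obtain p' q' where pq': "q' \<noteq> 0" "coprime p' q'" "s = (\<lambda>u. poly p' u / poly q' u)" by blast
    have "eventually (\<lambda>u. s u = poly p u / poly q u) (nhds 0)"
      using ev conjunct2[OF s] by eventually_elim (auto simp: pq(3))
    hence "eventually (\<lambda>u. poly p' u / poly q' u = poly p u / poly q u) (at 0)"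
      unfolding pq'(3) eventually_nhds_conv_at by simp
    from reduced_fraction_unique[OF pq'(1) pq(1) pq'(2) pq(2) this]
    show "s = (\<lambda>u. poly p u / poly q u)" unfolding pq'(3) by blast
  qed
  thus ?thesis using pq(3)[OF u] by simp
qed

text \<open>\<open>oct_sol_hypergeo_x\<close> holds near u = 0 only. Pulled back along a holomorphic
  right inverse \<open>v\<close> of \<open>oct_x\<close>, its right-hand side becomes a function of
  x on a neighbourhood of the whole ray.\<close>

lemma gauss_hypgeo_oct_sol:
  fixes \<nu> \<mu> :: complex and \<xi> :: real
  assumes sol: "oct_sol \<nu> \<mu> r" and \<mu>: "\<mu> \<notin> \<nat>"
  defines "w \<equiv> of_real (- A_minus \<xi> / A_plus \<xi>)"
  shows "w \<in> oct_dom"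
    "gauss_hypgeo (- \<nu>) (\<nu> + 1) (1 - \<mu>) (of_real ((1 - cosh \<xi>) / 2)) =
       of_real ((1 + cosh \<xi>) / 2) powr (- \<mu>) * of_real (2 / A_plus \<xi>) powr (- (3 * (\<nu> + \<mu>))) * r w"
proof -
  obtain \<sigma> V where V: "open V" and \<sigma>: "\<sigma> holomorphic_on V" and V1: "\<And>t. t \<ge> 1 \<Longrightarrow> of_real t \<in> V"
    and \<sigma>V: "\<And>z. z \<in> V \<Longrightarrow> 4 * \<sigma> z ^ 3 - 3 * \<sigma> z = z \<and> Re (\<sigma> z) > 0 \<and> Re (4 * \<sigma> z ^ 2 - 1) > 0"
    and \<sigma>_cosh: "\<And>y. \<sigma> (of_real (cosh y)) = of_real (cosh (y / 3))"
    by (rule cubic_inverse) (rule that)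
  \<comment> \<open>The second condition gives Re (1 - x) > 1/2, keeping the base of the power off
    the cut.\<close>
  define U where "U = (\<lambda>x. 1 - 2 * x) -` V \<inter> {x. Re (1 - 2 * x) > 0}"
  define s where "s = (\<lambda>x. \<sigma> (1 - 2 * x))"
  define h where "h = (\<lambda>x. csqrt ((4 * s x ^ 2 - 1) / 3))"
  \<comment> \<open>On the ray, s + h and h - s are \<open>A_plus\<close> and
    \<open>A_minus\<close>; \<open>q\<close> continues 2/A_plus and \<open>v\<close> continues the
    octahedral parameter.\<close>
  define q where "q = (\<lambda>x. 2 / (s x + h x))"
  define v where "v = (\<lambda>x. (s x - h x) / (s x + h x))"
  define g where "g = (\<lambda>x. (1 - x) powr (- \<mu>) * q x powr (- (3 * (\<nu> + \<mu>))) * r (v x))"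
  have U: "open U" unfolding U_def
    by (intro open_Int continuous_open_vimage open_Collect_less V continuous_intros)
  have sU: "4 * s x ^ 3 - 3 * s x = 1 - 2 * x" "Re (s x) > 0" "Re (4 * s x ^ 2 - 1) > 0" if "x \<in> U" for x
    using \<sigma>V[of "1 - 2 * x"] that by (auto simp: U_def s_def)
  have rad: "(4 * s x ^ 2 - 1) / 3 \<notin> \<real>\<^sub>\<le>\<^sub>0" if "x \<in> U" for x
    using sU(3)[OF that] by (auto simp: complex_nonpos_Reals_iff)
  have h2: "h x ^ 2 = (4 * s x ^ 2 - 1) / 3" for x by (simp add: h_def)
  have h0: "h x \<noteq> 0" if "x \<in> U" for x using rad[OF that] by (auto simp: h_def)
  have Re_sh: "Re (s x + h x) > 0" if "x \<in> U" for x
  proof -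
    have "Re (h x) \<ge> 0" unfolding h_def by (rule Re_csqrt)
    thus ?thesis using sU(2)[OF that] by simp
  qed
  have sh: "s x + h x \<noteq> 0" if "x \<in> U" for x
  proof
    assume "s x + h x = 0"
    with Re_sh[OF that] show False by (simp only: zero_complex.simps)
  qed
  have Re_q: "Re (q x) > 0" if "x \<in> U" for x
    using Re_sh[OF that] sh[OF that] unfolding q_def by (simp add: Re_divide' del: plus_complex.simps)
  \<comment> \<open>With 3 h^2 = 4 s^2 - 1 one has (s + h)^2 p_f(v) = 16 s^2 - 12 h^2 = 4 and (s +
    h)^3 p_e(v) = 8 (4 s^3 - 3 s).\<close>
  have v_eqs: "oct_pf (v x) = q x ^ 2" "oct_pe (v x) = q x ^ 3 * (1 - 2 * x)" "v x \<in> oct_dom" if x: "x \<in> U" for x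
  proof -
    define t where "t = 1 / (s x + h x)"
    have t: "t * (s x + h x) = 1" using sh[OF x] by (simp add: t_def)
    have vt: "v x = (s x - h x) * t" "q x = 2 * t" by (simp_all add: v_def q_def t_def)
    have h2': "3 * h x ^ 2 = 4 * s x ^ 2 - 1" unfolding h2 by simp
    show pf: "oct_pf (v x) = q x ^ 2"
      unfolding oct_pf_def vt using t h2' by algebra
    show "oct_pe (v x) = q x ^ 3 * (1 - 2 * x)"
      unfolding oct_pe_def vt sU(1)[OF x, symmetric] using t h2' by algebra
    have "q x \<noteq> 0" using Re_q[OF x] by auto
    moreover have "v x \<noteq> 1" using h0[OF x] sh[OF x] by (simp add: v_def)
    ultimately show "v x \<in> oct_dom" using pf by (simp add: oct_dom_def)
  qed
  \<comment> \<open>Positivity of the real part singles out \<open>q x\<close> as the principal root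
    of its square.\<close>
  have q_v: "oct_q (v x) = q x" if "x \<in> U" for x
    unfolding oct_q_def v_eqs(1)[OF that] using Re_q[OF that] by (simp add: csqrt_square)
  have x_v: "oct_x (v x) = x" if "x \<in> U" for x
  proof -
    have "q x \<noteq> 0" using Re_q[OF that] by auto
    thus ?thesis unfolding oct_x_def q_v[OF that] v_eqs(2)[OF that] by simp
  qed
  have hol_s: "s holomorphic_on U" unfolding s_def
    by (rule holomorphic_on_compose_gen[OF _ \<sigma>, unfolded o_def]) (auto simp: U_def intro!: holomorphic_intros)
  have hol_h: "h holomorphic_on U" unfolding h_def
    by (intro holomorphic_on_csqrt' holomorphic_intros hol_s) (use rad in auto)
  have hol_v: "v holomorphic_on U" unfolding v_def
    by (intro holomorphic_intros hol_s hol_h) (use sh in auto)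
  have hol_q: "q holomorphic_on U" unfolding q_def
    by (intro holomorphic_intros hol_s hol_h) (use sh in auto)
  have hol_rv: "(\<lambda>x. r (v x)) holomorphic_on U"
    by (rule holomorphic_on_compose_gen[OF hol_v oct_sol_holomorphic[OF sol], unfolded o_def])
       (use v_eqs(3) in auto)
  have pos_not: "z \<notin> \<real>\<^sub>\<le>\<^sub>0" if "Re z > 0" for z using that by (auto simp: complex_nonpos_Reals_iff)
  have hol_g: "g holomorphic_on U" unfolding g_def
  proof (intro holomorphic_on_mult holomorphic_on_powr hol_rv hol_q holomorphic_intros)
    fix x assume x: "x \<in> U"
    show "q x \<notin> \<real>\<^sub>\<le>\<^sub>0" by (rule pos_not[OF Re_q[OF x]])
    show "1 - x \<notin> \<real>\<^sub>\<le>\<^sub>0" using x by (intro pos_not) (simp add: U_def)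
  qed
  have lin: "1 - 2 * complex_of_real ((1 - t) / 2) = of_real t" for t
  proof -
    have "1 - 2 * ((1 - t) / 2) = t" by (simp add: field_simps)
    from arg_cong[OF this, of complex_of_real] show ?thesis
      by (simp only: of_real_diff of_real_mult of_real_1 of_real_numeral)
  qed
  have seg: "of_real ((1 - cosh y) / 2) \<in> U" for y
    using V1[OF cosh_real_ge_1[of y]] cosh_real_ge_1[of y]
    by (simp only: U_def lin Int_iff vimage_eq mem_Collect_eq) simp
  have at_cosh: "s (of_real ((1 - cosh y) / 2)) = of_real (cosh (y / 3))"
    "h (of_real ((1 - cosh y) / 2)) = of_real (sqrt ((4 * cosh (y / 3) ^ 2 - 1) / 3))" for y
  proof -
    show 1: "s (of_real ((1 - cosh y) / 2)) = of_real (cosh (y / 3))"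
      using \<sigma>_cosh[of y] by (simp only: s_def lin)
    have "1 \<le> cosh (y / 3) ^ 2" using cosh_real_ge_1[of "y / 3"] by (simp add: one_le_power)
    hence "0 \<le> (4 * cosh (y / 3) ^ 2 - 1) / 3" by simp
    hence "csqrt (of_real ((4 * cosh (y / 3) ^ 2 - 1) / 3)) = of_real (sqrt ((4 * cosh (y / 3) ^ 2 - 1) / 3))"
      using csqrt_of_real_nonneg[of "complex_of_real ((4 * cosh (y / 3) ^ 2 - 1) / 3)"]
      by (simp only: Re_complex_of_real Im_complex_of_real)
    thus "h (of_real ((1 - cosh y) / 2)) = of_real (sqrt ((4 * cosh (y / 3) ^ 2 - 1) / 3))"
      unfolding h_def 1 by simp
  qed
  have "0 \<in> U" using seg[of 0] by simp
  have v0: "v 0 = 0" using at_cosh[of 0] by (simp add: v_def)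
  have germ: "eventually (\<lambda>x. g x = eval_fps (fps_hypergeo [- \<nu>, \<nu> + 1] [1 - \<mu>] 1) x) (nhds 0)"
  proof -
    have "isCont v 0"
      using hol_v U \<open>0 \<in> U\<close> holomorphic_on_imp_continuous_on continuous_on_eq_continuous_at by blast
    hence "filterlim v (nhds 0) (nhds 0)"
      unfolding isCont_def v0 using v0 by (simp add: filterlim_iff eventually_nhds_conv_at)
    from eventually_compose_filterlim[OF oct_sol_hypergeo_x[OF sol \<mu>] this]
    have "eventually (\<lambda>x. (1 - oct_x (v x)) powr \<mu> * oct_q (v x) powr (3 * (\<nu> + \<mu>)) *
       eval_fps (fps_hypergeo [- \<nu>, \<nu> + 1] [1 - \<mu>] 1) (oct_x (v x)) = r (v x)) (nhds 0)" .
    moreover have "eventually (\<lambda>x. x \<in> U) (nhds 0)" by (rule eventually_nhds_in_open[OF U \<open>0 \<in> U\<close>])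
    ultimately show ?thesis
    proof eventually_elim
      case (elim x)
      have nz: "1 - x \<noteq> 0" "q x \<noteq> 0" using elim(2) Re_q[OF elim(2)] by (auto simp: U_def)
      have "(1 - x) powr (- \<mu>) * (1 - x) powr \<mu> = 1" "q x powr (- (3 * (\<nu> + \<mu>))) * q x powr (3 * (\<nu> + \<mu>)) = 1"
        using nz by (simp_all only: powr_add[symmetric]) simp_all
      thus ?case using elim(1) unfolding x_v[OF elim(2)] q_v[OF elim(2)] g_def by algebra
    qed
  qed
  define x0 :: complex where "x0 = of_real ((1 - cosh \<xi>) / 2)"
  have "closed_segment 0 x0 \<subseteq> U"
  proof
    fix x assume "x \<in> closed_segment 0 x0"
    then obtain t where t: "0 \<le> t" "t \<le> 1" "x = of_real (t * ((1 - cosh \<xi>) / 2))"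
      by (auto simp: closed_segment_def x0_def scaleR_conv_of_real)
    \<comment> \<open>Every point of the segment is (1 - cosh y)/2 for some real y, so
      \<open>seg\<close> covers it.\<close>
    have "1 \<le> 1 + t * (cosh \<xi> - 1)" using t(1) cosh_real_ge_1[of \<xi>] by simp
    hence "cosh (arcosh (1 + t * (cosh \<xi> - 1))) = 1 + t * (cosh \<xi> - 1)" by simp
    hence "t * ((1 - cosh \<xi>) / 2) = (1 - cosh (arcosh (1 + t * (cosh \<xi> - 1)))) / 2" by (simp add: field_simps)
    thus "x \<in> U" unfolding t(3) using seg by simp
  qed
  from gauss_hypgeo_eqI[OF U this hol_g germ]
  have G: "gauss_hypgeo (- \<nu>) (\<nu> + 1) (1 - \<mu>) x0 = g x0" .
  have "s x0 + h x0 = of_real (A_plus \<xi>)" "s x0 - h x0 = of_real (- A_minus \<xi>)"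
    unfolding x0_def at_cosh A_plus_def A_minus_def by simp_all
  hence w: "v x0 = w" and q: "q x0 = of_real (2 / A_plus \<xi>)"
    unfolding v_def q_def w_def by simp_all
  show "w \<in> oct_dom" using v_eqs(3)[of x0] seg[of \<xi>] w by (simp add: x0_def)
  have "1 - (1 - cosh \<xi>) / 2 = (1 + cosh \<xi>) / 2" by (simp add: field_simps)
  from arg_cong[OF this, of complex_of_real]
  have one: "1 - x0 = of_real ((1 + cosh \<xi>) / 2)"
    by (simp only: x0_def of_real_diff of_real_1)
  show "gauss_hypgeo (- \<nu>) (\<nu> + 1) (1 - \<mu>) (of_real ((1 - cosh \<xi>) / 2)) =
       of_real ((1 + cosh \<xi>) / 2) powr (- \<mu>) * of_real (2 / A_plus \<xi>) powr (- (3 * (\<nu> + \<mu>))) * r w"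
    unfolding x0_def[symmetric] using G[unfolded g_def w q one] .
qed

section \<open>The closed forms\<close>

text \<open>At u = -A_minus/A_plus the last identity is z^2 - 1 = -108 p_v / p_f^3 with denominators
  cleared, since p_f(u) = 4 / A_plus^2.\<close>

lemma A_plus_minus:
  assumes "\<xi> > 0"
  shows "A_minus \<xi> > 0" "A_plus \<xi> > 0"
    "A_minus \<xi> * A_plus \<xi> * (A_minus \<xi> + A_plus \<xi>) ^ 4 = 16 / 27 * sinh \<xi> ^ 2"
proof -
  define c where "c = cosh (\<xi> / 3)"
  define w where "w = sqrt ((4 * c ^ 2 - 1) / 3)"
  have c: "c > 1" using cosh_real_strict_mono[of 0 "\<xi> / 3"] assms by (simp add: c_def)
  hence c2: "c ^ 2 > 1" by (simp add: power2_eq_square less_1_mult)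
  have w2: "w ^ 2 = (4 * c ^ 2 - 1) / 3" using c2 by (simp add: w_def)
  have "c < w" unfolding w_def using c c2 by (intro real_less_rsqrt) simp
  have A: "A_minus \<xi> = w - c" "A_plus \<xi> = w + c"
    by (simp_all add: A_minus_def A_plus_def w_def c_def)
  show "A_minus \<xi> > 0" "A_plus \<xi> > 0" using \<open>c < w\<close> c unfolding A by simp_all
  have "cosh \<xi> = 4 * c ^ 3 - 3 * c" using cosh_triple[of "\<xi> / 3"] by (simp add: c_def)
  hence "sinh \<xi> ^ 2 = (4 * c ^ 3 - 3 * c) ^ 2 - 1" using cosh_square_eq[of \<xi>] by simp
  also have "\<dots> = (c ^ 2 - 1) * (4 * c ^ 2 - 1) ^ 2" by algebra
  finally have sinh: "sinh \<xi> ^ 2 = (c ^ 2 - 1) * (4 * c ^ 2 - 1) ^ 2" .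
  have "(w - c) * (w + c) * (w - c + (w + c)) ^ 4 = (w ^ 2 - c ^ 2) * (16 * (w ^ 2) ^ 2)"
    by algebra
  also have "\<dots> = 16 / 27 * sinh \<xi> ^ 2"
    unfolding sinh w2 by (simp add: field_simps power2_eq_square)
  finally have "(w - c) * (w + c) * (w - c + (w + c)) ^ 4 = 16 / 27 * sinh \<xi> ^ 2" .
  thus "A_minus \<xi> * A_plus \<xi> * (A_minus \<xi> + A_plus \<xi>) ^ 4 = 16 / 27 * sinh \<xi> ^ 2"
    unfolding A by simp
qed

lemma powi_eq_exp: "x > 0 \<Longrightarrow> x powi k = exp (of_int k * ln (x :: real))"
  using powr_real_of_int'[of x k] by (simp add: powr_def)

text \<open>All bases are positive, so the complex powers are real ones and combine through
  logarithms; sinh^2 = (cosh - 1)(cosh + 1) merges the two powers in cosh \<xi>.\<close>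

lemma legendre_P_oct_sol:
  assumes \<xi>: "\<xi> > 0" and sol: "oct_sol (of_real \<nu>) (of_real \<mu>) r" and \<mu>: "of_real \<mu> \<notin> (\<nat> :: complex set)"
  shows "legendre_P (of_real \<nu>) (of_real \<mu>) (cosh \<xi>) =
    of_real (2 powr (\<mu> - 3 * (\<nu> + \<mu>)) * inverse (Gamma (1 - \<mu>)) * sinh \<xi> powr (- \<mu>) *
      A_plus \<xi> powr (3 * (\<nu> + \<mu>))) * r (of_real (- A_minus \<xi> / A_plus \<xi>))"
proof -
  define w :: complex where "w = of_real (- A_minus \<xi> / A_plus \<xi>)"
  define C S P where "C = cosh \<xi>" and "S = sinh \<xi>" and "P = A_plus \<xi>"
  have P: "P > 0" using A_plus_minus[OF \<xi>] by (simp add: P_def)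
  have C: "C > 1" using cosh_real_strict_mono[of 0 \<xi>] \<xi> by (simp add: C_def)
  have S: "S > 0" using \<xi> by (simp add: S_def)
  have "S ^ 2 = (C - 1) * (C + 1)"
    using cosh_square_eq[of \<xi>] by (simp add: C_def S_def algebra_simps power2_eq_square)
  hence "ln (S ^ 2) = ln (C - 1) + ln (C + 1)" using C by (simp add: ln_mult)
  hence lnS: "2 * ln S = ln (C - 1) + ln (C + 1)" using S by (simp add: ln_realpow)
  have G: "gauss_hypgeo (- of_real \<nu>) (of_real \<nu> + 1) (1 - of_real \<mu>) (of_real ((1 - C) / 2)) =
      of_real ((1 + C) / 2) powr (- of_real \<mu>) * of_real (2 / P) powr (- (3 * (of_real \<nu> + of_real \<mu>))) * r w"
    unfolding C_def P_def w_def by (rule gauss_hypgeo_oct_sol(2)[OF sol \<mu>])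
  have powr: "complex_of_real x powr e = of_real (x powr y)" if "x > 0" "e = of_real y" for x y e
    using that by (simp add: powr_of_real)
  have "legendre_P (of_real \<nu>) (of_real \<mu>) C =
     1 / Gamma (1 - of_real \<mu>) * of_real ((C + 1) / (C - 1)) powr (of_real \<mu> / 2) *
     (of_real ((1 + C) / 2) powr (- of_real \<mu>) * of_real (2 / P) powr (- (3 * (of_real \<nu> + of_real \<mu>))) * r w)"
    unfolding legendre_P_def G ..
  also have "of_real ((C + 1) / (C - 1)) powr (of_real \<mu> / 2) = complex_of_real (((C + 1) / (C - 1)) powr (\<mu> / 2))"
    using C by (intro powr) simp_all
  also have "of_real ((1 + C) / 2) powr (- of_real \<mu>) = complex_of_real (((1 + C) / 2) powr (- \<mu>))"
    using C by (intro powr) simp_all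
  also have "of_real (2 / P) powr (- (3 * (of_real \<nu> + of_real \<mu>))) = complex_of_real ((2 / P) powr (- (3 * (\<nu> + \<mu>))))"
    using P by (intro powr) simp_all
  also have "1 / Gamma (1 - complex_of_real \<mu>) = of_real (inverse (Gamma (1 - \<mu>)))"
    using Gamma_complex_of_real[of "1 - \<mu>"] by (simp add: inverse_eq_divide)
  also have "of_real (inverse (Gamma (1 - \<mu>))) * of_real (((C + 1) / (C - 1)) powr (\<mu> / 2)) *
     (of_real (((1 + C) / 2) powr (- \<mu>)) * of_real ((2 / P) powr (- (3 * (\<nu> + \<mu>)))) * r w) =
     of_real (inverse (Gamma (1 - \<mu>)) * (((C + 1) / (C - 1)) powr (\<mu> / 2) * ((1 + C) / 2) powr (- \<mu>) *
       (2 / P) powr (- (3 * (\<nu> + \<mu>))))) * r w"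
    by (simp only: of_real_mult mult_ac)
  also have "((C + 1) / (C - 1)) powr (\<mu> / 2) * ((1 + C) / 2) powr (- \<mu>) * (2 / P) powr (- (3 * (\<nu> + \<mu>))) =
     2 powr (\<mu> - 3 * (\<nu> + \<mu>)) * S powr (- \<mu>) * P powr (3 * (\<nu> + \<mu>))"
  proof -
    have "\<mu> / 2 * (ln (C + 1) - ln (C - 1)) + - \<mu> * (ln (C + 1) - ln 2) + - (3 * (\<nu> + \<mu>)) * (ln 2 - ln P) =
       (\<mu> - 3 * (\<nu> + \<mu>)) * ln 2 + - \<mu> * ln S + 3 * (\<nu> + \<mu>) * ln P"
    proof -
      have "\<mu> * ln S = \<mu> / 2 * (ln (C - 1) + ln (C + 1))" unfolding lnS[symmetric] by simp
      thus ?thesis by (simp add: algebra_simps)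
    qed
    thus ?thesis using C S P
      by (simp add: powr_def exp_add[symmetric] ln_div add.commute[of 1 C])
  qed
  finally show ?thesis
    unfolding w_def[symmetric] unfolding C_def[symmetric] S_def[symmetric] P_def[symmetric]
    by (simp only: mult_ac)
qed

theorem theorem3p4:
  fixes n m :: int and \<xi> :: real
  assumes "\<xi> > 0"
  shows "A_plus \<xi> > 0 \<and> A_minus \<xi> > 0 \<and>
    legendre_P (- 1 / 6 + of_int n) (1 / 4 + of_int m) (cosh \<xi>) =
      complex_of_real
        (2 powi (- 2 * m - 3 * n) * inverse (Gamma (3 / 4 - real_of_int m)) *
         sinh \<xi> powr (- 1 / 4 - real_of_int m) *
         A_plus \<xi> powr (1 / 4 + 3 * real_of_int m + 3 * real_of_int n)) *
      oct_r n m (complex_of_real (- A_minus \<xi> / A_plus \<xi>)) \<and>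
    legendre_P (- 1 / 6 + of_int n) (- 1 / 4 - of_int m) (cosh \<xi>) =
      complex_of_real
        ((- 1) powi n * 2 powi (- 2 * m - 3 * n) * 3 powr (3 / 4 + 3 * real_of_int m) *
         inverse (Gamma (5 / 4 + real_of_int m)) *
         sinh \<xi> powr (- 1 / 4 - real_of_int m) *
         A_minus \<xi> powr (1 / 4 + 3 * real_of_int m + 3 * real_of_int n)) *
      oct_r_hat n m (complex_of_real (- A_plus \<xi> / A_minus \<xi>))"
proof (intro conjI)
  show pos: "A_plus \<xi> > 0" "A_minus \<xi> > 0" using A_plus_minus[OF assms] by auto
  define \<nu> \<mu> :: real where "\<nu> = - 1 / 6 + of_int n" and "\<mu> = 1 / 4 + of_int m"
  define k l where "k = 3 * n + 2 * m" and "l = 1 + 4 * m"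
  obtain r s where rs: "oct_sol (- 1 / 6 + of_int n) (1 / 4 + of_int m) r"
    "oct_sol (- 1 / 6 + of_int n) (- (1 / 4 + of_int m)) s" "oct_flip (of_real (oct_d n m)) k l r s"
    using oct_pair_int[of n m] unfolding oct_pair_def k_def l_def by blast
  have cpx: "- 1 / 6 + of_int n = complex_of_real \<nu>" "1 / 4 + of_int m = complex_of_real \<mu>"
    by (simp_all add: \<nu>_def \<mu>_def)
  have \<mu>: "complex_of_real \<mu> \<notin> \<nat>" "complex_of_real (- \<mu>) \<notin> \<nat>"
    using oct_order_not_Nats[of m] unfolding cpx by simp_all
  have sol: "oct_sol (of_real \<nu>) (of_real \<mu>) r" "oct_sol (of_real \<nu>) (of_real (- \<mu>)) s"
    using rs(1,2) unfolding cpx by simp_all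
  define w where "w = complex_of_real (- A_minus \<xi> / A_plus \<xi>)"
  have w: "w \<in> oct_dom" "w \<noteq> 0"
    using gauss_hypgeo_oct_sol(1)[OF sol(1) \<mu>(1)] pos by (simp_all add: w_def)
  have w': "1 / w = complex_of_real (- A_plus \<xi> / A_minus \<xi>)" "1 / w \<in> oct_dom" "1 / w \<noteq> 0"
    using inverse_in_oct_dom[OF w] w(2) by (simp_all add: w_def)
  have e: "1 / 4 + 3 * real_of_int m + 3 * real_of_int n = 3 * (\<nu> + \<mu>)"
    "- 1 / 4 - real_of_int m = - \<mu>" "3 / 4 - real_of_int m = 1 - \<mu>" "5 / 4 + real_of_int m = 1 + \<mu>"
    "3 / 4 + 3 * real_of_int m = 3 * \<mu>"
    by (simp_all add: \<nu>_def \<mu>_def algebra_simps)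
  \<comment> \<open>The fractional contributions 1/2 of 2 \<mu> and -1/2 of 3 \<nu> cancel.\<close>
  have two: "(2 :: real) powi (- 2 * m - 3 * n) = 2 powr (- 2 * \<mu> - 3 * \<nu>)"
    by (simp add: powi_eq_exp powr_def \<nu>_def \<mu>_def algebra_simps)
  have "legendre_P (of_real \<nu>) (of_real \<mu>) (cosh \<xi>) =
      complex_of_real (2 powi (- 2 * m - 3 * n) * inverse (Gamma (1 - \<mu>)) * sinh \<xi> powr (- \<mu>) *
         A_plus \<xi> powr (3 * (\<nu> + \<mu>))) * oct_r n m w"
    unfolding legendre_P_oct_sol[OF assms sol(1) \<mu>(1)] w_def[symmetric] oct_r_eq[OF rs(1) w(1)] two
    by (simp add: algebra_simps)
  thus "legendre_P (- 1 / 6 + of_int n) (1 / 4 + of_int m) (cosh \<xi>) =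
      complex_of_real
        (2 powi (- 2 * m - 3 * n) * inverse (Gamma (3 / 4 - real_of_int m)) *
         sinh \<xi> powr (- 1 / 4 - real_of_int m) *
         A_plus \<xi> powr (1 / 4 + 3 * real_of_int m + 3 * real_of_int n)) *
      oct_r n m (complex_of_real (- A_minus \<xi> / A_plus \<xi>))"
    unfolding cpx e w_def .
  \<comment> \<open>The order -\<mu> formula involves s at w, while the goal has
    \<open>oct_r_hat\<close> at 1/w. The flip relation at 1/w connects them, with B as its factor
    besides \<open>oct_d\<close>.\<close>
  define B where "B = (- (A_plus \<xi> / A_minus \<xi>)) powi k * ((A_minus \<xi> + A_plus \<xi>) / A_plus \<xi>) powi l"
  have B: "r (1 / w) = of_real (oct_d n m * B) * s w"
  proof -
    have "r (1 / w) = of_real (oct_d n m) * ((1 / w) powi k * (1 - w) powi l) * s w"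
      using rs(3) w'(2,3) unfolding oct_flip_def by (simp add: mult.assoc)
    also have "(1 / w) powi k * (1 - w) powi l = of_real B"
    proof -
      have "1 - w = of_real ((A_minus \<xi> + A_plus \<xi>) / A_plus \<xi>)"
        using pos by (simp add: w_def field_simps)
      thus ?thesis unfolding w'(1) B_def by simp
    qed
    finally show ?thesis by (simp add: mult_ac)
  qed
  have B0: "B \<noteq> 0" using pos by (simp add: B_def)
  have s: "s w = of_real (1 / B) * oct_r_hat n m (1 / w)"
    using B B0 oct_d_nonzero[of n m] by (simp add: oct_r_hat_def oct_r_eq[OF rs(1) w'(2)])
  have real: "2 powr (- \<mu> - 3 * (\<nu> - \<mu>)) * inverse (Gamma (1 + \<mu>)) * sinh \<xi> powr \<mu> *
      A_plus \<xi> powr (3 * (\<nu> - \<mu>)) * (1 / B) =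
      (- 1) powi n * 2 powi (- 2 * m - 3 * n) * 3 powr (3 * \<mu>) *
         inverse (Gamma (1 + \<mu>)) * sinh \<xi> powr (- \<mu>) * A_minus \<xi> powr (3 * (\<nu> + \<mu>))"
  proof -
    define p q S t where "p = A_plus \<xi>" and "q = A_minus \<xi>" and "S = sinh \<xi>" and "t = q + p"
    have pq: "p > 0" "q > 0" "t > 0" "S > 0" using pos assms by (simp_all add: p_def q_def t_def S_def)
    have "q * p * t ^ 4 * 27 = 16 * S ^ 2"
      using A_plus_minus(3)[OF assms] by (simp add: p_def q_def t_def S_def)
    hence "ln (q * p * t ^ 4 * 3 ^ 3) = ln (2 ^ 4 * S ^ 2)" by simp
    hence ln: "ln q + ln p + 4 * ln t + 3 * ln 3 = 4 * ln 2 + 2 * ln S"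
      using pq by (simp add: ln_mult ln_realpow del: power_numeral)
    have kl: "real_of_int k = 3 * \<nu> + 2 * \<mu>" "real_of_int l = 4 * \<mu>"
      by (simp_all add: k_def l_def \<nu>_def \<mu>_def)
    \<comment> \<open>k = 3 n + 2 m has the parity of n; this is the origin of the sign in the
      second formula.\<close>
    have sgn: "(- 1 :: real) powi k = (- 1) powi n"
      by (simp add: k_def power_int_minus_left)
    have "B = (- 1) powi n * (p / q) powi k * (t / p) powi l"
    proof -
      have "- (p / q) = (- 1) * (p / q)" by simp
      hence "(- (p / q)) powi k = (- 1) powi k * (p / q) powi k" by (simp only: power_int_mult_distrib)
      thus ?thesis by (simp add: B_def p_def q_def t_def sgn)
    qed
    also have "\<dots> = (- 1) powi n * exp ((3 * \<nu> + 2 * \<mu>) * (ln p - ln q) + 4 * \<mu> * (ln t - ln p))"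
      using pq by (simp add: powi_eq_exp kl ln_div exp_add)
    finally have B: "1 / B = (- 1) powi n * exp (- ((3 * \<nu> + 2 * \<mu>) * (ln p - ln q) + 4 * \<mu> * (ln t - ln p)))"
      unfolding exp_minus by (cases "even n") (simp_all add: power_int_minus_left field_simps)
    \<comment> \<open>Apart from the power 3 (\<nu> + \<mu>) of q, the quantities p, q, t enter
      through (q p t^4)^(-\<mu>). Replacing q p t^4 by 16/27 S^2 produces the power of 3, adjusts
      the power of 2 and turns S^\<mu> into S^(-\<mu>).\<close>
    have "(- \<mu> - 3 * (\<nu> - \<mu>)) * ln 2 + \<mu> * ln S + 3 * (\<nu> - \<mu>) * ln p +
        - ((3 * \<nu> + 2 * \<mu>) * (ln p - ln q) + 4 * \<mu> * (ln t - ln p)) =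
        (- 2 * \<mu> - 3 * \<nu>) * ln 2 + 3 * \<mu> * ln 3 + - \<mu> * ln S + 3 * (\<nu> + \<mu>) * ln q"
    proof -
      have "4 * ln t = 4 * ln 2 + 2 * ln S - ln q - ln p - 3 * ln 3" using ln by simp
      hence "\<mu> * (4 * ln t) = \<mu> * (4 * ln 2 + 2 * ln S - ln q - ln p - 3 * ln 3)" by simp
      thus ?thesis by (simp add: algebra_simps)
    qed
    from arg_cong[OF this, of exp]
    have "2 powr (- \<mu> - 3 * (\<nu> - \<mu>)) * S powr \<mu> * p powr (3 * (\<nu> - \<mu>)) *
        exp (- ((3 * \<nu> + 2 * \<mu>) * (ln p - ln q) + 4 * \<mu> * (ln t - ln p))) =
        2 powr (- 2 * \<mu> - 3 * \<nu>) * 3 powr (3 * \<mu>) * S powr (- \<mu>) * q powr (3 * (\<nu> + \<mu>))"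
      using pq unfolding exp_add by (simp add: powr_def)
    thus ?thesis unfolding B two p_def[symmetric] q_def[symmetric] S_def[symmetric]
      by (simp add: mult_ac)
  qed
  have "legendre_P (of_real \<nu>) (of_real (- \<mu>)) (cosh \<xi>) =
      complex_of_real (2 powr (- \<mu> - 3 * (\<nu> - \<mu>)) * inverse (Gamma (1 + \<mu>)) * sinh \<xi> powr \<mu> *
      A_plus \<xi> powr (3 * (\<nu> - \<mu>)) * (1 / B)) * oct_r_hat n m (1 / w)"
    unfolding legendre_P_oct_sol[OF assms sol(2) \<mu>(2)] w_def[symmetric] s by simp
  also have "complex_of_real (- \<mu>) = - 1 / 4 - of_int m" by (simp add: \<mu>_def)
  finally show "legendre_P (- 1 / 6 + of_int n) (- 1 / 4 - of_int m) (cosh \<xi>) =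
      complex_of_real
        ((- 1) powi n * 2 powi (- 2 * m - 3 * n) * 3 powr (3 / 4 + 3 * real_of_int m) *
         inverse (Gamma (5 / 4 + real_of_int m)) *
         sinh \<xi> powr (- 1 / 4 - real_of_int m) *
         A_minus \<xi> powr (1 / 4 + 3 * real_of_int m + 3 * real_of_int n)) *
      oct_r_hat n m (complex_of_real (- A_plus \<xi> / A_minus \<xi>))"
    unfolding cpx(1) e real w'(1) .
qed

end
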